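(* Let $p\geq 1$. There exist $\varepsilon_p>0$ and a constant $C_p>0$, both depending only on $p$ (and on the fixed universal constants $c_1,c_2$ of the context), such that the following holds. Let $K\subset\mathbb{R}^2$ be an origin-symmetric convex body with area $A(K)=\pi$. If for some $\varepsilon$ with $0<\varepsilon<\varepsilon_p$ $$\left(\frac{\Omega_p^{2+p}(K)}{2^{2+p}A^{2-p}(K)}\right)^{\frac{1}{p}}>\pi^2(1-\varepsilon),$$ then there exist a disk $\mathcal{D}$, an ellipse $\mathcal{E}$ and a special linear transformation $T\in SL(2,\mathbb{R})$ such that $$\mathcal{E}\subseteq TK\subseteq \left(1+\left(\frac{4}{3}\right)^{\frac{3}{4}}\frac{2c_2}{c_1^2}\varepsilon^{\frac{3}{10}}\right)\mathcal{D}$$ and $$d_{\mathcal{H}}\left(\mathcal{E},\left(1+\left(\frac{4}{3}\right)^{\frac{3}{4}}\frac{2c_2}{c_1^2}\varepsilon^{\frac{3}{10}}\right)\mathcal{D}\right)<C_p\,\varepsilon^{\frac{3}{10}}.$$ In particular, $$d_{\mathcal{H}}\left(TK,\mathcal{E}\right)<C_p\,\varepsilon^{\frac{3}{10}}.$$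
   Context: A convex body in $\mathbb{R}^2$ is a compact convex set with non-empty interior; it is origin-symmetric if $K=-K$. $A(\cdot)$ denotes area. Disks and ellipses are understood as solid (filled) sets. For a scalar $r>0$ and a set $L$, $rL=\{rx: x\in L\}$. The support function of a convex body $K$ is $s_K(z)=\max_{y\in\partial K}\langle z,y\rangle$ for $z\in\mathbb{S}^1$. The Hausdorff distance between convex bodies $K,L$ is $d_{\mathcal{H}}(K,L)=\max_{\mathbb{S}^1}|s_K-s_L|$. For $p\ge 1$ and a convex body $K\subset\mathbb{R}^2$ with the origin in its interior, the $p$-affine surface area (for $n=2$) is $$\Omega_p(K)=\int_{\partial K}\frac{\kappa(x)^{\frac{p}{2+p}}}{\langle x,\mathbf{n}_K(x)\rangle^{\frac{2(p-1)}{2+p}}}\,d\mu_{\partial K}(x),$$ where $\mu_{\partial K}$ is the usual arc-length (one-dimensional Hausdorff) measure on $\partial K$, $\mathbf{n}_K(x)$ is the outward unit normal and $\kappa(x)$ the curvature of $\partial K$ at $x$. For a general (non-smooth) convex body, $\kappa$ and $\mathbf{n}_K$ are taken in the generalized sense, defined $\mu_{\partial K}$-almost everywhere by Alexandrov's theorem on almost-everywhere second-order differentiability of the boundary. The constants $c_1,c_2>0$ are fixed universal constants with the property that for every origin-symmetric convex body $K\subset\mathbb{R}^2$ of area $\pi$ there is a special linear transformation $S\in SL(2,\mathbb{R})$ such that $c_1\le s_{SK}\le c_2$ on $\mathbb{S}^1$ (such constants exist by John's lemma). *)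

theory Defs
  imports "HOL-Analysis.Analysis"
begin

section \<open>Planar convex bodies\<close>

definition convex_body :: "(real^2) set \<Rightarrow> bool" where
  "convex_body K \<longleftrightarrow> compact K \<and> convex K \<and> interior K \<noteq> {}"

definition origin_symmetric :: "(real^2) set \<Rightarrow> bool" where
  "origin_symmetric K \<longleftrightarrow> uminus ` K = K"

abbreviation area :: "(real^2) set \<Rightarrow> real" where
  "area \<equiv> measure lebesgue"

abbreviation scaled_set :: "real \<Rightarrow> (real^2) set \<Rightarrow> (real^2) set" where
  "scaled_set r L \<equiv> (\<lambda>x. r *\<^sub>R x) ` L"

abbreviation mat_image :: "real^2^2 \<Rightarrow> (real^2) set \<Rightarrow> (real^2) set" where
  "mat_image S K \<equiv> (\<lambda>x. S *v x) ` K"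

definition special_linear :: "real^2^2 \<Rightarrow> bool" where
  "special_linear S \<longleftrightarrow> det S = 1"

text \<open>Disks and ellipses are solid and nondegenerate; the centre is arbitrary.\<close>

definition is_disk :: "(real^2) set \<Rightarrow> bool" where
  "is_disk D \<longleftrightarrow> (\<exists>c r. r > 0 \<and> D = cball c r)"

definition is_ellipse :: "(real^2) set \<Rightarrow> bool" where
  "is_ellipse E \<longleftrightarrow>
    (\<exists>(c :: real^2) (A :: real^2^2). invertible A \<and> E = (\<lambda>x. c + A *v x) ` cball 0 1)"

text \<open>The suprema in the next two definitions are over compact nonempty sets, and are attained,
  when the arguments are convex bodies.\<close>

definition support_fun :: "(real^2) set \<Rightarrow> real^2 \<Rightarrow> real" where
  "support_fun K z = (SUP y\<in>frontier K. z \<bullet> y)"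

definition hausdorff_distance :: "(real^2) set \<Rightarrow> (real^2) set \<Rightarrow> real" where
  "hausdorff_distance K L = (SUP z\<in>sphere 0 1. \<bar>support_fun K z - support_fun L z\<bar>)"

definition john_constants :: "real \<Rightarrow> real \<Rightarrow> bool" where
  "john_constants c1 c2 \<longleftrightarrow> c1 > 0 \<and> c2 > 0 \<and>
    (\<forall>K. convex_body K \<and> origin_symmetric K \<and> area K = pi \<longrightarrow>
      (\<exists>S. special_linear S \<and>
        (\<forall>z\<in>sphere 0 1. c1 \<le> support_fun (mat_image S K) z \<and>
                         support_fun (mat_image S K) z \<le> c2)))"

section \<open>One-dimensional Hausdorff measure\<close>

text \<open>Boundedness of the covering sets is required because \<^const>\<open>diameter\<close> is a supremum in
  the reals, which carries no information for unbounded sets.\<close>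

definition hausdorff1_covers :: "real \<Rightarrow> 'a::metric_space set \<Rightarrow> (nat \<Rightarrow> 'a set) set" where
  "hausdorff1_covers \<delta> A =
    {U. A \<subseteq> (\<Union>i. U i) \<and> (\<forall>i. bounded (U i) \<and> diameter (U i) \<le> \<delta>)}"

definition hausdorff1_pre :: "real \<Rightarrow> 'a::metric_space set \<Rightarrow> ennreal" where
  "hausdorff1_pre \<delta> A = (INF U\<in>hausdorff1_covers \<delta> A. \<Sum>i. ennreal (diameter (U i)))"

definition hausdorff1_outer :: "'a::metric_space set \<Rightarrow> ennreal" where
  "hausdorff1_outer A = (SUP \<delta>\<in>{0<..}. hausdorff1_pre \<delta> A)"

definition hausdorff1_measure :: "'a::metric_space measure" where
  "hausdorff1_measure =
    measure_of UNIV (lambda_system UNIV (Pow UNIV) hausdorff1_outer) hausdorff1_outer"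

lemma hausdorff1_pre_mono: "A \<subseteq> B \<Longrightarrow> hausdorff1_pre \<delta> A \<le> hausdorff1_pre \<delta> B"
  unfolding hausdorff1_pre_def hausdorff1_covers_def by (rule INF_superset_mono) auto

lemma hausdorff1_pre_countably_subadditive:
  "hausdorff1_pre \<delta> (\<Union>i::nat. A i) \<le> (\<Sum>i. hausdorff1_pre \<delta> (A i))"
proof (rule ennreal_le_epsilon)
  fix e :: real
  assume fin: "(\<Sum>i. hausdorff1_pre \<delta> (A i)) < top" and e: "0 < e"
  have "\<exists>U\<in>hausdorff1_covers \<delta> (A i).
      (\<Sum>n. ennreal (diameter (U n))) \<le> hausdorff1_pre \<delta> (A i) + ennreal (e * (1/2)^Suc i)" for i
  proof -
    have "hausdorff1_pre \<delta> (A i) < top"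
      using ennreal_suminf_lessD[OF fin] .
    then have "hausdorff1_pre \<delta> (A i) < hausdorff1_pre \<delta> (A i) + ennreal (e * (1/2)^Suc i)"
      using e ennreal_add_left_cancel_less[of "hausdorff1_pre \<delta> (A i)" 0 "ennreal (e * (1/2)^Suc i)"]
      by (simp add: less_top)
    then show ?thesis
      unfolding hausdorff1_pre_def INF_less_iff by (auto intro: less_imp_le)
  qed
  then obtain U where U: "\<And>i. U i \<in> hausdorff1_covers \<delta> (A i)"
    and Usum: "\<And>i. (\<Sum>n. ennreal (diameter (U i n)))
      \<le> hausdorff1_pre \<delta> (A i) + ennreal (e * (1/2)^Suc i)"
    by metis
  define V where "V = (\<lambda>k. case prod_decode k of (i, n) \<Rightarrow> U i n)"
  have "V \<in> hausdorff1_covers \<delta> (\<Union>i. A i)"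
  proof -
    have "\<exists>k. x \<in> V k" if "x \<in> A i" for x i
    proof -
      from that U[of i] obtain n where "x \<in> U i n"
        by (auto simp: hausdorff1_covers_def)
      then have "x \<in> V (prod_encode (i, n))" by (simp add: V_def)
      then show ?thesis ..
    qed
    moreover have "bounded (V k) \<and> diameter (V k) \<le> \<delta>" for k
      using U by (auto simp: hausdorff1_covers_def V_def split: prod.split)
    ultimately show ?thesis by (auto simp: hausdorff1_covers_def)
  qed
  then have "hausdorff1_pre \<delta> (\<Union>i. A i) \<le> (\<Sum>k. ennreal (diameter (V k)))"
    unfolding hausdorff1_pre_def by (rule INF_lower)
  also have "\<dots> = (\<Sum>k. (\<lambda>(i, n). ennreal (diameter (U i n))) (prod_decode k))"
    by (intro suminf_cong) (simp add: V_def split: prod.split)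
  also have "\<dots> = (\<Sum>i. \<Sum>n. ennreal (diameter (U i n)))"
    by (rule suminf_ennreal_2dimen) simp
  also have "\<dots> \<le> (\<Sum>i. hausdorff1_pre \<delta> (A i) + ennreal (e * (1/2)^Suc i))"
    by (intro suminf_le Usum) auto
  also have "\<dots> = (\<Sum>i. hausdorff1_pre \<delta> (A i)) + (\<Sum>i. ennreal (e * (1/2)^Suc i))"
    by (rule suminf_add[symmetric]) auto
  also have "(\<Sum>i. ennreal (e * (1/2)^Suc i)) = ennreal e"
    using e sums_mult[OF power_half_series, of e] by (intro suminf_ennreal_eq) auto
  finally show "hausdorff1_pre \<delta> (\<Union>i. A i) \<le> (\<Sum>i. hausdorff1_pre \<delta> (A i)) + ennreal e" .
qed

lemma outer_measure_space_hausdorff1: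
  "outer_measure_space (Pow UNIV) (hausdorff1_outer :: 'a::metric_space set \<Rightarrow> ennreal)"
proof -
  have pre_empty: "hausdorff1_pre \<delta> ({} :: 'a set) = 0" if "\<delta> > 0" for \<delta>
  proof -
    have "hausdorff1_pre \<delta> ({} :: 'a set) \<le> (\<Sum>i::nat. ennreal (diameter ({} :: 'a set)))"
      unfolding hausdorff1_pre_def using that
      by (intro INF_lower) (auto simp: hausdorff1_covers_def)
    then show ?thesis by simp
  qed
  have empty: "hausdorff1_outer ({} :: 'a set) = 0"
    unfolding hausdorff1_outer_def by (auto simp: pre_empty intro!: antisym SUP_least)
  have mono: "hausdorff1_outer A \<le> hausdorff1_outer B" if "A \<subseteq> B" for A B :: "'a set"
    unfolding hausdorff1_outer_def using that by (intro SUP_mono) (auto intro: hausdorff1_pre_mono)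
  have sub: "hausdorff1_outer (\<Union>i. A i) \<le> (\<Sum>i. hausdorff1_outer (A i))"
    for A :: "nat \<Rightarrow> 'a set"
  proof -
    have "hausdorff1_pre \<delta> (\<Union>i. A i) \<le> (\<Sum>i. hausdorff1_outer (A i))" if "\<delta> > 0" for \<delta>
    proof -
      note hausdorff1_pre_countably_subadditive[of \<delta> A]
      also have "(\<Sum>i. hausdorff1_pre \<delta> (A i)) \<le> (\<Sum>i. hausdorff1_outer (A i))"
        unfolding hausdorff1_outer_def using that by (intro suminf_le SUP_upper) auto
      finally show ?thesis .
    qed
    then show ?thesis
      by (subst hausdorff1_outer_def) (auto intro: SUP_least)
  qed
  show ?thesis
    using empty mono sub
    by (auto simp: outer_measure_space_def positive_def increasing_def countably_subadditive_def)
qed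

lemma
  fixes A :: "'a::metric_space set"
  shows space_hausdorff1_measure: "space (hausdorff1_measure :: 'a measure) = UNIV"
    and sets_hausdorff1_measure:
      "sets (hausdorff1_measure :: 'a measure) = lambda_system UNIV (Pow UNIV) hausdorff1_outer"
    and emeasure_hausdorff1_measure:
      "A \<in> sets hausdorff1_measure \<Longrightarrow> emeasure hausdorff1_measure A = hausdorff1_outer A"
proof -
  interpret sigma_algebra UNIV "Pow UNIV :: 'a set set" by (rule sigma_algebra_Pow)
  have ms: "measure_space (UNIV :: 'a set)
      (lambda_system UNIV (Pow UNIV) hausdorff1_outer) hausdorff1_outer"
    by (rule caratheodory_lemma[OF outer_measure_space_hausdorff1])
  then interpret L: sigma_algebra "UNIV :: 'a set"
      "lambda_system UNIV (Pow UNIV) hausdorff1_outer"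
    by (simp add: measure_space_def)
  show "space (hausdorff1_measure :: 'a measure) = UNIV"
    by (simp add: hausdorff1_measure_def space_measure_of_conv)
  show sets: "sets (hausdorff1_measure :: 'a measure)
      = lambda_system UNIV (Pow UNIV) hausdorff1_outer"
    by (simp add: hausdorff1_measure_def L.sets_measure_of_eq del: Pow_UNIV)
  show "emeasure hausdorff1_measure A = hausdorff1_outer A"
    if A: "A \<in> sets (hausdorff1_measure :: 'a measure)"
  proof -
    have "emeasure (measure_of UNIV (lambda_system UNIV (Pow UNIV) hausdorff1_outer)
        hausdorff1_outer) A = hausdorff1_outer A"
      using ms A unfolding sets measure_space_def by (intro emeasure_measure_of_sigma) auto
    then show ?thesis by (simp only: hausdorff1_measure_def)
  qed
qed

section \<open>Generalized curvature and the $p$-affine surface area\<close>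

definition is_outer_normal :: "(real^2) set \<Rightarrow> real^2 \<Rightarrow> real^2 \<Rightarrow> bool" where
  "is_outer_normal K x u \<longleftrightarrow> norm u = 1 \<and> (\<forall>y\<in>K. u \<bullet> y \<le> u \<bullet> x)"

text \<open>Meaningful only at boundary points with exactly one outer unit normal, i.e. where the
  boundary is differentiable.\<close>

definition outer_normal :: "(real^2) set \<Rightarrow> real^2 \<Rightarrow> real^2" where
  "outer_normal K x = (THE u. is_outer_normal K x u)"

definition rot90 :: "real^2 \<Rightarrow> real^2" where
  "rot90 u = vector [- u $ 2, u $ 1]"

text \<open>Near \<open>x\<close>, the boundary of \<open>K\<close> is the graph, over the supporting line at \<open>x\<close> with outer unit
  normal \<open>u\<close>, of the nonnegative convex function below; the height is measured inwards.\<close>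

definition boundary_height :: "(real^2) set \<Rightarrow> real^2 \<Rightarrow> real^2 \<Rightarrow> real \<Rightarrow> real" where
  "boundary_height K x u t = Inf {s. x + t *\<^sub>R rot90 u - s *\<^sub>R u \<in> K}"

text \<open>At a point with unique normal the height function vanishes at \<open>0\<close> together with its
  derivative, so Alexandrov's second-order expansion there reads
  \<open>boundary_height K x u t = k / 2 * t\<^sup>2 + o(t\<^sup>2)\<close>.\<close>

definition has_gen_curvature :: "(real^2) set \<Rightarrow> real^2 \<Rightarrow> real \<Rightarrow> bool" where
  "has_gen_curvature K x k \<longleftrightarrow> (\<exists>!u. is_outer_normal K x u) \<and>
    ((\<lambda>t. 2 * boundary_height K x (outer_normal K x) t / t\<^sup>2) \<longlongrightarrow> k) (at 0)"

text \<open>By Alexandrov's theorem the generalized curvature exists almost everywhere on the boundary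
  of a convex body; the value \<open>0\<close> on the exceptional null set is a convention.\<close>

definition gen_curvature :: "(real^2) set \<Rightarrow> real^2 \<Rightarrow> real" where
  "gen_curvature K x =
    (if \<exists>k. has_gen_curvature K x k then THE k. has_gen_curvature K x k else 0)"

definition p_affine_area :: "real \<Rightarrow> (real^2) set \<Rightarrow> real" where
  "p_affine_area p K =
    (LINT x:frontier K|hausdorff1_measure.
      gen_curvature K x powr (p / (2 + p)) /
      (x \<bullet> outer_normal K x) powr (2 * (p - 1) / (2 + p)))"

end

theory Submission
  imports Defs
begin

text \<open>
  An origin-symmetric body \<open>K\<close> is encoded by its gauge \<open>\<gamma>(\<theta>)\<close> at the unit vector \<open>e(\<theta>)\<close>, so that the
  boundary is the curve \<open>x(\<theta>) = e(\<theta>)/\<gamma>(\<theta>)\<close>.  Convexity says that at every \<open>\<theta>\<close> some sinusoid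
  \<open>\<gamma>(\<theta>) cos(\<phi> - \<theta>) + \<beta>(\<theta>) sin(\<phi> - \<theta>)\<close> in \<open>\<phi>\<close> stays below \<open>\<gamma>\<close>; the slope \<open>\<beta>\<close> is the derivative of \<open>\<gamma>\<close>
  outside a countable set.  Two numbers carry the whole argument: the area
  \<open>A = 1/2 \<integral> \<gamma>\<^sup>-\<^sup>2\<close> and \<open>b = 1/2 \<integral> (\<gamma>\<^sup>2 - \<beta>\<^sup>2)\<close>, both over a full turn; \<open>b\<close> is the area of the polar body.

  \<^emph>\<open>From the affine surface area to \<open>b\<close>.\<close>  In the angle \<open>\<theta>\<close>, the measure \<open>\<langle>x, n\<rangle> ds\<close> is \<open>\<gamma>\<^sup>-\<^sup>2 d\<theta>\<close> and
  \<open>\<kappa> \<langle>x, n\<rangle>\<^sup>-\<^sup>2 ds\<close> is \<open>\<gamma> (\<gamma> + \<gamma>'') d\<theta>\<close>, and the integrand of the \<open>p\<close>-affine area is the geometric mean of these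
  two with weights \<open>2/(2+p)\<close> and \<open>p/(2+p)\<close>.  Hoelder's inequality therefore gives
  \<open>\<Omega>\<^sub>p\<^sup>2\<^sup>+\<^sup>p \<le> (2 A)\<^sup>2 (2 b)\<^sup>p\<close>, and the hypothesis on \<open>K\<close> becomes \<open>b > \<pi> (1 - \<epsilon>)\<close>.  On a nonsmooth boundary, where the
  generalized curvature exists it is controlled by a lower limit of second differences of \<open>\<gamma>\<close>
  (\<open>curvature_bound\<close>), whose integral is at most \<open>2 b\<close> by Fatou's lemma and a summation by parts
  (\<open>curv_density_integral_le\<close>); Hausdorff measure on the boundary is dominated by \<open>|x'| d\<theta>\<close>
  (\<open>hausdorff1_outer_curve_le\<close>).  The outcome is \<open>p_affine_area_le\<close>.

  \<^emph>\<open>Stability of \<open>A b \<le> \<pi>\<^sup>2\<close>.\<close>  Use the parameter \<open>\<tau>\<close> with \<open>d\<tau> = \<gamma>\<^sup>-\<^sup>2 d\<theta>\<close>, twice the area swept by the radius.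
  Then \<open>x\<close> solves a Hill equation \<open>x'' + q x = 0\<close> with \<open>\<integral> q d\<tau> = 2 b\<close> over a full turn, and if \<open>A = \<pi>\<close> then
  \<open>x(\<tau> + \<pi>) = - x(\<tau>)\<close>.  For a fixed \<open>\<tau>\<^sub>0\<close> the solution \<open>y(\<tau>) = det(x(\<tau>\<^sub>0), x(\<tau>))\<close> and the trial function
  \<open>v(\<tau>) = sin(\<tau> - \<tau>\<^sub>0)\<close> vanish at the same points, so Jacobi's identity
  \<open>\<integral> (v'\<^sup>2 - q v\<^sup>2) = \<integral> (v' - v y'/y)\<^sup>2 \<ge> 0\<close> holds over a period.  Adding the same quantity for the base point
  \<open>\<tau>\<^sub>0 + \<pi>/2\<close> turns \<open>v\<^sup>2\<close> into \<open>1\<close>, and the sum of the two energies is \<open>\<pi> - b \<le> \<pi> \<epsilon>\<close>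
  (\<open>energy_integral_le_deficit\<close>).  Since \<open>(v' - v y'/y)/v\<close> is the derivative of \<open>log(v/y)\<close>, away from the common zeros
  \<open>det(x(\<tau>\<^sub>0), x(\<tau>))\<close> is a constant times \<open>sin(\<tau> - \<tau>\<^sub>0)\<close> up to a factor \<open>1 + O(\<epsilon>\<^sup>1\<^sup>/\<^sup>2)\<close> (\<open>cross_approx\<close>).

  \<^emph>\<open>From determinants to shape.\<close>  Choosing the base points \<open>0\<close>, \<open>\<pi>/2\<close> and two intermediate ones, the coordinates
  of \<open>x(\<tau>)\<close> in the basis \<open>x(0), x(\<pi>/2)\<close> are \<open>(cos \<tau>, sin \<tau>)\<close> up to \<open>O(\<epsilon>\<^sup>1\<^sup>/\<^sup>2)\<close> (\<open>u_close\<close>, \<open>w_close\<close>).  Mapping this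
  basis to a multiple of the standard one by a matrix \<open>T\<close> of determinant \<open>1\<close> squeezes \<open>T K\<close> between two
  discs about the origin whose radii differ by \<open>O(\<epsilon>\<^sup>1\<^sup>/\<^sup>2)\<close> (\<open>near_round\<close>).  As \<open>\<epsilon>\<^sup>1\<^sup>/\<^sup>2 \<le> \<epsilon>\<^sup>3\<^sup>/\<^sup>1\<^sup>0\<close>, the inner disc
  serves as the ellipse and the outer one as the enlarged disc.
\<close>

section \<open>Calculus with countably many exceptional points\<close>

text \<open>Suppose the value drops; after adding a small positive slope the derivative is positive off \<open>S\<close>
  while the value still drops.  Only countably many levels are attained on \<open>S\<close>, so some intermediate
  level \<open>c\<close> avoids them; at the last point with value at least \<open>c\<close> the function takes the value \<open>c\<close>
  and is increasing, a contradiction.\<close>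

lemma deriv_nonneg_off_countable_imp_le:
  fixes f :: "real \<Rightarrow> real"
  assumes ab: "a \<le> b" and cont: "continuous_on {a..b} f" and S: "countable S"
    and der: "\<And>x. x \<in> {a<..<b} - S \<Longrightarrow> (f has_real_derivative f' x) (at x)"
    and nonneg: "\<And>x. x \<in> {a<..<b} - S \<Longrightarrow> f' x \<ge> 0"
  shows "f a \<le> f b"
proof (rule ccontr)
  assume "\<not> f a \<le> f b"
  then have lt: "f b < f a" and ab': "a < b" using ab by (auto simp: not_le less_le)
  define e where "e = (f a - f b) / (2 * (b - a))"
  define g where "g x = f x + e * (x - a)" for x
  have e: "e > 0" using lt ab' by (simp add: e_def)
  have "e * (b - a) = (f a - f b) / 2" using ab' by (simp add: e_def field_simps)
  then have glt: "g b < g a" using lt by (simp add: g_def)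
  have gc: "continuous_on {a..b} g" unfolding g_def by (intro continuous_intros cont)
  have "uncountable {g b<..<g a}" using glt by (simp add: uncountable_open_interval)
  then obtain c where c: "g b < c" "c < g a" "c \<notin> g ` S"
    using S by (metis countable_image countable_subset greaterThanLessThan_iff subsetI)
  define A where "A = {x \<in> {a..b}. g x \<ge> c}"
  have "A = {a..b} \<inter> g -` {c..}" by (auto simp: A_def)
  then have "closed A" using continuous_closed_preimage[OF gc] by auto
  moreover have "bounded A" unfolding A_def by (rule bounded_subset[of "{a..b}"]) auto
  ultimately have "compact A" by (simp add: compact_eq_bounded_closed)
  moreover have "a \<in> A" using c ab' by (auto simp: A_def)
  ultimately obtain x where x: "x \<in> A" "\<And>y. y \<in> A \<Longrightarrow> y \<le> x"
    using compact_attains_sup[of A] by auto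
  have xb: "x < b" "a \<le> x" using x c by (auto simp: A_def less_le)
  have right: "g y < c" if "x < y" "y \<le> b" for y
    using x(2)[of y] that xb by (force simp: A_def)
  have gx: "g x = c"
  proof (rule antisym)
    show "c \<le> g x" using x by (simp add: A_def)
    have "((g) \<longlongrightarrow> g x) (at x within {a..b})"
      using gc xb by (simp add: continuous_on_def)
    then have l: "(g \<longlongrightarrow> g x) (at_right x)"
      using xb
      by (metis at_within_Icc_at_right at_within_Icc_at at_le greaterThanAtMost_iff
           atLeastAtMost_iff filterlim_at_split less_eq_real_def)
    have "eventually (\<lambda>y. y \<in> {x<..<b}) (at_right x)"
      using xb eventually_at_right_real[of x b] by simp
    then have "eventually (\<lambda>y. g y \<le> c) (at_right x)"
      by eventually_elim (use right in \<open>auto intro: less_imp_le\<close>)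
    then show "g x \<le> c" by (intro tendsto_upperbound[OF l]) auto
  qed
  have "x \<noteq> a" using gx c by auto
  then have xi: "x \<in> {a<..<b} - S" using xb gx c by auto
  have "(g has_real_derivative f' x + e) (at x)"
    unfolding g_def by (auto intro!: derivative_eq_intros der[OF xi])
  moreover have "f' x + e > 0" using nonneg[OF xi] e by simp
  ultimately obtain d where d: "d > 0" "\<And>h. 0 < h \<Longrightarrow> h < d \<Longrightarrow> g x < g (x + h)"
    using DERIV_pos_inc_right by metis
  define h where "h = min (d/2) (b - x)"
  have "g x < g (x + h)" using d xb by (intro d(2)) (auto simp: h_def)
  moreover have "g (x + h) < c" using d xb by (intro right) (auto simp: h_def)
  ultimately show False using gx by simp
qed

text \<open>Both \<open>f\<close> and the indefinite integral of \<open>g\<close> have derivative \<open>g\<close> off \<open>S\<close>, the latter because \<open>g\<close> is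
  continuous there; their difference is monotone in both directions.\<close>

lemma has_integral_deriv_off_countable:
  fixes f g :: "real \<Rightarrow> real"
  assumes ab: "a \<le> b" and cont: "continuous_on {a..b} f" and S: "countable S"
    and g: "g integrable_on {a..b}"
    and der: "\<And>x. x \<in> {a<..<b} - S \<Longrightarrow> (f has_real_derivative g x) (at x)"
    and gcont: "\<And>x. x \<in> {a<..<b} - S \<Longrightarrow> isCont g x"
  shows "(g has_integral (f b - f a)) {a..b}"
proof -
  define F where "F x = integral {a..x} g" for x
  have Fc: "continuous_on {a..b} F"
    unfolding F_def by (rule indefinite_integral_continuous_1[OF g])
  have Fd: "(F has_real_derivative g x) (at x)" if "x \<in> {a<..<b} - S" for x
  proof -
    have "(F has_vector_derivative g x) (at x within {a..b})"
      unfolding F_def using that gcont[OF that]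
      by (intro integral_has_vector_derivative_continuous_at[OF g, where S = "{}", simplified])
         (auto intro: continuous_at_imp_continuous_at_within)
    then show ?thesis
      using that by (simp add: at_within_Icc_at has_real_derivative_iff_has_vector_derivative)
  qed
  have "f a - F a \<le> f b - F b"
    by (rule deriv_nonneg_off_countable_imp_le[OF ab _ S, where f = "\<lambda>x. f x - F x" and f' = "\<lambda>_. 0"])
       (auto intro!: continuous_intros cont Fc derivative_eq_intros der Fd)
  moreover have "F a - f a \<le> F b - f b"
    by (rule deriv_nonneg_off_countable_imp_le[OF ab _ S, where f = "\<lambda>x. F x - f x" and f' = "\<lambda>_. 0"])
       (auto intro!: continuous_intros cont Fc derivative_eq_intros der Fd)
  moreover have "F a = 0" by (simp add: F_def)
  ultimately have "F b = f b - f a" by simp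
  then show ?thesis using integrable_integral[OF g] by (simp add: F_def)
qed

lemma integral_periodic_shift:
  fixes f :: "real \<Rightarrow> real"
  assumes per: "\<And>x. f (x + T) = f x" and int: "\<And>a b. f integrable_on {a..b}" and T: "T > 0"
    and le: "a \<le> b" "b \<le> a + T"
  shows "integral {b..b + T} f = integral {a..a + T} f"
proof -
  have "integral {a..a+T} f = integral {a..b} f + integral {b..a+T} f"
    using le by (subst Henstock_Kurzweil_Integration.integral_combine) (auto intro: int)
  moreover have "integral {b..b+T} f = integral {b..a+T} f + integral {a+T..b+T} f"
    using le by (subst Henstock_Kurzweil_Integration.integral_combine) (auto intro: int)
  moreover have "integral {a+T..b+T} f = integral {a..b} f"
    using integral_shift_real_ivl[of "a+T" T "b+T" f] by (simp add: per)
  ultimately show ?thesis by simp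
qed

lemma integral_periodic_shift_any:
  fixes f :: "real \<Rightarrow> real"
  assumes per: "\<And>x. f (x + T) = f x" and int: "\<And>a b. f integrable_on {a..b}" and T: "T > 0"
  shows "integral {b..b + T} f = integral {a..a + T} f"
proof -
  have *: "integral {b..b + T} f = integral {a..a + T} f" if "a \<le> b" "b \<le> a + real n * T" for n a b
    using that
  proof (induction n arbitrary: b)
    case (Suc n)
    show ?case
    proof (cases "b \<le> a + T")
      case True
      then show ?thesis using Suc.prems integral_periodic_shift[of f T a b] per int T by auto
    next
      case False
      then have "integral {b - T..b - T + T} f = integral {a..a + T} f"
        using Suc.prems by (intro Suc.IH) (auto simp: algebra_simps)
      moreover have "integral {b..b + T} f = integral {b - T..b - T + T} f"
        using T by (intro integral_periodic_shift per int) auto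
      ultimately show ?thesis by simp
    qed
  qed simp
  show ?thesis
  proof (cases "a \<le> b")
    case True
    obtain n where "(b - a) / T \<le> real n" using real_arch_simple by blast
    then show ?thesis using T True by (intro *[of _ _ n]) (auto simp: field_simps)
  next
    case False
    obtain n where "(a - b) / T \<le> real n" using real_arch_simple by blast
    then have "integral {a..a + T} f = integral {b..b + T} f"
      using T False by (intro *[of _ _ n]) (auto simp: field_simps)
    then show ?thesis ..
  qed
qed

lemma one_minus_cos_le: "1 - cos h \<le> \<bar>h\<bar>" "1 - cos h \<le> h\<^sup>2 / 2" for h :: real
proof -
  have eq: "1 - cos h = 2 * (sin (h/2))\<^sup>2"
    using cos_double_sin[of "h/2"] by simp
  have s: "\<bar>sin (h/2)\<bar> \<le> \<bar>h/2\<bar>" by (rule abs_sin_x_le_abs_x)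
  have "(sin (h/2))\<^sup>2 \<le> (h/2)\<^sup>2" using power_mono[OF s, of 2] by (simp add: power_divide)
  then show "1 - cos h \<le> h\<^sup>2 / 2" using eq by (simp add: power_divide)
  have "(sin (h/2))\<^sup>2 = \<bar>sin (h/2)\<bar> * \<bar>sin (h/2)\<bar>" by (simp add: power2_eq_square)
  also have "\<dots> \<le> \<bar>h/2\<bar> * 1" using s by (intro mult_mono) auto
  finally show "1 - cos h \<le> \<bar>h\<bar>" using eq by simp
qed

section \<open>Gauges of symmetric convex bodies in the angular variable\<close>

text \<open>The condition \<open>supp\<close> is convexity in the angular variable: the graph of \<open>\<gamma>\<close> lies above a sinusoid
  touching it at \<open>\<theta>\<close>, which is the linear functional of a supporting line read on unit vectors.\<close>

locale polar_gauge =
  fixes \<gamma> :: "real \<Rightarrow> real" and m M :: real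
  assumes m: "0 < m" and low: "m \<le> \<gamma> \<theta>" and upp: "\<gamma> \<theta> \<le> M"
    and per: "\<gamma> (\<theta> + pi) = \<gamma> \<theta>"
    and supp: "\<exists>b. \<forall>\<phi>. \<gamma> \<theta> * cos (\<phi> - \<theta>) + b * sin (\<phi> - \<theta>) \<le> \<gamma> \<phi>"
begin

text \<open>The choice depends only on the set of admissible slopes, which is the same at \<open>\<theta>\<close> and \<open>\<theta> + pi\<close>; hence \<open>\<beta>\<close>
  inherits the period of \<open>\<gamma>\<close>.\<close>

definition \<beta> :: "real \<Rightarrow> real" where
  "\<beta> \<theta> = (SOME b. \<forall>\<phi>. \<gamma> \<theta> * cos (\<phi> - \<theta>) + b * sin (\<phi> - \<theta>) \<le> \<gamma> \<phi>)"

lemma pos: "\<gamma> \<theta> > 0" using m low[of \<theta>] by simp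
lemma M: "M > 0" using pos[of 0] upp[of 0] by simp
lemma nz [simp]: "\<gamma> \<theta> \<noteq> 0" using pos[of \<theta>] by simp

lemma support: "\<gamma> \<theta> * cos (\<phi> - \<theta>) + \<beta> \<theta> * sin (\<phi> - \<theta>) \<le> \<gamma> \<phi>"
  using someI_ex[OF supp[of \<theta>]] by (auto simp: \<beta>_def)

lemma beta_per: "\<beta> (\<theta> + pi) = \<beta> \<theta>"
proof -
  have shift: "(\<forall>\<phi>. Q \<phi>) \<longleftrightarrow> (\<forall>\<phi>. Q (\<phi> + pi))" for Q :: "real \<Rightarrow> bool"
    by (metis diff_add_cancel)
  have "(\<forall>\<phi>. \<gamma> (\<theta> + pi) * cos (\<phi> - (\<theta> + pi)) + b * sin (\<phi> - (\<theta> + pi)) \<le> \<gamma> \<phi>) \<longleftrightarrow>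
        (\<forall>\<phi>. \<gamma> \<theta> * cos (\<phi> - \<theta>) + b * sin (\<phi> - \<theta>) \<le> \<gamma> \<phi>)" for b
    by (subst shift) (simp add: per)
  then show ?thesis by (simp add: \<beta>_def)
qed

lemma beta_bound: "\<bar>\<beta> \<theta>\<bar> \<le> M"
proof -
  have "\<beta> \<theta> \<le> M" using support[of \<theta> "\<theta> + pi/2"] upp[of "\<theta>+pi/2"] by simp
  moreover have "- \<beta> \<theta> \<le> M" using support[of \<theta> "\<theta> - pi/2"] upp[of "\<theta>-pi/2"] by simp
  ultimately show ?thesis by simp
qed

lemma gamma_lipschitz: "\<bar>\<gamma> x - \<gamma> y\<bar> \<le> 2 * M * \<bar>x - y\<bar>"
proof -
  have *: "\<gamma> \<theta> - 2 * M * \<bar>\<phi> - \<theta>\<bar> \<le> \<gamma> \<phi>" for \<theta> \<phi>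
  proof -
    have "\<gamma> \<theta> * (1 - cos (\<phi> - \<theta>)) \<le> M * \<bar>\<phi> - \<theta>\<bar>"
      using upp[of \<theta>] pos[of \<theta>] M one_minus_cos_le[of "\<phi> - \<theta>"] by (intro mult_mono) auto
    moreover have "\<bar>\<beta> \<theta> * sin (\<phi> - \<theta>)\<bar> \<le> M * \<bar>\<phi> - \<theta>\<bar>"
      unfolding abs_mult using beta_bound[of \<theta>] abs_sin_x_le_abs_x[of "\<phi>-\<theta>"] M by (intro mult_mono) auto
    moreover note support[of \<theta> \<phi>]
    ultimately show ?thesis by (simp add: algebra_simps abs_le_iff)
  qed
  show ?thesis using *[of x y] *[of y x] by (simp add: abs_le_iff abs_minus_commute)
qed

lemma gamma_cont: "continuous_on A \<gamma>"
proof -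
  have "(2*M)-lipschitz_on A \<gamma>"
    using gamma_lipschitz M by (intro lipschitz_onI) (auto simp: dist_real_def)
  then show ?thesis by (rule lipschitz_on_continuous_on)
qed

lemma gamma_isCont: "isCont \<gamma> x"
  using gamma_cont[of UNIV] by (simp add: continuous_on_eq_continuous_at)

lemma gamma_measurable [measurable]: "\<gamma> \<in> borel_measurable borel"
  by (rule borel_measurable_continuous_onI[OF gamma_cont])

definition B where "B \<theta> = \<beta> \<theta> + 2 * M * \<theta>"

text \<open>Comparing the supporting sinusoids at \<open>x\<close> and \<open>x + h\<close> bounds the decrease of \<open>\<beta>\<close> by
  \<open>(\<gamma> x + \<gamma> (x + h)) tan (h/2)\<close>: this is the inequality \<open>\<gamma> + \<gamma>'' \<ge> 0\<close> in finite form.  The linear term in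
  \<open>B\<close> compensates for it, so \<open>B\<close> is monotone.\<close>

lemma B_step: assumes "0 \<le> h" "h \<le> 1" shows "B x \<le> B (x + h)"
proof (cases "h = 0")
  case False
  with assms have h: "0 < h" "h \<le> 1" by auto
  have s: "sin h > 0" using h pi_gt3 by (intro sin_gt_zero) auto
  have s2: "h / 2 \<le> sin h"
  proof -
    have "sin 0 - 0 / 2 \<le> sin h - h / 2"
    proof (rule DERIV_nonneg_imp_nondecreasing[of 0 h "\<lambda>x. sin x - x / 2"])
      fix x assume x: "0 \<le> x" "x \<le> h"
      have "x\<^sup>2 \<le> 1" using x h by (simp add: abs_square_le_1)
      then have "cos x - 1/2 \<ge> 0" using one_minus_cos_le(2)[of x] by simp
      moreover have "((\<lambda>x. sin x - x / 2) has_real_derivative cos x - 1/2) (at x)"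
        by (auto intro!: derivative_eq_intros)
      ultimately show "\<exists>y. ((\<lambda>x. sin x - x / 2) has_real_derivative y) (at x) \<and> 0 \<le> y" by blast
    qed (use h in simp)
    then show ?thesis by simp
  qed
  have "\<gamma> x * cos h + \<beta> x * sin h \<le> \<gamma> (x + h)" using support[of x "x+h"] by simp
  moreover have "\<gamma> (x+h) * cos h - \<beta> (x+h) * sin h \<le> \<gamma> x" using support[of "x+h" x] by simp
  ultimately have "(\<beta> x - \<beta> (x+h)) * sin h \<le> (\<gamma> x + \<gamma> (x+h)) * (1 - cos h)"
    by (simp add: algebra_simps)
  also have "\<dots> \<le> (2 * M) * (h\<^sup>2/2)"
    using upp[of x] upp[of "x+h"] M one_minus_cos_le[of h] by (intro mult_mono) auto
  also have "\<dots> = (2 * M * h) * (h/2)" by (simp add: power2_eq_square)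
  also have "\<dots> \<le> (2 * M * h) * sin h" using s2 M h by (intro mult_left_mono) auto
  finally have "\<beta> x - \<beta> (x+h) \<le> 2 * M * h" using s by (simp add: mult_le_cancel_right_pos)
  then show ?thesis by (simp add: B_def algebra_simps)
qed simp

lemma B_mono: "mono B"
proof (rule monoI)
  have *: "x \<le> y \<Longrightarrow> y - x \<le> real n \<Longrightarrow> B x \<le> B y" for n x y
  proof (induction n arbitrary: y)
    case (Suc n)
    show ?case
    proof (cases "y - x \<le> 1")
      case True
      then show ?thesis using B_step[of "y - x" x] Suc.prems by simp
    next
      case False
      then have "B x \<le> B (y - 1)" using Suc.prems by (intro Suc.IH) auto
      also have "\<dots> \<le> B y" using B_step[of 1 "y - 1"] by simp
      finally show ?thesis .
    qed
  qed simp
  show "B x \<le> B y" if "x \<le> y" for x y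
    using *[OF that, of "nat \<lceil>y - x\<rceil>"] that by (meson real_nat_ceiling_ge)
qed

text \<open>A countable set, being contained in the set of jumps of a monotone function; off it \<open>\<beta>\<close> is the derivative of \<open>\<gamma>\<close>.\<close>

definition S where "S = {\<theta>. \<not> isCont \<beta> \<theta>}"

lemma S_countable: "countable S"
proof -
  have "isCont B \<theta> \<Longrightarrow> isCont \<beta> \<theta>" for \<theta>
  proof -
    assume "isCont B \<theta>"
    then have "isCont (\<lambda>x. B x - 2 * M * x) \<theta>" by (intro continuous_intros)
    then show ?thesis by (simp add: B_def)
  qed
  then have "S \<subseteq> {\<theta>. \<not> isCont B \<theta>}" by (auto simp: S_def)
  then show ?thesis using mono_ctble_discont[OF B_mono] countable_subset by blast
qed

lemma AE_not_S: "AE x in lborel. x \<notin> S"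
  by (intro AE_not_in countable_imp_null_set_lborel S_countable)

lemma beta_measurable [measurable]: "\<beta> \<in> borel_measurable borel"
proof -
  have "(\<lambda>x. B x - 2 * M * x) \<in> borel_measurable borel"
    using borel_measurable_mono[OF B_mono] by simp
  then show ?thesis by (simp add: B_def)
qed

text \<open>The supporting sinusoids at \<open>\<theta>\<close> and at \<open>\<theta> + h\<close> enclose the difference quotient between \<open>\<beta> \<theta>\<close> and \<open>\<beta> (\<theta> + h)\<close>,
  up to a term of order \<open>h\<close>.\<close>

lemma gamma_deriv: assumes "\<theta> \<notin> S" shows "(\<gamma> has_real_derivative \<beta> \<theta>) (at \<theta>)"
proof -
  have cont: "isCont \<beta> \<theta>" using assms by (simp add: S_def)
  have bound: "\<bar>(\<gamma> (\<theta> + h) - \<gamma> \<theta>) / h - \<beta> \<theta> * (sin h / h)\<bar> \<le> M * \<bar>h\<bar> / 2 + \<bar>\<beta> (\<theta> + h) - \<beta> \<theta>\<bar>"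
    if "h \<noteq> 0" for h
  proof -
    define q where "q = \<gamma> (\<theta> + h) - \<gamma> \<theta> - \<beta> \<theta> * sin h"
    have e: "\<gamma> x * (1 - cos h) \<le> M * (h\<^sup>2/2)" for x
      using upp[of x] M one_minus_cos_le[of h] by (intro mult_mono) auto
    have "- q \<le> \<gamma> \<theta> * (1 - cos h)"
      using support[of \<theta> "\<theta>+h"] by (simp add: q_def algebra_simps)
    then have 1: "- q \<le> M * (h\<^sup>2/2)" using e[of \<theta>] by linarith
    have "q \<le> \<gamma> (\<theta>+h) * (1 - cos h) + (\<beta> (\<theta>+h) - \<beta> \<theta>) * sin h"
      using support[of "\<theta>+h" \<theta>] by (simp add: q_def algebra_simps)
    moreover have "(\<beta> (\<theta>+h) - \<beta> \<theta>) * sin h \<le> \<bar>\<beta> (\<theta>+h) - \<beta> \<theta>\<bar> * \<bar>h\<bar>"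
      by (rule order_trans[OF abs_ge_self], unfold abs_mult)
         (intro mult_left_mono abs_sin_x_le_abs_x abs_ge_zero)
    ultimately have 2: "q \<le> M * (h\<^sup>2/2) + \<bar>\<beta> (\<theta>+h) - \<beta> \<theta>\<bar> * \<bar>h\<bar>" using e[of "\<theta>+h"] by linarith
    have "\<bar>q\<bar> \<le> M * (h\<^sup>2/2) + \<bar>\<beta> (\<theta>+h) - \<beta> \<theta>\<bar> * \<bar>h\<bar>"
      using 1 2 mult_nonneg_nonneg[OF abs_ge_zero abs_ge_zero, of "\<beta> (\<theta>+h) - \<beta> \<theta>" h] by linarith
    also have "\<dots> = (M * \<bar>h\<bar> / 2 + \<bar>\<beta> (\<theta> + h) - \<beta> \<theta>\<bar>) * \<bar>h\<bar>"
      by (simp add: algebra_simps power2_eq_square)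
    finally have "\<bar>q\<bar> / \<bar>h\<bar> \<le> M * \<bar>h\<bar> / 2 + \<bar>\<beta> (\<theta> + h) - \<beta> \<theta>\<bar>"
      using that by (simp add: divide_le_eq)
    moreover have "(\<gamma> (\<theta> + h) - \<gamma> \<theta>) / h - \<beta> \<theta> * (sin h / h) = q / h"
      by (simp add: q_def diff_divide_distrib)
    ultimately show ?thesis by (simp only: abs_divide)
  qed
  have bc: "((\<lambda>h. \<beta> (\<theta> + h)) \<longlongrightarrow> \<beta> \<theta>) (at 0)"
    using cont by (simp add: isCont_def LIM_offset_zero_iff)
  have "((\<lambda>h. M * \<bar>h\<bar> / 2 + \<bar>\<beta> (\<theta> + h) - \<beta> \<theta>\<bar>) \<longlongrightarrow> M * \<bar>0\<bar> / 2 + \<bar>\<beta> \<theta> - \<beta> \<theta>\<bar>) (at 0)"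
    by (intro tendsto_intros bc) auto
  then have lim0: "((\<lambda>h. M * \<bar>h\<bar> / 2 + \<bar>\<beta> (\<theta> + h) - \<beta> \<theta>\<bar>) \<longlongrightarrow> 0) (at 0)" by simp
  have "((\<lambda>h. (\<gamma> (\<theta> + h) - \<gamma> \<theta>) / h - \<beta> \<theta> * (sin h / h)) \<longlongrightarrow> 0) (at 0)"
    by (rule Lim_null_comparison[OF _ lim0]) (use bound in \<open>auto simp: eventually_at_filter\<close>)
  moreover have "((\<lambda>h. sin h / h) \<longlongrightarrow> (1::real)) (at 0)"
    using DERIV_sin[of "0::real"] by (simp add: DERIV_def)
  ultimately have "((\<lambda>h. ((\<gamma> (\<theta> + h) - \<gamma> \<theta>) / h - \<beta> \<theta> * (sin h / h)) + \<beta> \<theta> * (sin h / h)) \<longlongrightarrow> 0 + \<beta> \<theta> * 1) (at 0)"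
    by (intro tendsto_intros)
  then show ?thesis by (simp add: DERIV_def)
qed

lemma cont_beta_power_integrable:
  assumes "continuous_on {a..b} u"
  shows "(\<lambda>x. u x * \<beta> x ^ k) integrable_on {a..b}"
proof (rule measurable_bounded_by_integrable_imp_integrable_real)
  have "(\<lambda>x. \<beta> x ^ k) \<in> borel_measurable borel" by measurable
  then have "(\<lambda>x. \<beta> x ^ k) \<in> borel_measurable lebesgue"
    by (intro measurable_completion) simp
  then have "(\<lambda>x. \<beta> x ^ k) \<in> borel_measurable (lebesgue_on {a..b})"
    by (simp add: measurable_restrict_space1)
  moreover have "u \<in> borel_measurable (lebesgue_on {a..b})"
    by (rule continuous_imp_measurable_on_sets_lebesgue[OF assms]) auto
  ultimately show "(\<lambda>x. u x * \<beta> x ^ k) \<in> borel_measurable (lebesgue_on {a..b})" by measurable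
  show "(\<lambda>x. \<bar>u x\<bar> * M ^ k) integrable_on {a..b}"
    by (intro integrable_continuous_real continuous_intros assms)
  show "\<bar>u x * \<beta> x ^ k\<bar> \<le> \<bar>u x\<bar> * M ^ k" for x
    unfolding abs_mult power_abs using beta_bound[of x]
    by (intro mult_left_mono power_mono) auto
qed auto

text \<open>The form in which the fundamental theorem is used below: derivatives of smooth expressions in \<open>\<theta>\<close> and
  \<open>\<gamma> \<theta>\<close> are affine in \<open>\<beta>\<close> with continuous coefficients.\<close>

lemma ftc:
  assumes ab: "a \<le> b" and cont: "continuous_on {a..b} f"
    and p: "\<And>x. x \<in> {a..b} \<Longrightarrow> isCont p x" and q: "\<And>x. x \<in> {a..b} \<Longrightarrow> isCont q x"
    and der: "\<And>x. x \<in> {a<..<b} - S \<Longrightarrow> (f has_real_derivative p x + q x * \<beta> x) (at x)"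
  shows "((\<lambda>x. p x + q x * \<beta> x) has_integral (f b - f a)) {a..b}"
proof (rule has_integral_deriv_off_countable[OF ab cont S_countable _ der])
  have "(\<lambda>x. p x * \<beta> x ^ 0) integrable_on {a..b}" "(\<lambda>x. q x * \<beta> x ^ 1) integrable_on {a..b}"
    by (intro cont_beta_power_integrable continuous_at_imp_continuous_on ballI p q; simp)+
  then show "(\<lambda>x. p x + q x * \<beta> x) integrable_on {a..b}" by (auto intro: integrable_add)
  show "isCont (\<lambda>x. p x + q x * \<beta> x) x" if "x \<in> {a<..<b} - S" for x
    using that p[of x] q[of x] by (auto simp: S_def intro!: continuous_intros)
qed

section \<open>The deficit identity in the swept-area parameter\<close>

text \<open>Twice the area swept by the radius vector between the directions \<open>0\<close> and \<open>\<theta>\<close>.\<close>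

definition \<tau> :: "real \<Rightarrow> real" where "\<tau> \<theta> = (LBINT y=0..\<theta>. 1 / (\<gamma> y)\<^sup>2)"

lemma tau_0: "\<tau> 0 = 0" by (simp add: \<tau>_def zero_ereal_def[symmetric])

lemma inv_cont: "continuous_on A (\<lambda>y. 1 / (\<gamma> y)\<^sup>2)"
  by (intro continuous_intros gamma_cont) auto

lemma tau_deriv: "(\<tau> has_real_derivative 1 / (\<gamma> x)\<^sup>2) (at x)"
proof -
  define r where "r = \<bar>x\<bar> + 1"
  have "((\<lambda>u. LBINT y=0..u. 1 / (\<gamma> y)\<^sup>2) has_vector_derivative (1 / (\<gamma> x)\<^sup>2)) (at x within {-r..r})"
    using interval_integral_FTC2[of "-r" 0 r "\<lambda>y. 1 / (\<gamma> y)\<^sup>2" x] inv_cont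
    by (auto simp: r_def zero_ereal_def)
  moreover have "x \<in> {-r<..<r}" by (auto simp: r_def)
  ultimately have "((\<lambda>u. LBINT y=0..u. 1 / (\<gamma> y)\<^sup>2) has_vector_derivative (1 / (\<gamma> x)\<^sup>2)) (at x)"
    by (simp add: at_within_Icc_at)
  then show ?thesis unfolding \<tau>_def[abs_def] has_real_derivative_iff_has_vector_derivative .
qed

lemma tau_isCont: "isCont \<tau> x" using tau_deriv DERIV_isCont by blast
lemma tau_cont: "continuous_on A \<tau>" by (simp add: continuous_at_imp_continuous_on tau_isCont)

lemma tau_strict_mono: "x < y \<Longrightarrow> \<tau> x < \<tau> y"
  by (rule DERIV_pos_imp_increasing[of x y \<tau>]) (auto intro!: exI[of _ "1 / (\<gamma> _)\<^sup>2"] tau_deriv)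

lemma tau_mono_iff: "\<tau> x < \<tau> y \<longleftrightarrow> x < y"
  using tau_strict_mono by (metis less_asym neqE)

lemma inv_sq_has_integral:
  assumes "x \<le> y"
  shows "((\<lambda>t. 1 / (\<gamma> t)\<^sup>2) has_integral (\<tau> y - \<tau> x)) {x..y}"
  by (rule fundamental_theorem_of_calculus[OF assms])
     (metis tau_deriv has_real_derivative_iff_has_vector_derivative has_vector_derivative_at_within)

lemma tau_bounds:
  assumes xy: "x \<le> y"
  shows tau_upper: "\<tau> y - \<tau> x \<le> (y - x) / m\<^sup>2" and tau_lower: "(y - x) / M\<^sup>2 \<le> \<tau> y - \<tau> x"
proof -
  have c: "((\<lambda>_. c) has_integral (y - x) * c) {x..y}" for c :: real
    using has_integral_const_real[of c x y] xy by simp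
  have "1 / (\<gamma> t)\<^sup>2 \<le> 1 / m\<^sup>2" "1 / M\<^sup>2 \<le> 1 / (\<gamma> t)\<^sup>2" for t
    using m low[of t] upp[of t] pos[of t] by (intro frac_le power_mono; simp)+
  then show "\<tau> y - \<tau> x \<le> (y - x) / m\<^sup>2" "(y - x) / M\<^sup>2 \<le> \<tau> y - \<tau> x"
    using has_integral_le[OF inv_sq_has_integral[OF xy] c[of "1 / m\<^sup>2"]]
      has_integral_le[OF c[of "1 / M\<^sup>2"] inv_sq_has_integral[OF xy]] by simp_all
qed

lemma tau_surj: "\<exists>\<theta>. \<tau> \<theta> = t"
proof -
  define r where "r = \<bar>t\<bar> * M\<^sup>2"
  have r: "r \<ge> 0" "r / M\<^sup>2 = \<bar>t\<bar>" using M by (auto simp: r_def)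
  have "\<bar>t\<bar> \<le> \<tau> r" using tau_lower[of 0 r] r tau_0 by simp
  moreover have "\<tau> (-r) \<le> -\<bar>t\<bar>" using tau_lower[of "-r" 0] r tau_0 by simp
  ultimately have "\<exists>\<theta>\<ge>-r. \<theta> \<le> r \<and> \<tau> \<theta> = t"
    using r by (intro IVT' tau_cont) auto
  then show ?thesis by blast
qed

lemma tau_shift_general: "\<tau> (x + pi) = \<tau> x + \<tau> pi"
proof -
  have "((\<lambda>x. \<tau> (x + pi) - \<tau> x) has_real_derivative 0) (at x)" for x
  proof -
    have "((\<lambda>x. \<tau> (x + pi)) has_real_derivative 1 / (\<gamma> (x + pi))\<^sup>2) (at x)"
      using DERIV_shift tau_deriv by blast
    then show ?thesis using tau_deriv[of x] per[of x] by (auto intro!: derivative_eq_intros)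
  qed
  then have "\<tau> (x + pi) - \<tau> x = \<tau> (0 + pi) - \<tau> 0"
    by (rule DERIV_isconst_all[rule_format])
  then show ?thesis using tau_0 by simp
qed

lemma tau_shift: assumes "\<tau> pi = pi" shows "\<tau> (x + pi) = \<tau> x + pi"
  using tau_shift_general assms by simp

text \<open>The integrand \<open>v'\<^sup>2 - q v\<^sup>2\<close> of Jacobi's quadratic form for \<open>v = sin (\<tau> - \<tau> \<eta>)\<close>, transported to the angle
  (where \<open>q d\<tau> = \<gamma> (\<gamma> + \<gamma>'') d\<theta>\<close>) and integrated by parts, so that \<open>\<gamma>\<close> is differentiated only once.\<close>

definition energy :: "real \<Rightarrow> real \<Rightarrow> real" where
  "energy \<eta> \<theta> = (cos (\<tau> \<theta> - \<tau> \<eta>) / \<gamma> \<theta>)\<^sup>2 - (sin (\<tau> \<theta> - \<tau> \<eta>) * \<gamma> \<theta>)\<^sup>2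
     + (sin (\<tau> \<theta> - \<tau> \<eta>) * \<beta> \<theta>)\<^sup>2
     + 2 * sin (\<tau> \<theta> - \<tau> \<eta>) * cos (\<tau> \<theta> - \<tau> \<eta>) / \<gamma> \<theta> * \<beta> \<theta>"

text \<open>With \<open>v = sin (\<tau> - \<tau> \<eta>)\<close> and \<open>y\<close> the determinant of the boundary points at \<open>\<eta>\<close> and \<open>\<theta>\<close>, this is
  \<open>(v' - v y'/y) / \<gamma>\<close> with derivatives in \<open>\<tau>\<close>; dividing by \<open>\<gamma>\<close> makes its square a density with respect to the angle.\<close>

definition gap :: "real \<Rightarrow> real \<Rightarrow> real" where
  "gap \<eta> \<theta> = cos (\<tau> \<theta> - \<tau> \<eta>) / \<gamma> \<theta>
     - sin (\<tau> \<theta> - \<tau> \<eta>) * \<gamma> \<theta> * (cos (\<theta> - \<eta>) / sin (\<theta> - \<eta>)) + sin (\<tau> \<theta> - \<tau> \<eta>) * \<beta> \<theta>"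

text \<open>The area of the body minus the area of its polar body.\<close>

definition deficit :: real where
  "deficit = integral {0..pi} (\<lambda>\<theta>. 1 / (\<gamma> \<theta>)\<^sup>2 - (\<gamma> \<theta>)\<^sup>2 + (\<beta> \<theta>)\<^sup>2)"

lemma energy_integrable: "energy \<eta> integrable_on {a..b}"
proof -
  let ?s = "\<lambda>\<theta>. sin (\<tau> \<theta> - \<tau> \<eta>)" and ?c = "\<lambda>\<theta>. cos (\<tau> \<theta> - \<tau> \<eta>)"
  have "(\<lambda>\<theta>. ((?c \<theta> / \<gamma> \<theta>)\<^sup>2 - (?s \<theta> * \<gamma> \<theta>)\<^sup>2) * \<beta> \<theta> ^ 0) integrable_on {a..b}"
       "(\<lambda>\<theta>. (?s \<theta>)\<^sup>2 * \<beta> \<theta> ^ 2) integrable_on {a..b}"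
       "(\<lambda>\<theta>. (2 * ?s \<theta> * ?c \<theta> / \<gamma> \<theta>) * \<beta> \<theta> ^ 1) integrable_on {a..b}"
    by (intro cont_beta_power_integrable continuous_intros gamma_cont tau_cont; simp)+
  then have "(\<lambda>\<theta>. ((?c \<theta> / \<gamma> \<theta>)\<^sup>2 - (?s \<theta> * \<gamma> \<theta>)\<^sup>2) * \<beta> \<theta> ^ 0 + (?s \<theta>)\<^sup>2 * \<beta> \<theta> ^ 2
      + (2 * ?s \<theta> * ?c \<theta> / \<gamma> \<theta>) * \<beta> \<theta> ^ 1) integrable_on {a..b}"
    by (intro integrable_add)
  then show ?thesis by (rule integrable_eq) (simp add: energy_def power_mult_distrib)
qed

text \<open>Jacobi's identity: the two integrands differ by the derivative of \<open>H = v\<^sup>2 y'/y\<close> (derivatives in \<open>\<tau>\<close>), up to a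
  part of \<open>H\<close> that the definition of the energy has already absorbed.\<close>

lemma gap_sq_integral:
  assumes "\<eta> < a" "a \<le> b" "b < \<eta> + pi"
  defines "H \<equiv> \<lambda>\<theta>. (sin (\<tau> \<theta> - \<tau> \<eta>))\<^sup>2 * (\<gamma> \<theta>)\<^sup>2 * (cos (\<theta> - \<eta>) / sin (\<theta> - \<eta>))"
  shows "((\<lambda>\<theta>. (gap \<eta> \<theta>)\<^sup>2) has_integral (integral {a..b} (energy \<eta>) - (H b - H a))) {a..b}"
proof -
  let ?s = "\<lambda>\<theta>. sin (\<tau> \<theta> - \<tau> \<eta>)" and ?c = "\<lambda>\<theta>. cos (\<tau> \<theta> - \<tau> \<eta>)"
  let ?S = "\<lambda>\<theta>. sin (\<theta> - \<eta>)" and ?C = "\<lambda>\<theta>. cos (\<theta> - \<eta>)"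
  define p where "p \<theta> = 2 * ?s \<theta> * ?c \<theta> * (?C \<theta> / ?S \<theta>) - (?s \<theta>)\<^sup>2 * (\<gamma> \<theta>)\<^sup>2 / (?S \<theta>)\<^sup>2" for \<theta>
  define q where "q \<theta> = 2 * (?s \<theta>)\<^sup>2 * \<gamma> \<theta> * (?C \<theta> / ?S \<theta>)" for \<theta>
  have S: "?S x > 0" if "x \<in> {a..b}" for x using that assms by (intro sin_gt_zero) auto
  have cH: "continuous_on {a..b} H" unfolding H_def
    using S by (intro continuous_intros gamma_cont tau_cont) force
  have "((\<lambda>x. p x + q x * \<beta> x) has_integral (H b - H a)) {a..b}"
  proof (rule ftc[OF assms(2) cH])
    show "isCont p x" if "x \<in> {a..b}" for x
      unfolding p_def using S[OF that] by (intro continuous_intros gamma_isCont tau_isCont) auto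
    show "isCont q x" if "x \<in> {a..b}" for x
      unfolding q_def using S[OF that] by (intro continuous_intros gamma_isCont tau_isCont) auto
    fix x assume x: "x \<in> {a<..<b} - S"
    then have Sx: "?S x > 0" using S[of x] by auto
    have d: "(\<gamma> has_real_derivative \<beta> x) (at x)" using gamma_deriv x by auto
    define K where "K \<theta> = ?C \<theta> / ?S \<theta>" for \<theta>
    have CS: "?C x * ?C x = 1 - ?S x * ?S x"
      using sin_cos_squared_add[of "x - \<eta>"] by (simp add: power2_eq_square)
    have dK: "(K has_real_derivative - 1 / (?S x)\<^sup>2) (at x)"
      unfolding K_def using Sx
      by (auto intro!: derivative_eq_intros simp: CS power2_eq_square) 
    have ds: "(?s has_real_derivative ?c x * (1 / (\<gamma> x)\<^sup>2)) (at x)"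
      by (rule derivative_eq_intros tau_deriv refl | simp)+
    have "((\<lambda>\<theta>. (?s \<theta>)\<^sup>2 * (\<gamma> \<theta>)\<^sup>2 * K \<theta>) has_real_derivative
       (2 * ?s x * (?c x * (1 / (\<gamma> x)\<^sup>2)) * (\<gamma> x)\<^sup>2 + (?s x)\<^sup>2 * (2 * \<gamma> x * \<beta> x)) * K x
       + (?s x)\<^sup>2 * (\<gamma> x)\<^sup>2 * (- 1 / (?S x)\<^sup>2)) (at x)"
      using DERIV_mult[OF DERIV_mult[OF DERIV_power[OF ds, of 2] DERIV_power[OF d, of 2]] dK]
      by (simp add: algebra_simps)
    also have "(2 * ?s x * (?c x * (1 / (\<gamma> x)\<^sup>2)) * (\<gamma> x)\<^sup>2 + (?s x)\<^sup>2 * (2 * \<gamma> x * \<beta> x)) * K x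
       + (?s x)\<^sup>2 * (\<gamma> x)\<^sup>2 * (- 1 / (?S x)\<^sup>2) = p x + q x * \<beta> x"
      by (simp add: p_def q_def algebra_simps flip: K_def)
    finally show "(H has_real_derivative p x + q x * \<beta> x) (at x)"
      by (simp add: H_def K_def)
  qed
  then have "((\<lambda>x. energy \<eta> x - (p x + q x * \<beta> x)) has_integral (integral {a..b} (energy \<eta>) - (H b - H a))) {a..b}"
    by (intro has_integral_diff integrable_integral energy_integrable)
  then show ?thesis
  proof (rule has_integral_eq[rotated])
    fix x assume x: "x \<in> {a..b}"
    have sc: "(?C x / ?S x)\<^sup>2 = 1 / (?S x)\<^sup>2 - 1"
      using S[OF x] by (simp add: power_divide cos_squared_eq field_simps)
    have "p x = 2 * ?s x * ?c x * (?C x / ?S x) - (?s x)\<^sup>2 * (\<gamma> x)\<^sup>2 * (1 + (?C x / ?S x)\<^sup>2)"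
      by (simp add: sc p_def)
    then show "energy \<eta> x - (p x + q x * \<beta> x) = (gap \<eta> x)\<^sup>2"
      unfolding energy_def q_def gap_def by (simp add: power2_eq_square algebra_simps)
  qed
qed

text \<open>Enlarge the interval to \<open>[\<eta> + h, \<eta> + pi - h]\<close> and let \<open>h\<close> tend to \<open>0\<close>.  The boundary terms vanish because
  \<open>sin (\<tau> - \<tau> \<eta>)\<close> has zeros at both ends, where the cotangent has simple poles; at the right end this uses
  \<open>\<tau> (\<eta> + pi) = \<tau> \<eta> + pi\<close>.\<close>

lemma gap_sq_integral_le_energy:
  assumes norm: "\<tau> pi = pi" and ab: "\<eta> < a" "a \<le> b" "b < \<eta> + pi"
  shows "integral {a..b} (\<lambda>\<theta>. (gap \<eta> \<theta>)\<^sup>2) \<le> integral {\<eta>..\<eta> + pi} (energy \<eta>)"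
proof -
  let ?s = "\<lambda>\<theta>. sin (\<tau> \<theta> - \<tau> \<eta>)"
  let ?I = "integral {a..b} (\<lambda>\<theta>. (gap \<eta> \<theta>)\<^sup>2)"
  define H where "H \<theta> = (?s \<theta>)\<^sup>2 * (\<gamma> \<theta>)\<^sup>2 * (cos (\<theta> - \<eta>) / sin (\<theta> - \<eta>))" for \<theta>
  define F where "F x = integral {\<eta>..x} (energy \<eta>)" for x
  have Fc: "continuous_on {\<eta>..\<eta>+pi} F"
    unfolding F_def by (rule indefinite_integral_continuous_1[OF energy_integrable])
  define d where "d = min (a - \<eta>) (\<eta> + pi - b)"
  have d: "d > 0" using ab by (simp add: d_def)
  have ineq: "?I \<le> F (\<eta> + pi - h) - F (\<eta> + h) - (H (\<eta> + pi - h) - H (\<eta> + h))"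
    if h: "0 < h" "h < d" for h
  proof -
    have le: "\<eta> < \<eta> + h" "\<eta> + h \<le> a" "b \<le> \<eta> + pi - h" using h ab by (auto simp: d_def)
    have *: "((\<lambda>\<theta>. (gap \<eta> \<theta>)\<^sup>2) has_integral (integral {\<eta>+h..\<eta>+pi-h} (energy \<eta>)
        - (H (\<eta>+pi-h) - H (\<eta>+h)))) {\<eta>+h..\<eta>+pi-h}"
      unfolding H_def using le ab by (intro gap_sq_integral) auto
    have "?I \<le> integral {\<eta>+h..\<eta>+pi-h} (\<lambda>\<theta>. (gap \<eta> \<theta>)\<^sup>2)"
      using le ab gap_sq_integral[of \<eta> a b] *
      by (intro integral_subset_le) (auto intro: has_integral_integrable)
    also have "\<dots> = integral {\<eta>+h..\<eta>+pi-h} (energy \<eta>) - (H (\<eta>+pi-h) - H (\<eta>+h))"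
      using * by (rule integral_unique)
    also have "integral {\<eta>+h..\<eta>+pi-h} (energy \<eta>) = F (\<eta>+pi-h) - F (\<eta>+h)"
      unfolding F_def using le ab
      by (subst Henstock_Kurzweil_Integration.integral_combine[of \<eta> "\<eta>+h" "\<eta>+pi-h", symmetric])
         (auto intro: energy_integrable)
    finally show ?thesis .
  qed
  have Hb: "\<bar>H x\<bar> \<le> (h / m\<^sup>2)\<^sup>2 * M\<^sup>2 / sin h"
    if h: "0 < h" "h < pi" and x: "x = \<eta> + h \<or> x = \<eta> + pi - h" for h x
  proof -
    have sh: "sin h > 0" using h by (intro sin_gt_zero) auto
    have sx: "sin (x - \<eta>) = sin h" using x by auto
    have "\<bar>?s x\<bar> \<le> h / m\<^sup>2"
    proof (cases "x = \<eta> + h")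
      case True
      then have "\<bar>\<tau> x - \<tau> \<eta>\<bar> \<le> h / m\<^sup>2"
        using tau_upper[of \<eta> x] tau_strict_mono[of \<eta> x] h by simp
      then show ?thesis using abs_sin_x_le_abs_x[of "\<tau> x - \<tau> \<eta>"] by linarith
    next
      case False
      then have x: "x = \<eta> + pi - h" using x by simp
      have "?s x = sin (pi - (\<tau> (\<eta> + pi) - \<tau> x))" by (simp add: tau_shift[OF norm])
      also have "\<dots> = sin (\<tau> (\<eta> + pi) - \<tau> x)" by (rule sin_pi_minus)
      finally have "\<bar>?s x\<bar> \<le> \<bar>\<tau> (\<eta> + pi) - \<tau> x\<bar>" using abs_sin_x_le_abs_x by simp
      also have "\<dots> \<le> h / m\<^sup>2"
        using tau_upper[of x "\<eta> + pi"] tau_strict_mono[of x "\<eta>+pi"] h x by simp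
      finally show ?thesis .
    qed
    then have "(?s x)\<^sup>2 \<le> (h / m\<^sup>2)\<^sup>2" using power_mono[of "\<bar>?s x\<bar>" _ 2] by simp
    moreover have "(\<gamma> x)\<^sup>2 \<le> M\<^sup>2" using upp[of x] pos[of x] by (intro power_mono) auto
    moreover have "\<bar>cos (x - \<eta>) / sin (x - \<eta>)\<bar> \<le> 1 / sin h"
      unfolding sx using sh by (simp add: abs_divide divide_right_mono)
    ultimately have "(?s x)\<^sup>2 * (\<gamma> x)\<^sup>2 * \<bar>cos (x - \<eta>) / sin (x - \<eta>)\<bar> \<le> (h / m\<^sup>2)\<^sup>2 * M\<^sup>2 * (1 / sin h)"
      by (intro mult_mono) auto
    then show ?thesis by (simp add: H_def abs_mult)
  qed
  have small: "((\<lambda>h. (h / m\<^sup>2)\<^sup>2 * M\<^sup>2 / sin h) \<longlongrightarrow> 0) (at_right 0)"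
  proof -
    have "((\<lambda>h. inverse (sin h / h)) \<longlongrightarrow> inverse (1::real)) (at 0)"
      using DERIV_sin[of "0::real"] by (intro tendsto_inverse) (auto simp: DERIV_def)
    then have "((\<lambda>h. inverse (sin h / h)) \<longlongrightarrow> 1) (at_right (0::real))"
      by (simp add: filterlim_at_split)
    then have "((\<lambda>h. (h / (m\<^sup>2)\<^sup>2) * M\<^sup>2 * inverse (sin h / h)) \<longlongrightarrow> (0 / (m\<^sup>2)\<^sup>2) * M\<^sup>2 * 1) (at_right (0::real))"
      using m by (intro tendsto_intros) auto
    moreover have "(h / (m\<^sup>2)\<^sup>2) * M\<^sup>2 * inverse (sin h / h) = (h / m\<^sup>2)\<^sup>2 * M\<^sup>2 / sin h" for h
      by (simp add: power2_eq_square field_simps)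
    ultimately show ?thesis by simp
  qed
  have dpi: "d < pi" using ab by (auto simp: d_def min_def)
  have ev: "eventually (\<lambda>h. 0 < h \<and> h < d) (at_right 0)"
    using d by (auto simp: eventually_at_right)
  have H1: "((\<lambda>h. H (\<eta> + h)) \<longlongrightarrow> 0) (at_right 0)"
    by (rule Lim_null_comparison[OF _ small]) (use ev in \<open>eventually_elim; use Hb dpi in auto\<close>)
  have H2: "((\<lambda>h. H (\<eta> + pi - h)) \<longlongrightarrow> 0) (at_right 0)"
    by (rule Lim_null_comparison[OF _ small]) (use ev in \<open>eventually_elim; use Hb dpi in auto\<close>)
  have t1: "((\<lambda>h. \<eta> + h) \<longlongrightarrow> \<eta>) (at_right 0)" by (auto intro!: tendsto_eq_intros)
  have t2: "((\<lambda>h. \<eta> + pi - h) \<longlongrightarrow> \<eta> + pi) (at_right 0)" by (auto intro!: tendsto_eq_intros)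
  have F1: "((\<lambda>h. F (\<eta> + h)) \<longlongrightarrow> F \<eta>) (at_right 0)"
    by (rule continuous_on_tendsto_compose[OF Fc t1]) (use ev dpi in \<open>auto elim!: eventually_mono\<close>)
  have F2: "((\<lambda>h. F (\<eta> + pi - h)) \<longlongrightarrow> F (\<eta> + pi)) (at_right 0)"
    by (rule continuous_on_tendsto_compose[OF Fc t2]) (use ev dpi in \<open>auto elim!: eventually_mono\<close>)
  have "((\<lambda>h. F (\<eta> + pi - h) - F (\<eta> + h) - (H (\<eta> + pi - h) - H (\<eta> + h))) \<longlongrightarrow> 
      F (\<eta> + pi) - F \<eta> - (0 - 0)) (at_right 0)"
    by (intro tendsto_intros F1 F2 H1 H2)
  then have "?I \<le> F (\<eta> + pi) - F \<eta> - (0 - 0)"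
    by (rule tendsto_lowerbound) (use ev ineq in \<open>auto elim!: eventually_mono\<close>)
  then show ?thesis by (simp add: F_def)
qed

lemma energy_integral_nonneg:
  assumes norm: "\<tau> pi = pi"
  shows "0 \<le> integral {\<eta>..\<eta> + pi} (energy \<eta>)"
  using gap_sq_integral_le_energy[OF norm, of \<eta> "\<eta> + pi/2" "\<eta> + pi/2"] by simp

text \<open>Shifting the phase by \<open>pi/2\<close> exchanges sine and cosine up to sign, so that the mixed terms cancel and the two
  energy densities add up to the integrand of the deficit.  The second energy has a nonnegative integral.\<close>

lemma energy_integral_le_deficit:
  assumes norm: "\<tau> pi = pi"
  shows "integral {\<eta>..\<eta> + pi} (energy \<eta>) \<le> deficit"
proof -
  obtain \<theta>1 where \<theta>1: "\<tau> \<theta>1 = \<tau> \<eta> + pi/2" using tau_surj by blast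
  let ?D = "\<lambda>\<theta>. 1 / (\<gamma> \<theta>)\<^sup>2 - (\<gamma> \<theta>)\<^sup>2 + (\<beta> \<theta>)\<^sup>2"
  have sum: "energy \<eta> \<theta> + energy \<theta>1 \<theta> = ?D \<theta>" for \<theta>
  proof -
    have shift: "\<tau> \<theta> - \<tau> \<theta>1 = (\<tau> \<theta> - \<tau> \<eta>) - pi/2" using \<theta>1 by simp
    have sc: "sin (\<tau> \<theta> - \<tau> \<theta>1) = - cos (\<tau> \<theta> - \<tau> \<eta>)"
      "cos (\<tau> \<theta> - \<tau> \<theta>1) = sin (\<tau> \<theta> - \<tau> \<eta>)"
      unfolding shift using sin_diff[of "\<tau> \<theta> - \<tau> \<eta>" "pi/2"] cos_diff[of "\<tau> \<theta> - \<tau> \<eta>" "pi/2"] by simp_all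
    define s c where "s = sin (\<tau> \<theta> - \<tau> \<eta>)" and "c = cos (\<tau> \<theta> - \<tau> \<eta>)"
    have "s\<^sup>2 + c\<^sup>2 = 1" by (simp add: s_def c_def)
    then have s2: "s\<^sup>2 = 1 - c\<^sup>2" by simp
    show ?thesis unfolding energy_def sc s_def[symmetric] c_def[symmetric]
      by (simp add: power_mult_distrib power_divide s2 algebra_simps diff_divide_distrib)
  qed
  have per': "energy \<theta>1 (x + pi) = energy \<theta>1 x" for x
  proof -
    have shift: "\<tau> (x + pi) - \<tau> \<theta>1 = (\<tau> x - \<tau> \<theta>1) + pi" by (simp add: tau_shift[OF norm])
    show ?thesis unfolding energy_def shift by (simp add: per beta_per)
  qed
  have Dint: "?D integrable_on {a..b}" for a b
    using integrable_add[OF energy_integrable[of \<eta> a b] energy_integrable[of \<theta>1 a b]] by (simp add: sum)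
  have "0 \<le> integral {\<theta>1..\<theta>1 + pi} (energy \<theta>1)" by (rule energy_integral_nonneg[OF norm])
  also have "\<dots> = integral {\<eta>..\<eta> + pi} (energy \<theta>1)"
    by (rule integral_periodic_shift_any[OF per' energy_integrable]) simp
  finally have "integral {\<eta>..\<eta> + pi} (energy \<eta>)
      \<le> integral {\<eta>..\<eta> + pi} (energy \<eta>) + integral {\<eta>..\<eta> + pi} (energy \<theta>1)" by simp
  also have "\<dots> = integral {\<eta>..\<eta> + pi} ?D"
    by (subst integral_add[symmetric]) (auto intro: energy_integrable simp: sum)
  also have "\<dots> = integral {0..0 + pi} ?D"
    by (rule integral_periodic_shift_any[OF _ Dint]) (auto simp: per beta_per)
  finally show ?thesis by (simp add: deficit_def)
qed

lemma gap_sq_integral_le_deficit: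
  assumes "\<tau> pi = pi" "\<eta> < a" "a \<le> b" "b < \<eta> + pi"
  shows "integral {a..b} (\<lambda>\<theta>. (gap \<eta> \<theta>)\<^sup>2) \<le> deficit"
  using gap_sq_integral_le_energy[OF assms] energy_integral_le_deficit[OF assms(1), of \<eta>] by linarith

text \<open>The determinant of the boundary points in the directions \<open>\<eta>\<close> and \<open>\<theta>\<close>.\<close>

definition cross :: "real \<Rightarrow> real \<Rightarrow> real" where
  "cross \<eta> \<theta> = sin (\<theta> - \<eta>) / (\<gamma> \<eta> * \<gamma> \<theta>)"

text \<open>The logarithmic derivative of \<open>cross \<eta> \<theta> / sin (\<tau> \<theta> - \<tau> \<eta>)\<close> is minus the gap divided by \<open>\<gamma> sin (\<tau> \<theta> - \<tau> \<eta>)\<close>.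
  The gap is small in mean square by the deficit bound, while \<open>\<integral> \<gamma>\<^sup>-\<^sup>2\<close> is at most \<open>pi\<close>; the inequality of the arithmetic
  and geometric mean combines the two.\<close>

lemma log_ratio:
  assumes norm: "\<tau> pi = pi" and ab: "\<eta> < a" "a \<le> b" "b < \<eta> + pi"
    and s0: "0 < s0" "\<And>x. x \<in> {a..b} \<Longrightarrow> s0 \<le> sin (\<tau> x - \<tau> \<eta>)"
    and def: "deficit \<le> pi * \<epsilon>" "0 < \<epsilon>"
  defines "L \<equiv> \<lambda>\<theta>. ln (cross \<eta> \<theta> / sin (\<tau> \<theta> - \<tau> \<eta>))"
  shows "\<bar>L b - L a\<bar> \<le> pi / 2 * (1 + 1 / s0\<^sup>2) * sqrt \<epsilon>"
proof -
  let ?s = "\<lambda>\<theta>. sin (\<tau> \<theta> - \<tau> \<eta>)" and ?c = "\<lambda>\<theta>. cos (\<tau> \<theta> - \<tau> \<eta>)"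
  let ?S = "\<lambda>\<theta>. sin (\<theta> - \<eta>)" and ?C = "\<lambda>\<theta>. cos (\<theta> - \<eta>)"
  define p where "p \<theta> = ?C \<theta> / ?S \<theta> - ?c \<theta> / (?s \<theta> * (\<gamma> \<theta>)\<^sup>2)" for \<theta>
  define q where "q \<theta> = - 1 / \<gamma> \<theta>" for \<theta>
  define L' where "L' \<theta> = ln (?S \<theta>) - ln (\<gamma> \<theta>) - ln (?s \<theta>)" for \<theta>
  have S: "?S x > 0" if "x \<in> {a..b}" for x using that ab by (intro sin_gt_zero) auto
  have sp: "?s x > 0" if "x \<in> {a..b}" for x using s0 that by force
  have LL: "L x = L' x - ln (\<gamma> \<eta>)" if "x \<in> {a..b}" for x
    unfolding L_def L'_def cross_def using S[OF that] sp[OF that] pos[of x] pos[of \<eta>]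
    by (simp add: ln_div ln_mult)
  have hi: "((\<lambda>x. p x + q x * \<beta> x) has_integral (L' b - L' a)) {a..b}"
  proof (rule ftc[OF ab(2)])
    show "continuous_on {a..b} L'" unfolding L'_def
      by (intro continuous_intros gamma_cont tau_cont ballI) (use S sp in force)+
    show "isCont p x" if "x \<in> {a..b}" for x
      unfolding p_def using S[OF that] sp[OF that] by (intro continuous_intros gamma_isCont tau_isCont) auto
    show "isCont q x" if "x \<in> {a..b}" for x
      unfolding q_def by (intro continuous_intros gamma_isCont) auto
    fix x assume x: "x \<in> {a<..<b} - S"
    then have x': "x \<in> {a..b}" by auto
    have d: "(\<gamma> has_real_derivative \<beta> x) (at x)" using gamma_deriv x by auto
    have ds: "(?s has_real_derivative ?c x * (1 / (\<gamma> x)\<^sup>2)) (at x)"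
      by (rule derivative_eq_intros tau_deriv refl | simp)+
    have dS: "(?S has_real_derivative ?C x) (at x)"
      by (rule derivative_eq_intros refl | simp)+
    have "(L' has_real_derivative (1 / ?S x * ?C x - 1 / \<gamma> x * \<beta> x - 1 / ?s x * (?c x * (1 / (\<gamma> x)\<^sup>2)))) (at x)"
      unfolding L'_def
      by (intro DERIV_diff DERIV_chain2[OF DERIV_ln_divide dS] DERIV_chain2[OF DERIV_ln_divide d]
            DERIV_chain2[OF DERIV_ln_divide ds] S[OF x'] sp[OF x'] pos)
    then show "(L' has_real_derivative p x + q x * \<beta> x) (at x)"
      by (simp add: p_def q_def algebra_simps)
  qed
  \<comment> \<open>The weight that balances the two terms of the arithmetic mean.\<close>
  define w where "w = 1 / sqrt \<epsilon>"
  have lam: "w > 0" using def by (simp add: w_def)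
  let ?B = "\<lambda>x. 1/2 * (w * (gap \<eta> x)\<^sup>2 + 1 / (w * s0\<^sup>2) * (1 / (\<gamma> x)\<^sup>2))"
  have pq: "\<bar>p x + q x * \<beta> x\<bar> \<le> ?B x" if x: "x \<in> {a..b}" for x
  proof -
    have eq: "p x + q x * \<beta> x = - gap \<eta> x * (1 / (\<gamma> x * ?s x))"
      using sp[OF x] by (simp add: p_def q_def gap_def field_simps power2_eq_square)
    have "0 \<le> (sqrt w * \<bar>gap \<eta> x\<bar> - 1 / sqrt w * (1 / (\<gamma> x * ?s x)))\<^sup>2" by simp
    also have "\<dots> = w * (gap \<eta> x)\<^sup>2 + 1 / w * (1 / (\<gamma> x * ?s x))\<^sup>2
        - 2 * (\<bar>gap \<eta> x\<bar> * (1 / (\<gamma> x * ?s x)))"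
      using lam by (simp add: power2_diff power_mult_distrib power_divide)
    finally have "2 * \<bar>p x + q x * \<beta> x\<bar> \<le> w * (gap \<eta> x)\<^sup>2 + 1 / w * (1 / (\<gamma> x * ?s x))\<^sup>2"
      unfolding eq using sp[OF x] pos[of x] by (simp add: abs_mult)
    moreover have "(1 / (\<gamma> x * ?s x))\<^sup>2 \<le> 1 / s0\<^sup>2 * (1 / (\<gamma> x)\<^sup>2)"
    proof -
      have "1 / (?s x)\<^sup>2 \<le> 1 / s0\<^sup>2"
        using s0(1) s0(2)[OF x] by (intro divide_left_mono power_mono mult_pos_pos zero_less_power) auto
      then have "1 / (?s x)\<^sup>2 * (1 / (\<gamma> x)\<^sup>2) \<le> 1 / s0\<^sup>2 * (1 / (\<gamma> x)\<^sup>2)"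
        by (intro mult_right_mono) auto
      then show ?thesis by (simp add: power_mult_distrib power_divide mult.commute)
    qed
    then have "1 / w * (1 / (\<gamma> x * ?s x))\<^sup>2 \<le> 1 / w * (1 / s0\<^sup>2 * (1 / (\<gamma> x)\<^sup>2))"
      using lam by (intro mult_left_mono) auto
    ultimately show ?thesis by simp
  qed
  have ig: "((\<lambda>x. (gap \<eta> x)\<^sup>2) has_integral integral {a..b} (\<lambda>\<theta>. (gap \<eta> \<theta>)\<^sup>2)) {a..b}"
    using gap_sq_integral[OF ab] by (simp add: has_integral_integrable integrable_integral)
  have it: "((\<lambda>x. 1 / (\<gamma> x)\<^sup>2) has_integral (\<tau> b - \<tau> a)) {a..b}"
    by (rule inv_sq_has_integral[OF ab(2)])
  define V where "V = 1/2 * (w * integral {a..b} (\<lambda>\<theta>. (gap \<eta> \<theta>)\<^sup>2) + 1 / (w * s0\<^sup>2) * (\<tau> b - \<tau> a))"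
  have iB: "(?B has_integral V) {a..b}"
    unfolding V_def by (intro has_integral_mult_right has_integral_add ig it)
  have "L' b - L' a \<le> V" using hi iB by (rule has_integral_le) (rule order_trans[OF abs_ge_self pq])
  moreover have "- (L' b - L' a) \<le> V" using has_integral_neg[OF hi] iB
    by (rule has_integral_le) (rule order_trans[OF abs_ge_minus_self pq])
  ultimately have "\<bar>L b - L a\<bar> \<le> V" using LL[of a] LL[of b] ab by simp
  also have "V \<le> 1/2 * (w * (pi * \<epsilon>) + 1 / (w * s0\<^sup>2) * pi)"
  proof -
    have "integral {a..b} (\<lambda>\<theta>. (gap \<eta> \<theta>)\<^sup>2) \<le> pi * \<epsilon>"
      using gap_sq_integral_le_deficit[OF norm ab] def by linarith
    moreover have "\<tau> b - \<tau> a \<le> pi"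
      using tau_strict_mono[of \<eta> a] tau_strict_mono[of b "\<eta>+pi"] ab tau_shift[OF norm, of \<eta>] by simp
    ultimately show ?thesis unfolding V_def using lam s0(1)
      by (intro mult_left_mono add_mono) auto
  qed
  also have "\<dots> = pi / 2 * (1 + 1 / s0\<^sup>2) * sqrt \<epsilon>"
  proof -
    have "w * \<epsilon> = sqrt \<epsilon>" using def by (simp add: w_def real_div_sqrt)
    moreover have "1 / (w * s0\<^sup>2) = sqrt \<epsilon> / s0\<^sup>2" by (simp add: w_def)
    ultimately show ?thesis by (simp add: algebra_simps)
  qed
  finally show ?thesis .
qed

end

lemma sin_ge_on_middle:
  fixes a x :: real
  assumes "0 \<le> a" "a \<le> x" "x \<le> pi - a"
  shows "sin a \<le> sin x"
proof (cases "x \<le> pi / 2")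
  case True
  then show ?thesis using assms by (intro sin_monotone_2pi_le) auto
next
  case False
  then have "sin a \<le> sin (pi - x)" using assms by (intro sin_monotone_2pi_le) auto
  then show ?thesis by simp
qed

text \<open>The constant of the logarithmic estimate on parameters whose sine is at least \<open>sin (pi/8)\<close>.\<close>

definition \<kappa> :: real where "\<kappa> = pi / 2 * (1 + 1 / (sin (pi/8))\<^sup>2)"

lemma kappa_pos: "\<kappa> > 0"
  unfolding \<kappa>_def by (intro mult_pos_pos add_pos_nonneg) auto

context polar_gauge begin

lemma cross_pos: assumes "\<eta> < \<theta>" "\<theta> < \<eta> + pi" shows "cross \<eta> \<theta> > 0"
  unfolding cross_def using assms pos by (intro divide_pos_pos mult_pos_pos sin_gt_zero) auto

text \<open>The logarithmic estimate between \<open>\<theta>\<close> and the quarter-turn point \<open>\<theta>h\<close>, exponentiated.  The margin \<open>pi/8\<close> keeps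
  both away from the zeros of the determinant.\<close>

lemma cross_approx:
  assumes norm: "\<tau> pi = pi" and def: "deficit \<le> pi * \<epsilon>" "0 < \<epsilon>"
    and t: "pi/8 \<le> \<tau> \<theta> - \<tau> \<eta>" "\<tau> \<theta> - \<tau> \<eta> \<le> 7*pi/8" and h: "\<tau> \<theta>h = \<tau> \<eta> + pi/2"
  shows "\<bar>cross \<eta> \<theta> - cross \<eta> \<theta>h * sin (\<tau> \<theta> - \<tau> \<eta>)\<bar> \<le> (exp (\<kappa> * sqrt \<epsilon>) - 1) * cross \<eta> \<theta>h"
proof -
  define a b where "a = min \<theta> \<theta>h" and "b = max \<theta> \<theta>h"
  let ?L = "\<lambda>\<theta>. ln (cross \<eta> \<theta> / sin (\<tau> \<theta> - \<tau> \<eta>))"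
  let ?s = "sin (\<tau> \<theta> - \<tau> \<eta>)"
  have pp: "0 < pi/8" "0 < pi" using pi_gt_zero by linarith+
  have lo: "\<eta> < \<theta>" "\<eta> < \<theta>h" using t h pp tau_mono_iff[of \<eta> \<theta>] tau_mono_iff[of \<eta> \<theta>h] by linarith+
  have hi: "\<theta> < \<eta> + pi" "\<theta>h < \<eta> + pi"
    using t h pp tau_mono_iff[of \<theta> "\<eta> + pi"] tau_mono_iff[of \<theta>h "\<eta> + pi"] tau_shift[OF norm, of \<eta>]
    by linarith+
  have s8: "sin (pi/8) > 0" by (intro sin_gt_zero) auto
  have mono: "x \<le> y \<Longrightarrow> \<tau> x \<le> \<tau> y" for x y using tau_strict_mono[of x y] by (cases "x = y") auto
  have "\<bar>?L b - ?L a\<bar> \<le> pi / 2 * (1 + 1 / (sin (pi/8))\<^sup>2) * sqrt \<epsilon>"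
  proof (rule log_ratio[OF norm _ _ _ s8 _ def])
    fix x assume x: "x \<in> {a..b}"
    have "pi/8 \<le> \<tau> x - \<tau> \<eta>"
      using mono[of a x] x t h pp by (auto simp: a_def min_def split: if_splits)
    moreover have "\<tau> x - \<tau> \<eta> \<le> pi - pi/8"
      using mono[of x b] x t h pp by (auto simp: b_def max_def split: if_splits)
    ultimately show "sin (pi/8) \<le> sin (\<tau> x - \<tau> \<eta>)"
      by (intro sin_ge_on_middle) auto
  qed (use lo hi in \<open>auto simp: a_def b_def\<close>)
  then have "\<bar>?L \<theta> - ?L \<theta>h\<bar> \<le> \<kappa> * sqrt \<epsilon>"
    unfolding a_def b_def \<kappa>_def by (cases "\<theta> \<le> \<theta>h") (auto simp: min_def max_def abs_minus_commute)
  moreover have "?L \<theta>h = ln (cross \<eta> \<theta>h)" using h by simp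
  ultimately have LL: "\<bar>?L \<theta> - ln (cross \<eta> \<theta>h)\<bar> \<le> \<kappa> * sqrt \<epsilon>" by simp
  have c: "cross \<eta> \<theta> > 0" "cross \<eta> \<theta>h > 0" using cross_pos lo hi by auto
  have sp: "?s > 0" by (intro sin_gt_zero) (use t pp in linarith)+
  define y where "y = ?L \<theta> - ln (cross \<eta> \<theta>h)"
  have "exp y = cross \<eta> \<theta> / ?s / cross \<eta> \<theta>h"
    using c sp by (simp add: y_def exp_diff)
  then have eq: "cross \<eta> \<theta> - cross \<eta> \<theta>h * ?s = (exp y - 1) * (cross \<eta> \<theta>h * ?s)"
    using c sp by (simp add: field_simps)
  have "\<bar>exp y - 1\<bar> \<le> exp \<bar>y\<bar> - 1"
  proof (cases "y \<ge> 0")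
    case False
    define z where "z = exp (-y)"
    have "z > 1" using False by (simp add: z_def)
    then have "1 - 1/z \<le> z - 1"
      using zero_le_power2[of "z - 1"] by (simp add: field_simps power2_eq_square)
    moreover have "exp y = 1/z" by (simp add: z_def exp_minus inverse_eq_divide)
    ultimately show ?thesis using False \<open>z > 1\<close> by (simp add: z_def)
  qed simp
  also have "\<dots> \<le> exp (\<kappa> * sqrt \<epsilon>) - 1" using LL by (simp add: y_def)
  finally have e: "\<bar>exp y - 1\<bar> \<le> exp (\<kappa> * sqrt \<epsilon>) - 1" .
  have "0 \<le> \<kappa> * sqrt \<epsilon>" using LL by linarith
  then have "\<bar>exp y - 1\<bar> * (cross \<eta> \<theta>h * ?s) \<le> (exp (\<kappa> * sqrt \<epsilon>) - 1) * (cross \<eta> \<theta>h * 1)"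
    using e c sp by (intro mult_mono mult_left_mono) auto
  then show ?thesis unfolding eq using c sp by (simp add: abs_mult)
qed

end

section \<open>Curves with almost sinusoidal determinants\<close>

lemma periodic_bound:
  fixes h :: "real \<Rightarrow> real"
  assumes per: "\<And>t. h (t + pi) = h t" and b: "\<And>t. a \<le> t \<Longrightarrow> t \<le> a + pi \<Longrightarrow> h t \<le> C"
  shows "h t \<le> C"
proof -
  interpret periodic_fun_simple h pi by unfold_locales (rule per)
  define n where "n = \<lfloor>(t - a) / pi\<rfloor>"
  have "of_int n \<le> (t - a) / pi" "(t - a) / pi < of_int n + 1" by (auto simp: n_def)
  then have "a \<le> t - of_int n * pi" "t - of_int n * pi \<le> a + pi"
    by (auto simp: field_simps)
  then have "h (t - of_int n * pi) \<le> C" by (rule b)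
  then show ?thesis by (simp add: minus_of_int)
qed

text \<open>Here \<open>(u, w)\<close> are the coordinates of an antiperiodic plane curve with respect to its points at the parameters \<open>0\<close>
  and \<open>pi/2\<close>.  In the approximation hypothesis the brackets are determinants of two points of the curve.\<close>

locale almost_trigonometric =
  fixes u w :: "real \<Rightarrow> real" and \<delta> :: real
  assumes u0: "u 0 = 1" and w0: "w 0 = 0" and u1: "u (pi/2) = 0" and w1: "w (pi/2) = 1"
    and anti: "u (t + pi) = - u t" "w (t + pi) = - w t"
    and \<delta>: "0 \<le> \<delta>" "\<delta> \<le> 1/100"
    and approx: "\<lbrakk>pi/8 \<le> t; t \<le> 7*pi/8\<rbrakk> \<Longrightarrow>
      \<bar>(u s * w (s + t) - w s * u (s + t)) - (u s * w (s + pi/2) - w s * u (s + pi/2)) * sin t\<bar>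
        \<le> \<delta> * (u s * w (s + pi/2) - w s * u (s + pi/2))"
begin

lemma w_far: assumes "pi/8 \<le> t" "t \<le> 7*pi/8" shows "\<bar>w t - sin t\<bar> \<le> \<delta>"
  using approx[OF assms, of 0] by (simp add: u0 w0 w1 u1)

lemma u_far: assumes "-3*pi/8 \<le> t" "t \<le> 3*pi/8" shows "\<bar>u t - cos t\<bar> \<le> \<delta>"
proof -
  have "pi/8 \<le> t + pi/2" "t + pi/2 \<le> 7*pi/8" using assms by auto
  from approx[OF this, of "pi/2"] have "\<bar>- u (t + pi) - sin (t + pi/2)\<bar> \<le> \<delta>"
    using anti(1)[of 0] by (simp add: u0 w0 w1 u1 add.commute add.left_commute)
  then show ?thesis by (simp add: anti sin_add)
qed

text \<open>Near the parameter \<open>0\<close> the base point \<open>0\<close> gives no information on \<open>w\<close>, since the determinant vanishes there.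
  The base point \<open>-pi/4\<close> does: its coordinates are known up to \<open>\<delta>\<close>, the determinant with it is known, and \<open>u t\<close> is
  known, which determines \<open>w t\<close> because \<open>u (-pi/4)\<close> is near \<open>1/sqrt 2\<close>.\<close>

lemma w_near: assumes t: "-pi/8 \<le> t" "t \<le> pi/8" shows "\<bar>w t - sin t\<bar> \<le> 14 * \<delta>"
proof -
  define q :: real where "q = sqrt 2 / 2"
  have q: "q * q = 1/2" "7/10 \<le> q" "q \<le> 71/100"
  proof -
    show "q * q = 1/2" by (simp add: q_def)
    have "1.4 \<le> sqrt (2::real)" by (rule real_le_rsqrt) (simp add: power2_eq_square)
    then show "7/10 \<le> q" by (simp add: q_def)
    have "sqrt (2::real) \<le> 1.42" by (rule real_le_lsqrt) (simp_all add: power2_eq_square)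
    then show "q \<le> 71/100" by (simp add: q_def)
  qed
  have cs: "cos (pi/4) = q" "sin (pi/4) = q" by (simp_all add: q_def cos_45 sin_45)
  define U W u4 w4 where "U = u (-pi/4)" and "W = w (-pi/4)" and "u4 = u (pi/4)" and "w4 = w (pi/4)"
  have U: "\<bar>U - q\<bar> \<le> \<delta>" using u_far[of "-pi/4"] by (simp add: U_def cs)
  have u4: "\<bar>u4 - q\<bar> \<le> \<delta>" using u_far[of "pi/4"] by (simp add: u4_def cs)
  have w4: "\<bar>w4 - q\<bar> \<le> \<delta>" using w_far[of "pi/4"] by (simp add: w4_def cs)
  have "sin (3*pi/4) = sin (pi - pi/4)" by (rule arg_cong[of _ _ sin]) simp
  then have s34: "sin (3*pi/4) = q" by (simp only: sin_pi_minus cs)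
  have "w (3*pi/4) = - W" using anti(2)[of "-pi/4"] by (simp add: W_def)
  then have W: "\<bar>W + q\<bar> \<le> \<delta>" using w_far[of "3*pi/4"] s34 by (simp add: abs_le_iff)
  have ut: "\<bar>u t - cos t\<bar> \<le> \<delta>" using t by (intro u_far) auto
  define Q where "Q = U * w4 - W * u4"
  have prod: "\<bar>x * y - a * b\<bar> \<le> 7/4 * \<delta>" if "\<bar>x - a\<bar> \<le> \<delta>" "\<bar>y - b\<bar> \<le> \<delta>" "\<bar>a\<bar> \<le> (71/100)" "\<bar>b\<bar> \<le> 1"
    for x y a b :: real
  proof -
    have "x * y - a * b = (x - a) * y + a * (y - b)" by (simp add: algebra_simps)
    then have "\<bar>x * y - a * b\<bar> \<le> \<bar>x - a\<bar> * \<bar>y\<bar> + \<bar>a\<bar> * \<bar>y - b\<bar>"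
      by (metis abs_mult abs_triangle_ineq)
    also have "\<dots> \<le> \<delta> * (101/100) + (71/100) * \<delta>"
      using that \<delta> by (intro add_mono mult_mono) auto
    finally show ?thesis using \<delta> by simp
  qed
  have "\<bar>U * w4 - q * q\<bar> \<le> 7/4 * \<delta>" using U w4 q by (intro prod) auto
  then have Q1: "\<bar>U * w4 - 1/2\<bar> \<le> 7/4 * \<delta>" by (simp add: q(1))
  have "\<bar>W * u4 - (-q) * q\<bar> \<le> 7/4 * \<delta>" using W u4 q by (intro prod) auto
  then have Q2: "\<bar>W * u4 + 1/2\<bar> \<le> 7/4 * \<delta>" by (simp add: q(1))
  have Q: "\<bar>Q - 1\<bar> \<le> 7/2 * \<delta>" using Q1 Q2 unfolding Q_def abs_le_iff by (intro conjI; linarith)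
  have Wu: "\<bar>W * u t - (-q) * cos t\<bar> \<le> 7/4 * \<delta>" using W ut q by (intro prod) auto
  have sq: "sin (t + pi/4) = q * sin t + q * cos t" by (simp add: sin_add cs)
  have "pi/8 \<le> t + pi/4" "t + pi/4 \<le> 7*pi/8" using t by auto
  from approx[OF this, of "-pi/4"]
  have main: "\<bar>(U * w t - W * u t) - Q * sin (t + pi/4)\<bar> \<le> \<delta> * Q"
    by (simp add: U_def W_def Q_def u4_def w4_def)
  have "\<delta> * Q \<le> \<delta> * (207/200)" using abs_le_D1[OF Q] \<delta> by (intro mult_left_mono) linarith+
  moreover have "\<bar>(Q - 1) * sin (t + pi/4)\<bar> \<le> 7/2 * \<delta> * 1"
    unfolding abs_mult using Q \<delta> by (intro mult_mono) auto
  moreover have "(Q - 1) * sin (t + pi/4) = Q * sin (t + pi/4) - (q * sin t + q * cos t)"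
    using sq by (simp only: left_diff_distrib mult_1)
  ultimately have Qs: "\<bar>Q * sin (t + pi/4) - (q * sin t + q * cos t)\<bar> \<le> 7/2 * \<delta>"
    and dQ: "\<delta> * Q \<le> \<delta> * (207/200)" by simp_all
  have Wu': "\<bar>W * u t + q * cos t\<bar> \<le> 7/4 * \<delta>" using Wu by simp
  have tri: "\<bar>x - a\<bar> \<le> c1 + c2 + c3"
    if "\<bar>x - y - z\<bar> \<le> c1" "\<bar>y + b\<bar> \<le> c2" "\<bar>z - (a + b)\<bar> \<le> c3" for x y z a b c1 c2 c3 :: real
    using that by linarith
  have "\<bar>U * w t - q * sin t\<bar> \<le> \<delta> * (207/200) + 7/4 * \<delta> + 7/2 * \<delta>"
    by (rule tri[OF order_trans[OF main dQ] Wu' Qs])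
  then have A: "\<bar>U * w t - q * sin t\<bar> \<le> 13/2 * \<delta>" using \<delta> by linarith
  have B: "\<bar>(q - U) * sin t\<bar> \<le> \<delta> * 1"
    unfolding abs_mult using U \<delta> by (intro mult_mono) (auto simp: abs_minus_commute)
  have "U * (w t - sin t) = (U * w t - q * sin t) + (q - U) * sin t" by (simp add: algebra_simps)
  then have "\<bar>U * (w t - sin t)\<bar> \<le> \<bar>U * w t - q * sin t\<bar> + \<bar>(q - U) * sin t\<bar>"
    by (simp only: abs_triangle_ineq)
  also have "\<dots> \<le> 13/2 * \<delta> + \<delta> * 1" by (rule add_mono[OF A B])
  finally have C: "\<bar>U * (w t - sin t)\<bar> \<le> 13/2 * \<delta> + \<delta> * 1" .
  have "3/5 \<le> \<bar>U\<bar>" using U q \<delta> by linarith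
  then have "3/5 * \<bar>w t - sin t\<bar> \<le> \<bar>U * (w t - sin t)\<bar>"
    unfolding abs_mult by (intro mult_right_mono) auto
  have "a \<le> 14 * \<delta>" if "3/5 * a \<le> 13/2 * \<delta> + \<delta> * 1" for a :: real
    using that \<delta>(1) by linarith
  from this[OF order_trans[OF \<open>3/5 * _ \<le> _\<close> C]] show ?thesis .
qed

text \<open>Starting the curve a quarter period later exchanges the roles of the two coordinates, so the estimates for \<open>w\<close> also
  yield those for \<open>u\<close>.\<close>

lemma quarter_turn: "almost_trigonometric (\<lambda>t. w (t + pi/2)) (\<lambda>t. - u (t + pi/2)) \<delta>"
proof
  show "w (0 + pi/2) = 1" "- u (0 + pi/2) = 0" by (simp_all add: w1 u1)
  show "w (pi/2 + pi/2) = 0" "- u (pi/2 + pi/2) = 1" using anti[of 0] by (simp_all add: w0 u0)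
  show "w (t + pi + pi/2) = - w (t + pi/2)" "- u (t + pi + pi/2) = - (- u (t + pi/2))" for t
    using anti[of "t + pi/2"] by (simp_all add: add.commute add.left_commute)
  show "0 \<le> \<delta>" "\<delta> \<le> 1/100" by (fact \<delta>)+
  show "\<bar>(w (s + pi/2) * - u (s + t + pi/2) - - u (s + pi/2) * w (s + t + pi/2))
      - (w (s + pi/2) * - u (s + pi/2 + pi/2) - - u (s + pi/2) * w (s + pi/2 + pi/2)) * sin t\<bar>
      \<le> \<delta> * (w (s + pi/2) * - u (s + pi/2 + pi/2) - - u (s + pi/2) * w (s + pi/2 + pi/2))"
    if "pi/8 \<le> t" "t \<le> 7*pi/8" for s t
    using approx[OF that, of "s + pi/2"]
    by (simp add: algebra_simps) 
qed

lemma w_close: "\<bar>w t - sin t\<bar> \<le> 14 * \<delta>"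
proof (rule periodic_bound[where a = "-pi/8" and h = "\<lambda>t. \<bar>w t - sin t\<bar>"])
  show "\<bar>w t - sin t\<bar> \<le> 14 * \<delta>" if "-pi/8 \<le> t" "t \<le> -pi/8 + pi" for t
    using w_near[of t] w_far[of t] that \<delta> by (cases "t \<le> pi/8") auto
qed (simp add: anti abs_minus_commute)

lemma u_close: "\<bar>u t - cos t\<bar> \<le> 14 * \<delta>"
proof -
  interpret turned: almost_trigonometric "\<lambda>t. w (t + pi/2)" "\<lambda>t. - u (t + pi/2)" \<delta>
    by (rule quarter_turn)
  show ?thesis using turned.w_close[of "t - pi/2"] by (simp add: sin_diff abs_minus_commute)
qed

end

section \<open>Bodies with small deficit are nearly elliptical\<close>

definition dir :: "real \<Rightarrow> real^2" where "dir \<theta> = vector [cos \<theta>, sin \<theta>]"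

lemma dir_nth [simp]: "dir \<theta> $ 1 = cos \<theta>" "dir \<theta> $ 2 = sin \<theta>"
  by (simp_all add: dir_def)

lemma norm_dir [simp]: "norm (dir \<theta>) = 1"
  by (simp add: norm_vec_def L2_set_def sum_2)

lemma inner_dir [simp]: "dir a \<bullet> dir b = cos (a - b)"
  by (simp add: inner_vec_def sum_2 cos_diff)

lemma polar_form:
  fixes z :: "real^2"
  obtains r \<theta> where "0 \<le> r" "z = r *\<^sub>R dir \<theta>" "0 \<le> \<theta>" "\<theta> < 2 * pi"
proof (cases "z = 0")
  case True
  then show ?thesis using that[of 0 0] by simp
next
  case False
  define x y where "x = z $ 1 / norm z" and "y = z $ 2 / norm z"
  have "(z $ 1)\<^sup>2 + (z $ 2)\<^sup>2 = (norm z)\<^sup>2"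
    by (simp add: norm_vec_def L2_set_def sum_2)
  then have "x\<^sup>2 + y\<^sup>2 = 1" using False by (simp add: x_def y_def power_divide flip: add_divide_distrib)
  then obtain t where t: "0 \<le> t" "t < 2 * pi" "x = cos t" "y = sin t" using sincos_total_2pi by blast
  have "z = norm z *\<^sub>R dir t"
    using False t(3,4)[symmetric] by (simp add: vec_eq_iff forall_2 x_def y_def)
  then show ?thesis using that[of "norm z" t] t by simp
qed

locale polar_body = polar_gauge +
  fixes K :: "(real^2) set"
  assumes K_compact: "compact K"
    and K_iff: "0 \<le> r \<Longrightarrow> r *\<^sub>R dir \<theta> \<in> K \<longleftrightarrow> r * \<gamma> \<theta> \<le> 1"
    and K_frontier: "frontier K = range (\<lambda>\<theta>. (1 / \<gamma> \<theta>) *\<^sub>R dir \<theta>)"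
begin

definition pt :: "real \<Rightarrow> real^2" where "pt \<theta> = (1 / \<gamma> \<theta>) *\<^sub>R dir \<theta>"

lemma image_between_balls:
  fixes T :: "real^2^2"
  assumes T: "invertible T" and b: "\<And>\<theta>. r1 \<le> norm (T *v pt \<theta>)" "\<And>\<theta>. norm (T *v pt \<theta>) \<le> r2"
  shows "cball 0 r1 \<subseteq> mat_image T K" "mat_image T K \<subseteq> cball 0 r2"
proof -
  have norm_eq: "norm (T *v (r *\<^sub>R dir \<theta>)) = (r * \<gamma> \<theta>) * norm (T *v pt \<theta>)" if "0 \<le> r" for r \<theta>
  proof -
    have "r *\<^sub>R dir \<theta> = (r * \<gamma> \<theta>) *\<^sub>R pt \<theta>" by (simp add: pt_def)
    then show ?thesis using that pos[of \<theta>]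
      by (simp only: matrix_vector_mult_scaleR norm_scaleR) (simp add: abs_mult)
  qed
  show "cball 0 r1 \<subseteq> mat_image T K"
  proof
    fix z :: "real^2" assume z: "z \<in> cball 0 r1"
    obtain y where y: "z = T *v y"
      using T by (metis invertible_def matrix_vector_mul_assoc matrix_vector_mul_lid)
    obtain r \<theta> where r: "0 \<le> r" "y = r *\<^sub>R dir \<theta>" using polar_form by metis
    have "T *v pt \<theta> \<noteq> 0"
    proof
      assume "T *v pt \<theta> = 0"
      then have "pt \<theta> = 0" using T
        by (metis invertible_def matrix_vector_mul_assoc matrix_vector_mul_lid matrix_vector_mult_0_right)
      then have "norm (pt \<theta>) = 0" by simp
      then show False by (simp add: pt_def)
    qed
    then have p: "norm (T *v pt \<theta>) > 0" by simp
    have "(r * \<gamma> \<theta>) * norm (T *v pt \<theta>) \<le> 1 * norm (T *v pt \<theta>)"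
      using z norm_eq[OF r(1), of \<theta>] b(1)[of \<theta>] by (simp add: y r(2))
    then have "r * \<gamma> \<theta> \<le> 1" using p by (simp only: mult_le_cancel_right_pos)
    then have "y \<in> K" using K_iff[OF r(1)] r(2) by simp
    then show "z \<in> mat_image T K" using y by blast
  qed
  show "mat_image T K \<subseteq> cball 0 r2"
  proof
    fix z assume "z \<in> mat_image T K"
    then obtain y where y: "y \<in> K" "z = T *v y" by blast
    obtain r \<theta> where r: "0 \<le> r" "y = r *\<^sub>R dir \<theta>" using polar_form by metis
    have "r * \<gamma> \<theta> \<le> 1" using y r K_iff by simp
    then have "norm z \<le> 1 * norm (T *v pt \<theta>)"
      unfolding y r(2) norm_eq[OF r(1)] by (intro mult_right_mono) auto
    then show "z \<in> cball 0 r2" using b(2)[of \<theta>] by simp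
  qed
qed

text \<open>The matrix \<open>T\<close> sends the boundary points with parameters \<open>0\<close> and \<open>pi/2\<close> to \<open>r\<close> times the standard basis, where
  \<open>r\<^sup>2\<close> is their determinant \<open>d\<close>; this is what makes the determinant of \<open>T\<close> equal to \<open>1\<close>.  The bound on \<open>r\<close> follows
  by comparing areas with the inner disc.\<close>

theorem near_round:
  assumes area: "area K = pi" and norm: "\<tau> pi = pi" and def: "deficit \<le> pi * \<epsilon>" "0 < \<epsilon>"
  defines "\<delta> \<equiv> exp (\<kappa> * sqrt \<epsilon>) - 1"
  assumes \<delta>: "\<delta> \<le> 1/100"
  obtains T r where "special_linear T" "0 < r" "r \<le> 2"
    "cball 0 (r * (1 - 28 * \<delta>)) \<subseteq> mat_image T K" "mat_image T K \<subseteq> cball 0 (r * (1 + 28 * \<delta>))"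
proof -
  obtain \<theta> where \<theta>: "\<And>t. \<tau> (\<theta> t) = t" using tau_surj by metis
  have inj: "\<theta> (\<tau> x) = x" for x using \<theta>[of "\<tau> x"] tau_strict_mono by (metis less_irrefl neqE)
  have \<theta>shift: "\<theta> (t + pi) = \<theta> t + pi" for t
    using inj[of "\<theta> t + pi"] by (simp add: tau_shift[OF norm] \<theta>)
  define X where "X t = pt (\<theta> t)" for t
  define W where "W s t = X s $ 1 * X t $ 2 - X s $ 2 * X t $ 1" for s t
  have Wc: "W s t = cross (\<theta> s) (\<theta> t)" for s t
    by (simp add: W_def X_def pt_def cross_def sin_diff diff_divide_distrib algebra_simps)
  have Xshift: "X (t + pi) = - X t" for t
    by (simp add: X_def \<theta>shift pt_def per vec_eq_iff forall_2)
  have ord: "\<theta> s < \<theta> t" if "s < t" for s t using that tau_mono_iff[of "\<theta> s" "\<theta> t"] by (simp add: \<theta>)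
  have approx: "\<bar>W s (s + t) - W s (s + pi/2) * sin t\<bar> \<le> \<delta> * W s (s + pi/2)"
    if "pi/8 \<le> t" "t \<le> 7*pi/8" for s t
    using cross_approx[OF norm def, of "\<theta> (s+t)" "\<theta> s" "\<theta> (s + pi/2)"] that
    by (simp add: \<theta> Wc \<delta>_def)
  define d where "d = W 0 (pi/2)"
  have "\<theta> (pi/2) < \<theta> 0 + pi" using ord[of "pi/2" "0+pi"] \<theta>shift[of 0] by simp
  then have d: "d > 0" unfolding d_def Wc using ord[of 0 "pi/2"] by (intro cross_pos) auto
  define u w where "u t = W t (pi/2) / d" and "w t = W 0 t / d" for t
  have decomp: "W s t = d * (u s * w t - w s * u t)" for s t
  proof -
    have "W s t * d = W s (pi/2) * W 0 t - W 0 s * W t (pi/2)"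
      by (simp add: d_def W_def algebra_simps)
    moreover have "d * (u s * w t - w s * u t) = (W s (pi/2) * W 0 t - W 0 s * W t (pi/2)) / d"
    proof -
      have "d * (A / d * (B / d) - C / d * (E / d)) = (A * B - C * E) / d" for A B C E :: real
        using d by (simp add: field_simps)
      then show ?thesis unfolding u_def w_def .
    qed
    ultimately have "W s t * d = d * (u s * w t - w s * u t) * d" using d by simp
    then show ?thesis using d by (simp only: mult_cancel_right) simp
  qed
  have Wneg: "W (s + pi) t = - W s t" "W s (t + pi) = - W s t" for s t
    unfolding W_def Xshift by simp_all
  interpret almost_trigonometric u w \<delta>
  proof
    show "u 0 = 1" "w (pi/2) = 1" using d by (simp_all add: u_def w_def d_def)
    show "w 0 = 0" "u (pi/2) = 0" by (simp_all add: u_def w_def W_def)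
    show "u (t + pi) = - u t" "w (t + pi) = - w t" for t by (simp_all add: u_def w_def Wneg)
    show "0 \<le> \<delta>" using def kappa_pos by (simp add: \<delta>_def)
    show "\<delta> \<le> 1/100" by (rule \<delta>)
    show "\<bar>(u s * w (s + t) - w s * u (s + t)) - (u s * w (s + pi/2) - w s * u (s + pi/2)) * sin t\<bar>
        \<le> \<delta> * (u s * w (s + pi/2) - w s * u (s + pi/2))" (is "?L \<le> ?R")
      if "pi/8 \<le> t" "t \<le> 7*pi/8" for s t
    proof -
      have "W s (s + t) - W s (s + pi/2) * sin t = d * ((u s * w (s + t) - w s * u (s + t))
          - (u s * w (s + pi/2) - w s * u (s + pi/2)) * sin t)"
        unfolding decomp by (simp only: right_diff_distrib left_diff_distrib mult.assoc)
      then have "\<bar>W s (s + t) - W s (s + pi/2) * sin t\<bar> = d * ?L"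
        using d by (simp add: abs_mult)
      moreover have "\<delta> * W s (s + pi/2) = d * ?R" unfolding decomp by simp
      ultimately have "d * ?L \<le> d * ?R" using approx[OF that, of s] by (simp only:)
      then show ?thesis using d by (simp only: mult_le_cancel_left_pos)
    qed
  qed
  define r where "r = sqrt d"
  have r: "r > 0" "r * r = d" using d by (auto simp: r_def)
  define T :: "real^2^2" where "T = vector [vector [X (pi/2) $ 2 / r, - X (pi/2) $ 1 / r],
      vector [- X 0 $ 2 / r, X 0 $ 1 / r]]"
  have r0: "r \<noteq> 0" using r by simp
  have T1: "T *v X t = vector [r * u t, r * w t]" for t
  proof -
    have "r * u t = W t (pi/2) / r" unfolding u_def r(2)[symmetric] using r0 by simp
    then have "X (pi/2) $ 2 / r * X t $ 1 + - X (pi/2) $ 1 / r * X t $ 2 = r * u t"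
      by (simp add: W_def diff_divide_distrib mult.commute)
    moreover have "r * w t = W 0 t / r" unfolding w_def r(2)[symmetric] using r0 by simp
    then have "- X 0 $ 2 / r * X t $ 1 + X 0 $ 1 / r * X t $ 2 = r * w t"
      by (simp add: W_def diff_divide_distrib mult.commute)
    ultimately show ?thesis
      by (simp add: T_def vec_eq_iff forall_2 matrix_vector_mult_def sum_2)
  qed
  have detT: "det T = 1"
  proof -
    have "det T = d / (r * r)"
      by (simp add: T_def det_2 d_def W_def diff_divide_distrib algebra_simps)
    then show ?thesis using r d by simp
  qed
  have circ: "\<bar>norm (vector [x, y] :: real^2) - 1\<bar> \<le> \<bar>x - cos t\<bar> + \<bar>y - sin t\<bar>" for x y t
  proof -
    have "\<bar>norm (vector [x, y] :: real^2) - norm (dir t)\<bar> \<le> norm (vector [x, y] - dir t)"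
      by (rule norm_triangle_ineq3)
    also have "\<dots> \<le> \<bar>x - cos t\<bar> + \<bar>y - sin t\<bar>"
      using norm_le_l1_cart[of "vector [x, y] - dir t"] by (simp add: sum_2)
    finally show ?thesis by simp
  qed
  have TX: "\<bar>norm (T *v X t) - r\<bar> \<le> r * (28 * \<delta>)" for t
  proof -
    have "T *v X t = r *\<^sub>R vector [u t, w t]" by (simp add: T1 vec_eq_iff forall_2)
    then have "norm (T *v X t) - r = r * (norm (vector [u t, w t] :: real^2) - 1)"
      using r by (simp add: algebra_simps)
    then have "\<bar>norm (T *v X t) - r\<bar> = r * \<bar>norm (vector [u t, w t] :: real^2) - 1\<bar>"
      using r by (simp add: abs_mult)
    also have "\<dots> \<le> r * (28 * \<delta>)"
      using circ[of "u t" "w t" t] u_close[of t] w_close[of t] r by (intro mult_left_mono) auto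
    finally show ?thesis .
  qed
  have Tpt: "\<bar>norm (T *v pt x) - r\<bar> \<le> r * (28 * \<delta>)" for x
    using TX[of "\<tau> x"] by (simp add: X_def inj)
  have invT: "invertible T" using detT by (simp add: invertible_det_nz)
  have b1: "r * (1 - 28 * \<delta>) \<le> norm (T *v pt x)" for x
    using Tpt[of x] by (simp add: abs_le_iff algebra_simps)
  have b2: "norm (T *v pt x) \<le> r * (1 + 28 * \<delta>)" for x
    using Tpt[of x] by (simp add: abs_le_iff algebra_simps)
  note sub = image_between_balls[OF invT b1 b2]
  have "r \<le> 2"
  proof -
    have mK: "K \<in> lmeasurable" using K_compact by (rule lmeasurable_compact)
    have mTK: "mat_image T K \<in> lmeasurable"
      using mK by (intro measurable_linear_image) auto
    have "measure lebesgue (mat_image T K) = \<bar>det (matrix ((*v) T))\<bar> * area K"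
      using mK by (intro measure_linear_image) auto
    then have aT: "area (mat_image T K) = pi" using detT area by simp
    define R where "R = r * (1 - 28 * \<delta>)"
    have R: "R \<ge> 0" using r \<delta> by (simp add: R_def)
    have "area (cball 0 R) \<le> area (mat_image T K)"
      using sub(1) mTK by (intro measure_mono_fmeasurable) (auto simp: R_def)
    moreover have "area (cball 0 R) = pi * R\<^sup>2"
      using R content_cball[of R "0::real^2"] by (simp add: unit_ball_vol_2)
    ultimately have "R\<^sup>2 \<le> 1" using aT by simp
    then have "R \<le> 1" by (simp add: abs_square_le_1 flip: abs_le_iff)
    moreover have "r * (1/2) \<le> R" unfolding R_def using r \<delta> by (intro mult_left_mono) auto
    ultimately show ?thesis by simp
  qed
  moreover have "special_linear T" by (simp add: special_linear_def detT)
  ultimately show ?thesis using that r(1) sub by blast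
qed

end

section \<open>Polar description and area of a convex body\<close>

lemma dir_shift: "dir \<phi> = cos (\<phi> - \<theta>) *\<^sub>R dir \<theta> + sin (\<phi> - \<theta>) *\<^sub>R dir (\<theta> + pi/2)"
proof -
  have "cos \<phi> = cos ((\<phi> - \<theta>) + \<theta>)" "sin \<phi> = sin ((\<phi> - \<theta>) + \<theta>)" by simp_all
  then show ?thesis
    unfolding cos_add sin_add by (simp add: vec_eq_iff forall_2 cos_add sin_add)
qed

lemma dir_pi: "dir (\<theta> + pi) = - dir \<theta>"
  by (simp add: vec_eq_iff forall_2)

text \<open>Every ray from the origin leaves \<open>K\<close> exactly once, at a distance \<open>\<rho> \<theta>\<close>, and \<open>\<gamma> = 1 / \<rho>\<close>.  A supporting line at the
  exit point, written as \<open>c \<bullet> y = 1\<close>, supplies the supporting sinusoid \<open>c \<bullet> dir \<phi>\<close>.\<close>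

lemma polar_body_of_convex_body:
  assumes K: "convex_body K" and sym: "origin_symmetric K"
  obtains \<gamma> m M where "polar_body \<gamma> m M K"
proof -
  have comp: "compact K" and conv: "convex K" and ne: "interior K \<noteq> {}"
    using K by (auto simp: convex_body_def)
  have neg: "- x \<in> K \<longleftrightarrow> x \<in> K" for x
    using sym unfolding origin_symmetric_def by (metis image_eqI minus_minus imageE)
  have zero: "0 \<in> interior K"
  proof -
    obtain x where x: "x \<in> interior K" using ne by blast
    have "- x \<in> interior (uminus ` K)" using x by (simp add: interior_negations)
    then have "- x \<in> interior K" using sym by (simp add: origin_symmetric_def)
    then have "(1/2) *\<^sub>R x + (1/2) *\<^sub>R (- x) \<in> interior K"
      using x convex_interior[OF conv] by (intro convexD) auto
    then show ?thesis by simp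
  qed
  obtain e where e: "e > 0" "ball 0 e \<subseteq> K" using zero by (auto simp: mem_interior)
  obtain R where R: "R > 0" "K \<subseteq> cball 0 R"
    using compact_imp_bounded[OF comp] unfolding bounded_pos by (auto simp: subset_iff)
  have "\<exists>d>0. d *\<^sub>R dir \<theta> \<in> frontier K \<and> (\<forall>r. 0 \<le> r \<and> r < d \<longrightarrow> r *\<^sub>R dir \<theta> \<in> interior K)" for \<theta>
  proof -
    have "dir \<theta> \<noteq> 0" using norm_dir[of \<theta>] by force
    then show ?thesis
      using ray_to_frontier[OF compact_imp_bounded[OF comp] zero, of "dir \<theta>"] by (metis add_0)
  qed
  then obtain \<rho> where \<rho>: "\<And>\<theta>. \<rho> \<theta> > 0" "\<And>\<theta>. \<rho> \<theta> *\<^sub>R dir \<theta> \<in> frontier K"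
    "\<And>\<theta> r. 0 \<le> r \<Longrightarrow> r < \<rho> \<theta> \<Longrightarrow> r *\<^sub>R dir \<theta> \<in> interior K" by metis
  have clK: "closed K" using comp by (rule compact_imp_closed)
  have frK: "frontier K \<subseteq> K" using clK by (rule frontier_subset_closed)
  have notint: "x \<notin> interior K" if "x \<in> frontier K" for x using that by (simp add: frontier_def)
  have iff: "r *\<^sub>R dir \<theta> \<in> K \<longleftrightarrow> r \<le> \<rho> \<theta>" if r: "0 \<le> r" for r \<theta>
  proof
    assume in_K: "r *\<^sub>R dir \<theta> \<in> K"
    show "r \<le> \<rho> \<theta>"
    proof (rule ccontr)
      assume "\<not> r \<le> \<rho> \<theta>"
      then have lt: "\<rho> \<theta> < r" by simp
      define t where "t = 1 - \<rho> \<theta> / r"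
      have t: "0 < t" "t \<le> 1" using lt \<rho>(1)[of \<theta>] by (auto simp: t_def)
      have "r *\<^sub>R dir \<theta> - t *\<^sub>R (r *\<^sub>R dir \<theta> - 0) \<in> interior K"
        using in_K t zero closure_subset[of K] by (intro mem_interior_closure_convex_shrink conv) auto
      also have "r *\<^sub>R dir \<theta> - t *\<^sub>R (r *\<^sub>R dir \<theta> - 0) = (r - t * r) *\<^sub>R dir \<theta>"
        by (simp add: scaleR_left_diff_distrib)
      also have "r - t * r = \<rho> \<theta>" using lt \<rho>(1)[of \<theta>] by (simp add: t_def field_simps)
      finally show False using notint[OF \<rho>(2)[of \<theta>]] by blast
    qed
  next
    assume "r \<le> \<rho> \<theta>"
    then show "r *\<^sub>R dir \<theta> \<in> K"
      using \<rho>(2)[of \<theta>] \<rho>(3)[OF r, of \<theta>] frK interior_subset by (cases "r = \<rho> \<theta>") auto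
  qed
  define \<gamma> where "\<gamma> \<theta> = 1 / \<rho> \<theta>" for \<theta>
  have g\<rho>: "1 / \<gamma> \<theta> = \<rho> \<theta>" for \<theta> by (simp add: \<gamma>_def)
  have "polar_body \<gamma> (1 / R) (2 / e) K"
  proof
    show "0 < 1 / R" using R by simp
    fix \<theta>
    have "norm (\<rho> \<theta> *\<^sub>R dir \<theta>) \<le> R" using R(2) frK \<rho>(2)[of \<theta>] by auto
    then have "\<rho> \<theta> \<le> R" using \<rho>(1)[of \<theta>] by simp
    then show "1 / R \<le> \<gamma> \<theta>" unfolding \<gamma>_def using \<rho>(1)[of \<theta>] by (intro divide_left_mono) auto
    have "(e/2) *\<^sub>R dir \<theta> \<in> K" using e by (intro subsetD[OF e(2)]) auto
    then have "e / 2 \<le> \<rho> \<theta>" using iff[of "e/2" \<theta>] e by simp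
    then have "1 / \<rho> \<theta> \<le> 1 / (e/2)" using e by (intro divide_left_mono) auto
    then show "\<gamma> \<theta> \<le> 2 / e" by (simp add: \<gamma>_def)
    have flip: "r *\<^sub>R dir (\<theta> + pi) \<in> K \<longleftrightarrow> r *\<^sub>R dir \<theta> \<in> K" for r
      using neg[of "r *\<^sub>R dir \<theta>"] by (simp add: dir_pi)
    have "r \<le> \<rho> (\<theta> + pi) \<longleftrightarrow> r \<le> \<rho> \<theta>" if "0 \<le> r" for r
      using flip[of r] iff[OF that, of \<theta>] iff[OF that, of "\<theta> + pi"] by blast
    from this[of "\<rho> \<theta>"] this[of "\<rho> (\<theta> + pi)"] have "\<rho> (\<theta> + pi) = \<rho> \<theta>"
      using \<rho>(1)[of \<theta>] \<rho>(1)[of "\<theta>+pi"] by auto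
    then show "\<gamma> (\<theta> + pi) = \<gamma> \<theta>" by (simp add: \<gamma>_def)
    show "\<exists>b. \<forall>\<phi>. \<gamma> \<theta> * cos (\<phi> - \<theta>) + b * sin (\<phi> - \<theta>) \<le> \<gamma> \<phi>"
    proof -
      define x where "x = \<rho> \<theta> *\<^sub>R dir \<theta>"
      have ri: "rel_interior K = interior K" using ne by (rule rel_interior_nonempty_interior)
      have "x \<in> closure K" "x \<notin> rel_interior K"
        using \<rho>(2)[of \<theta>] frK closure_subset notint unfolding x_def ri by auto
      then obtain a where a: "\<And>y. y \<in> closure K \<Longrightarrow> a \<bullet> x \<le> a \<bullet> y"
        "\<And>y. y \<in> rel_interior K \<Longrightarrow> a \<bullet> x < a \<bullet> y"
        using supporting_hyperplane_relative_frontier[OF conv] by metis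
      have ax: "a \<bullet> x < 0" using a(2)[of 0] zero by (simp add: ri)
      define c where "c = (1 / (a \<bullet> x)) *\<^sub>R a"
      have c1: "c \<bullet> y \<le> 1" if "y \<in> K" for y
        using a(1)[of y] that closure_subset ax by (auto simp: c_def divide_le_eq)
      have "c \<bullet> x = 1" using ax by (simp add: c_def)
      then have cx: "c \<bullet> dir \<theta> = \<gamma> \<theta>" using \<rho>(1)[of \<theta>] by (simp add: x_def \<gamma>_def field_simps)
      have "\<gamma> \<theta> * cos (\<phi> - \<theta>) + (c \<bullet> dir (\<theta> + pi/2)) * sin (\<phi> - \<theta>) \<le> \<gamma> \<phi>" for \<phi>
      proof -
        have "c \<bullet> (\<rho> \<phi> *\<^sub>R dir \<phi>) \<le> 1" using \<rho>(2)[of \<phi>] frK by (intro c1) auto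
        then have "c \<bullet> dir \<phi> \<le> \<gamma> \<phi>" using \<rho>(1)[of \<phi>] by (simp add: \<gamma>_def field_simps)
        moreover have "c \<bullet> dir \<phi> = \<gamma> \<theta> * cos (\<phi> - \<theta>) + (c \<bullet> dir (\<theta> + pi/2)) * sin (\<phi> - \<theta>)"
          by (subst dir_shift[of \<phi> \<theta>]) (simp add: inner_add_right cx)
        ultimately show ?thesis by simp
      qed
      then show ?thesis by blast
    qed
  next
    show "compact K" by (fact comp)
    show "r *\<^sub>R dir \<theta> \<in> K \<longleftrightarrow> r * \<gamma> \<theta> \<le> 1" if "0 \<le> r" for r \<theta>
      using iff[OF that, of \<theta>] \<rho>(1)[of \<theta>] by (simp add: \<gamma>_def)
    show "frontier K = range (\<lambda>\<theta>. (1 / \<gamma> \<theta>) *\<^sub>R dir \<theta>)"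
    proof
      show "range (\<lambda>\<theta>. (1 / \<gamma> \<theta>) *\<^sub>R dir \<theta>) \<subseteq> frontier K" using \<rho>(2) by (auto simp: g\<rho>)
      show "frontier K \<subseteq> range (\<lambda>\<theta>. (1 / \<gamma> \<theta>) *\<^sub>R dir \<theta>)"
      proof
        fix z assume z: "z \<in> frontier K"
        obtain r \<theta> where r: "0 \<le> r" "z = r *\<^sub>R dir \<theta>" using polar_form by metis
        have "r \<le> \<rho> \<theta>" using z frK r iff by auto
        moreover have "\<not> r < \<rho> \<theta>" using \<rho>(3)[OF r(1), of \<theta>] notint[OF z] r(2) by auto
        ultimately have "r = \<rho> \<theta>" by simp
        then show "z \<in> range (\<lambda>\<theta>. (1 / \<gamma> \<theta>) *\<^sub>R dir \<theta>)" using r by (auto simp: g\<rho>)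
      qed
    qed
  qed
  then show ?thesis using that by blast
qed

abbreviation vec2 :: "real \<times> real \<Rightarrow> real^2" where "vec2 z \<equiv> vector [fst z, snd z]"

lemma vec2_measurable [measurable]: "vec2 \<in> lborel \<Otimes>\<^sub>M lborel \<rightarrow>\<^sub>M borel"
proof -
  have eq: "vec2 = (\<lambda>z. fst z *\<^sub>R axis 1 1 + snd z *\<^sub>R axis 2 1)"
    by (simp add: fun_eq_iff vec_eq_iff forall_2 axis_def)
  show ?thesis unfolding eq by measurable
qed

lemma lborel_real2: "(lborel :: (real^2) measure) = distr (lborel \<Otimes>\<^sub>M lborel) borel vec2"
proof (rule lborel_eqI)
  fix l u :: "real^2" assume le: "\<And>b. b \<in> Basis \<Longrightarrow> l \<bullet> b \<le> u \<bullet> b"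
  have ax: "axis 1 1 \<in> (Basis :: (real^2) set)" "axis 2 1 \<in> (Basis :: (real^2) set)"
    by (auto simp: Basis_vec_def)
  have l1: "l $ 1 \<le> u $ 1" "l $ 2 \<le> u $ 2"
    using le[OF ax(1)] le[OF ax(2)] by (simp_all add: inner_axis)
  have pre: "vec2 -` box l u \<inter> space (lborel \<Otimes>\<^sub>M lborel) = {l $ 1<..<u $ 1} \<times> {l $ 2<..<u $ 2}"
    by (auto simp: mem_box_cart forall_2 space_pair_measure)
  have "emeasure (distr (lborel \<Otimes>\<^sub>M lborel) borel vec2) (box l u)
      = emeasure (lborel \<Otimes>\<^sub>M lborel) ({l $ 1<..<u $ 1} \<times> {l $ 2<..<u $ 2})"
    by (subst emeasure_distr) (auto simp: pre)
  also have "\<dots> = emeasure lborel {l $ 1<..<u $ 1} * emeasure lborel {l $ 2<..<u $ 2}"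
    by (rule lborel.emeasure_pair_measure_Times) auto
  also have "\<dots> = ennreal ((u $ 1 - l $ 1) * (u $ 2 - l $ 2))"
    using l1 by (simp add: ennreal_mult)
  also have "(u $ 1 - l $ 1) * (u $ 2 - l $ 2) = (\<Prod>b\<in>Basis. (u - l) \<bullet> b)"
  proof -
    have B: "(Basis :: (real^2) set) = {axis 1 1, axis 2 1}"
    proof -
      have "(Basis :: (real^2) set) = (\<lambda>i. axis i 1) ` UNIV" by (auto simp: Basis_vec_def)
      then show ?thesis unfolding UNIV_2 by simp
    qed
    have "axis 1 1 \<noteq> (axis 2 1 :: real^2)" by (simp add: axis_eq_axis)
    then show ?thesis unfolding B by (simp add: inner_axis)
  qed
  finally show "emeasure (distr (lborel \<Otimes>\<^sub>M lborel) borel vec2) (box l u) = (\<Prod>b\<in>Basis. (u - l) \<bullet> b)" .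
qed simp

lemma nn_integral_abs_Icc:
  assumes "0 \<le> c"
  shows "(\<integral>\<^sup>+x. ennreal \<bar>x\<bar> * indicator {-c..c} x \<partial>lborel) = ennreal (c\<^sup>2)"
proof -
  have "((\<lambda>x. - x) has_integral ((- 0\<^sup>2/2) - (- (-c)\<^sup>2/2))) {-c..0}"
    using assms by (intro fundamental_theorem_of_calculus)
      (auto simp: has_real_derivative_iff_has_vector_derivative[symmetric] intro!: derivative_eq_intros)
  then have 1: "((\<lambda>x. \<bar>x\<bar>) has_integral (c\<^sup>2/2)) {-c..0}"
    by (rule has_integral_eq_rhs[OF has_integral_eq[rotated]]) auto
  have "((\<lambda>x. x) has_integral (c\<^sup>2/2 - 0\<^sup>2/2)) {0..c}"
    using assms by (intro fundamental_theorem_of_calculus)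
      (auto simp: has_real_derivative_iff_has_vector_derivative[symmetric] intro!: derivative_eq_intros)
  then have 2: "((\<lambda>x. \<bar>x\<bar>) has_integral (c\<^sup>2/2)) {0..c}"
    by (rule has_integral_eq_rhs[OF has_integral_eq[rotated]]) auto
  have "((\<lambda>x. \<bar>x\<bar>) has_integral (c\<^sup>2/2 + c\<^sup>2/2)) {-c..c}"
    using assms by (intro has_integral_combine[OF _ _ 1 2]) auto
  then have "integral\<^sup>N lborel (\<lambda>x. indicator {-c..c} x * \<bar>x\<bar>) = c\<^sup>2"
    by (intro nn_integral_has_integral_lebesgue) auto
  moreover have "ennreal (indicator {-c..c} x * \<bar>x\<bar>) = ennreal \<bar>x\<bar> * indicator {-c..c} x" for x
    by (auto simp: indicator_def)
  ultimately show ?thesis by simp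
qed

lemma nn_integral_FTC_UNIV:
  fixes f F :: "real \<Rightarrow> real"
  assumes [measurable]: "f \<in> borel_measurable borel" and d: "\<And>x. DERIV F x :> f x" and nn: "\<And>x. 0 \<le> f x"
    and lim: "(F \<longlongrightarrow> T1) at_top" "(F \<longlongrightarrow> T0) at_bot"
  shows "(\<integral>\<^sup>+x. ennreal (f x) \<partial>lborel) = ennreal (T1 - T0)"
proof -
  have mono: "x \<le> y \<Longrightarrow> F x \<le> F y" for x y
    by (rule DERIV_nonneg_imp_nondecreasing) (use d nn in blast)+
  have T1: "F 0 \<le> T1" using lim(1)
    by (rule tendsto_lowerbound) (auto intro!: eventually_at_top_linorderI[of 0] mono)
  have T0: "T0 \<le> F 0" using lim(2)
    by (rule tendsto_upperbound) (auto intro!: eventually_at_bot_linorderI[of 0] mono simp: eventually_at_bot_linorder)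
  have A: "(\<integral>\<^sup>+x. ennreal (f x) * indicator {0..} x \<partial>lborel) = T1 - F 0"
    by (rule nn_integral_FTC_atLeast) (auto intro: d nn lim)
  have B: "(\<integral>\<^sup>+x. ennreal (f (-x)) * indicator {0..} x \<partial>lborel) = - T0 - - F (- 0)"
  proof (rule nn_integral_FTC_atLeast[where F = "\<lambda>x. - F (- x)"])
    show "((\<lambda>x. - F (- x)) has_real_derivative f (- x)) (at x)" for x
      using DERIV_minus[OF DERIV_chain2[OF d[of "-x"] DERIV_minus[OF DERIV_ident]]] by simp
    show "((\<lambda>x. - F (- x)) \<longlongrightarrow> - T0) at_top"
      by (intro tendsto_minus filterlim_compose[OF lim(2)] filterlim_uminus_at_bot_at_top)
  qed (auto intro: nn)
  have C: "(\<integral>\<^sup>+x. ennreal (f x) * indicator {..0} x \<partial>lborel)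
      = (\<integral>\<^sup>+x. ennreal (f (-x)) * indicator {0..} x \<partial>lborel)"
    by (subst nn_integral_real_affine[where c = "-1" and t = 0])
       (auto intro!: nn_integral_cong simp: indicator_def)
  have "(\<integral>\<^sup>+x. ennreal (f x) \<partial>lborel)
      = (\<integral>\<^sup>+x. ennreal (f x) * indicator {0..} x + ennreal (f x) * indicator {..0} x \<partial>lborel)"
    using AE_lborel_singleton[of 0]
    by (intro nn_integral_cong_AE) (auto elim!: eventually_mono simp: indicator_def)
  also have "\<dots> = ennreal (T1 - F 0) + ennreal (F 0 - T0)"
    by (subst nn_integral_add) (simp_all add: A B C)
  also have "\<dots> = ennreal (T1 - T0)" using T1 T0 by (simp flip: ennreal_plus)
  finally show ?thesis .
qed

context polar_body begin

text \<open>In the coordinates \<open>(x, x t)\<close> each line through the origin is parametrized by \<open>x\<close>; negative \<open>x\<close> correspond to the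
  opposite direction, where the gauge has the same value.\<close>

lemma mem_slope_iff: "(vector [x, x * t] :: real^2) \<in> K \<longleftrightarrow> \<bar>x\<bar> \<le> 1 / (\<gamma> (arctan t) * sqrt (1 + t\<^sup>2))"
proof -
  define s where "s = sqrt (1 + t\<^sup>2)"
  have s: "s > 0" by (auto simp: s_def add_pos_nonneg)
  have d: "dir (arctan t) = vector [1 / s, t / s]"
    by (simp add: dir_def cos_arctan sin_arctan s_def)
  have abs_mem: "(vector [x, x * t] :: real^2) \<in> K \<longleftrightarrow> \<bar>x\<bar> * s * \<gamma> (arctan t) \<le> 1"
  proof (cases "x \<ge> 0")
    case True
    have "vector [x, x * t] = (\<bar>x\<bar> * s) *\<^sub>R dir (arctan t)"
      using True s by (simp add: d vec_eq_iff forall_2)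
    then show ?thesis using K_iff[of "\<bar>x\<bar> * s" "arctan t"] s by simp
  next
    case False
    have "vector [x, x * t] = (\<bar>x\<bar> * s) *\<^sub>R dir (arctan t + pi)"
      using False s by (simp add: dir_pi d vec_eq_iff forall_2)
    then show ?thesis using K_iff[of "\<bar>x\<bar> * s" "arctan t + pi"] s by (simp add: per)
  qed
  show ?thesis unfolding abs_mem s_def[symmetric] using s pos[of "arctan t"]
    by (simp add: le_divide_eq mult.commute mult.left_commute)
qed

text \<open>Fubini in the coordinates \<open>(x, x t)\<close>, whose area element is \<open>\<bar>x\<bar> dx dt\<close>: integrating over \<open>x\<close> first leaves
  \<open>\<gamma> (arctan t)\<^sup>-\<^sup>2 / (1 + t\<^sup>2)\<close>, which is the derivative of \<open>\<tau> (arctan t)\<close>.\<close>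

theorem area_eq_tau: "area K = \<tau> pi"
proof -
  define G where "G t = 1 / (\<gamma> (arctan t) * sqrt (1 + t\<^sup>2))" for t
  have Gpos: "G t \<ge> 0" for t unfolding G_def using pos[of "arctan t"] by simp
  have Gc: "continuous_on UNIV G"
    unfolding G_def by (intro continuous_intros continuous_on_compose2[OF gamma_cont[of UNIV]])
      (auto simp: add_nonneg_eq_0_iff)
  have [measurable]: "G \<in> borel_measurable borel" by (rule borel_measurable_continuous_onI[OF Gc])
  have Kb [measurable]: "K \<in> sets borel" using K_compact by (simp add: borel_compact)
  have Kb' [measurable]: "K \<in> sets lborel" using Kb by simp
  have ind_meas: "(\<lambda>z. indicator K (vec2 z) :: ennreal) \<in> borel_measurable (lborel \<Otimes>\<^sub>M lborel)"
    by measurable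
  have "emeasure lborel K = (\<integral>\<^sup>+z. indicator K z \<partial>distr (lborel \<Otimes>\<^sub>M lborel) borel vec2)"
    by (subst lborel_real2[symmetric]) simp
  also have "\<dots> = (\<integral>\<^sup>+z. indicator K (vec2 z) \<partial>(lborel \<Otimes>\<^sub>M lborel))"
    by (rule nn_integral_distr) measurable
  also have "\<dots> = (\<integral>\<^sup>+x. \<integral>\<^sup>+y. indicator K (vec2 (x, y)) \<partial>lborel \<partial>lborel)"
    by (rule lborel.nn_integral_fst[symmetric, OF ind_meas])
  also have "\<dots> = (\<integral>\<^sup>+x. \<integral>\<^sup>+t. ennreal \<bar>x\<bar> * indicator {-G t..G t} x \<partial>lborel \<partial>lborel)"
  proof (rule nn_integral_cong_AE, use AE_lborel_singleton[of 0] in eventually_elim)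
    fix x :: real assume x: "x \<noteq> 0"
    have km [measurable]: "(\<lambda>y. indicator K (vec2 (x, y)) :: ennreal) \<in> borel_measurable borel"
      using measurable_Pair2[OF ind_meas, of x] by simp
    have "(\<integral>\<^sup>+y. indicator K (vec2 (x, y)) \<partial>lborel) = \<bar>x\<bar> * (\<integral>\<^sup>+t. indicator K (vec2 (x, 0 + x * t)) \<partial>lborel)"
      by (rule nn_integral_real_affine[OF km x])
    also have "\<dots> = (\<integral>\<^sup>+t. ennreal \<bar>x\<bar> * indicator K (vec2 (x, 0 + x * t)) \<partial>lborel)"
      by (rule nn_integral_cmult[symmetric]) measurable
    also have "\<dots> = (\<integral>\<^sup>+t. ennreal \<bar>x\<bar> * indicator {-G t..G t} x \<partial>lborel)"
      by (intro nn_integral_cong) (auto simp: indicator_def mem_slope_iff G_def[symmetric] abs_le_iff)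
    finally show "(\<integral>\<^sup>+y. indicator K (vec2 (x, y)) \<partial>lborel) = (\<integral>\<^sup>+t. ennreal \<bar>x\<bar> * indicator {-G t..G t} x \<partial>lborel)" .
  qed
  also have "\<dots> = (\<integral>\<^sup>+t. \<integral>\<^sup>+x. ennreal \<bar>x\<bar> * indicator {-G t..G t} x \<partial>lborel \<partial>lborel)"
  proof (rule lborel_pair.Fubini'[symmetric])
    have eq: "(\<lambda>(x, t). ennreal \<bar>x\<bar> * indicator {-G t..G t} x)
        = (\<lambda>z. ennreal \<bar>fst z\<bar> * indicator {z. - G (snd z) \<le> fst z \<and> fst z \<le> G (snd z)} z)"
      by (auto simp: fun_eq_iff indicator_def)
    show "(\<lambda>(x, t). ennreal \<bar>x\<bar> * indicator {-G t..G t} x) \<in> borel_measurable (lborel \<Otimes>\<^sub>M lborel)"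
      unfolding eq by measurable
  qed
  also have "\<dots> = (\<integral>\<^sup>+t. ennreal ((G t)\<^sup>2) \<partial>lborel)"
    by (simp add: nn_integral_abs_Icc Gpos)
  also have "\<dots> = ennreal (\<tau> (pi/2) - \<tau> (-(pi/2)))"
  proof (rule nn_integral_FTC_UNIV[where F = "\<lambda>t. \<tau> (arctan t)"])
    fix t :: real
    have "(G t)\<^sup>2 = 1 / (\<gamma> (arctan t))\<^sup>2 * inverse (1 + t\<^sup>2)"
      by (simp add: G_def power_divide power_mult_distrib add_nonneg_nonneg inverse_eq_divide)
    then show "((\<lambda>t. \<tau> (arctan t)) has_real_derivative (G t)\<^sup>2) (at t)"
      using DERIV_chain2[OF tau_deriv DERIV_arctan[of t]] by simp
    show "((\<lambda>t. \<tau> (arctan t)) \<longlongrightarrow> \<tau> (pi/2)) at_top"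
      by (rule isCont_tendsto_compose[OF tau_isCont tendsto_arctan_at_top])
    show "((\<lambda>t. \<tau> (arctan t)) \<longlongrightarrow> \<tau> (-(pi/2))) at_bot"
      by (rule isCont_tendsto_compose[OF tau_isCont tendsto_arctan_at_bot])
  qed auto
  also have "\<tau> (pi/2) - \<tau> (-(pi/2)) = \<tau> pi"
    using tau_shift_general[of "-(pi/2)"] by simp
  finally have "emeasure lborel K = ennreal (\<tau> pi)" .
  moreover have "\<tau> pi \<ge> 0" using tau_strict_mono[of 0 pi] tau_0 by simp
  ultimately have "measure lborel K = \<tau> pi" by (simp add: measure_def)
  then show ?thesis using Kb' by simp
qed

end

section \<open>Hausdorff measure of curves and comparison of level sets\<close>

text \<open>Cut the connected components of \<open>T\<close> along the grid of mesh \<open>h\<close>.  The pieces are numbered by pairing the number of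
  the component with the number of the grid cell.\<close>

lemma open_real_disjoint_short_intervals:
  fixes T :: "real set" and h :: real
  assumes T: "open T" and h: "h > 0"
  obtains J :: "nat \<Rightarrow> real set" where "disjoint_family J" "(\<Union>i. J i) = T"
    "\<And>i. J i \<in> sets borel" "\<And>i. is_interval (J i)" "\<And>i x y. x \<in> J i \<Longrightarrow> y \<in> J i \<Longrightarrow> \<bar>x - y\<bar> \<le> h"
proof -
  define G where "G k = {of_int k * h..<(of_int k + 1) * h}" for k :: int
  have G_floor: "x \<in> G k \<longleftrightarrow> k = \<lfloor>x / h\<rfloor>" for x k
  proof -
    have "x \<in> G k \<longleftrightarrow> of_int k \<le> x / h \<and> x / h < of_int k + 1"
      using h by (simp add: G_def pos_le_divide_eq pos_divide_less_eq)
    then show ?thesis using floor_eq_iff[of "x / h" k] by auto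
  qed
  have cnt: "countable (components T)"
    by (rule countable_disjoint_open_subsets)
       (use pairwise_disjoint_components[of T] in \<open>auto simp: open_components[OF T] pairwise_def disjnt_def\<close>)
  define C where "C i = \<Union>{c \<in> components T. to_nat_on (components T) c = i}" for i
  have C: "x \<in> C i \<longleftrightarrow> x \<in> T \<and> to_nat_on (components T) (connected_component_set T x) = i" for x i
  proof -
    have "x \<in> c \<and> c \<in> components T \<longleftrightarrow> x \<in> T \<and> c = connected_component_set T x" for c
      by (auto simp: components_def connected_component_refl_eq dest: connected_component_in)
         (meson connected_component_sym connected_component_trans)+
    note key = this
    have "x \<in> C i \<longleftrightarrow> (\<exists>c. (x \<in> c \<and> c \<in> components T) \<and> to_nat_on (components T) c = i)"
      unfolding C_def by blast
    then show ?thesis unfolding key by simp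
  qed
  have C_cases: "C i = {} \<or> C i \<in> components T" for i
  proof (cases "C i = {}")
    case False
    then obtain c where c: "c \<in> components T" "to_nat_on (components T) c = i" by (auto simp: C_def)
    have "{c' \<in> components T. to_nat_on (components T) c' = i} = {c}"
      using c inj_on_to_nat_on[OF cnt] by (auto simp: inj_on_def)
    then show ?thesis using c by (simp add: C_def)
  qed simp
  define J where "J n = C (fst (prod_decode n)) \<inter> G (int_decode (snd (prod_decode n)))" for n
  have J: "x \<in> J n \<longleftrightarrow> x \<in> T \<and> n = prod_encode (to_nat_on (components T) (connected_component_set T x), int_encode \<lfloor>x / h\<rfloor>)" for x n
  proof -
    obtain i j where n: "n = prod_encode (i, j)" by (metis prod_decode_inverse surj_pair)
    have "j = int_encode k \<longleftrightarrow> int_decode j = k" for k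
      by (metis int_encode_inverse int_decode_inverse)
    then show ?thesis unfolding J_def Int_iff C G_floor by (auto simp: n prod_encode_eq)
  qed
  show ?thesis
  proof
    show "disjoint_family J" by (auto simp: disjoint_family_on_def J)
    show "(\<Union>i. J i) = T" by (auto simp: J)
    show "is_interval (J i)" for i
    proof -
      have "connected (C j)" for j using C_cases[of j] in_components_connected by auto
      then have "is_interval (C j)" for j by (simp add: is_interval_connected_1)
      then show ?thesis unfolding J_def G_def by (intro is_interval_Int is_interval_co)
    qed
    show "J i \<in> sets borel" for i
    proof -
      have "open (C j)" for j using C_cases[of j] open_components[OF T] by auto
      then show ?thesis unfolding J_def G_def by (intro sets.Int) (auto intro: borel_open)
    qed
    show "\<bar>x - y\<bar> \<le> h" if "x \<in> J i" "y \<in> J i" for i x y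
      using that by (auto simp: J_def G_def algebra_simps)
  qed
qed

lemma hausdorff1_outer_mono: "A \<subseteq> B \<Longrightarrow> hausdorff1_outer A \<le> hausdorff1_outer B"
  unfolding hausdorff1_outer_def by (intro SUP_mono) (auto intro: hausdorff1_pre_mono)

text \<open>Cover \<open>A\<close> by an open set of almost the same measure and cut that set into intervals whose images have diameter at
  most \<open>\<delta>\<close>: the diameters of the images are bounded by the measures of the intervals, whose sum is the measure
  of the open set.\<close>

lemma hausdorff1_outer_curve_le:
  fixes X :: "real \<Rightarrow> 'a::real_normed_vector" and w :: "real \<Rightarrow> real"
  assumes w [measurable]: "w \<in> borel_measurable borel" and wC: "\<And>x. w x \<le> C" and C: "C > 0"
    and lip: "\<And>a b. a \<le> b \<Longrightarrow> ennreal (dist (X a) (X b)) \<le> emeasure (density lborel w) {a..b}"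
    and A: "A \<in> sets borel"
  shows "hausdorff1_outer (X ` A) \<le> emeasure (density lborel w) A"
proof -
  let ?\<nu> = "density lborel w"
  have [measurable]: "A \<in> sets borel" by (fact A)
  have bound: "emeasure ?\<nu> B \<le> C * emeasure lborel B" if [measurable]: "B \<in> sets borel" for B
  proof -
    have "emeasure ?\<nu> B = (\<integral>\<^sup>+x. ennreal (w x) * indicator B x \<partial>lborel)"
      by (subst emeasure_density) auto
    also have "\<dots> \<le> (\<integral>\<^sup>+x. ennreal C * indicator B x \<partial>lborel)"
      by (intro nn_integral_mono mult_right_mono ennreal_leI wC) auto
    finally show ?thesis by (simp add: nn_integral_cmult)
  qed
  have open_case: "hausdorff1_pre \<delta> (X ` T) \<le> emeasure ?\<nu> T" if T: "open T" and \<delta>: "\<delta> > 0" for T \<delta>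
  proof -
    have "\<delta> / C > 0" using C \<delta> by simp
    from open_real_disjoint_short_intervals[OF T this]
    obtain J :: "nat \<Rightarrow> real set" where J: "disjoint_family J" "(\<Union>i. J i) = T"
      "\<And>i. J i \<in> sets borel" "\<And>i. is_interval (J i)" "\<And>i x y. x \<in> J i \<Longrightarrow> y \<in> J i \<Longrightarrow> \<bar>x - y\<bar> \<le> \<delta> / C"
      by blast
    have dist_le: "ennreal (dist (X x) (X y)) \<le> emeasure ?\<nu> (J i) \<and> dist (X x) (X y) \<le> \<delta>"
      if xy: "x \<in> J i" "y \<in> J i" for x y i
    proof -
      define a b where "a = min x y" and "b = max x y"
      have ab: "a \<le> b" "a \<in> J i" "b \<in> J i" using xy by (auto simp: a_def b_def min_def max_def)
      have "{a..b} \<subseteq> J i"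
        using J(4)[of i] ab unfolding is_interval_1 by (meson atLeastAtMost_iff subsetI)
      then have 1: "emeasure ?\<nu> {a..b} \<le> emeasure ?\<nu> (J i)" using J(3) by (intro emeasure_mono) auto
      have "emeasure ?\<nu> {a..b} \<le> C * emeasure lborel {a..b}" by (rule bound) auto
      also have "\<dots> = ennreal (C * (b - a))" using ab C by (simp add: ennreal_mult)
      also have "\<dots> \<le> ennreal \<delta>"
        using J(5)[OF ab(2,3)] ab C by (intro ennreal_leI) (simp add: field_simps)
      finally have 2: "emeasure ?\<nu> {a..b} \<le> ennreal \<delta>" .
      have "dist (X x) (X y) = dist (X a) (X b)" by (auto simp: a_def b_def min_def max_def dist_commute)
      then show ?thesis using lip[OF ab(1)] 1 2 \<delta> by (metis ennreal_le_iff less_imp_le order_trans)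
    qed
    have bnd: "bounded (X ` J i)" for i
    proof (cases "J i = {}")
      case False
      then obtain y where y: "y \<in> J i" by blast
      show ?thesis unfolding bounded_def using dist_le[OF y] by (intro exI[of _ "X y"] exI[of _ \<delta>]) auto
    qed simp
    have diam: "ennreal (diameter (X ` J i)) \<le> emeasure ?\<nu> (J i) \<and> diameter (X ` J i) \<le> \<delta>" for i
    proof (cases "emeasure ?\<nu> (J i)")
      case (real r)
      have "diameter (X ` J i) \<le> min r \<delta>"
      proof (rule diameter_le)
        show "X ` J i \<noteq> {} \<or> 0 \<le> min r \<delta>" using real \<delta> by auto
        show "norm (x - y) \<le> min r \<delta>" if xy: "x \<in> X ` J i" "y \<in> X ` J i" for x y
        proof -
          obtain a b where "a \<in> J i" "b \<in> J i" "x = X a" "y = X b" using xy by blast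
          then have "ennreal (dist x y) \<le> ennreal r \<and> dist x y \<le> \<delta>" using dist_le real by metis
          then show ?thesis using real by (simp add: ennreal_le_iff dist_norm)
        qed
      qed
      then show ?thesis using real by (auto intro: ennreal_leI)
    next
      case top
      have "diameter (X ` J i) \<le> \<delta>"
        by (rule diameter_le) (use dist_le \<delta> in \<open>auto simp flip: dist_norm\<close>)
      then show ?thesis using top by simp
    qed
    have "(\<lambda>i. X ` J i) \<in> hausdorff1_covers \<delta> (X ` T)"
      using J(2) bnd diam by (auto simp: hausdorff1_covers_def)
    then have "hausdorff1_pre \<delta> (X ` T) \<le> (\<Sum>i. ennreal (diameter (X ` J i)))"
      unfolding hausdorff1_pre_def by (rule INF_lower)
    also have "\<dots> \<le> (\<Sum>i. emeasure ?\<nu> (J i))" using diam by (intro suminf_le) auto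
    also have "\<dots> = emeasure ?\<nu> T" using J by (subst suminf_emeasure) auto
    finally show ?thesis .
  qed
  have "hausdorff1_pre \<delta> (X ` A) \<le> emeasure ?\<nu> A" if \<delta>: "\<delta> > 0" for \<delta>
  proof (rule ennreal_le_epsilon)
    fix e :: real assume e: "0 < e"
    have "e / C > 0" using e C by simp
    moreover have "A \<in> sets lebesgue" using A by simp
    ultimately obtain T where T: "open T" "A \<subseteq> T" "emeasure lebesgue (T - A) < ennreal (e / C)"
      using sets_lebesgue_outer_open[of A "e / C"] by metis
    have TA [measurable]: "T - A \<in> sets borel" using T(1) A by auto
    have "hausdorff1_pre \<delta> (X ` A) \<le> hausdorff1_pre \<delta> (X ` T)"
      using T(2) by (intro hausdorff1_pre_mono image_mono)
    also have "\<dots> \<le> emeasure ?\<nu> T" by (rule open_case[OF T(1) \<delta>])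
    also have "\<dots> = emeasure ?\<nu> A + emeasure ?\<nu> (T - A)"
      using T(1,2) A by (subst plus_emeasure) (auto intro!: arg_cong[where f = "emeasure ?\<nu>"])
    also have "emeasure ?\<nu> (T - A) \<le> C * emeasure lborel (T - A)" by (rule bound[OF TA])
    also have "\<dots> \<le> C * ennreal (e / C)"
      using T(3) TA by (intro mult_left_mono) (auto intro: less_imp_le)
    also have "\<dots> = ennreal e" using C e by (simp flip: ennreal_mult)
    finally show "hausdorff1_pre \<delta> (X ` A) \<le> emeasure ?\<nu> A + ennreal e"
      by (simp add: add_left_mono)
  qed
  then show ?thesis unfolding hausdorff1_outer_def by (intro SUP_least) auto
qed

lemma le_layer_sum:
  fixes y :: ennreal and c :: real
  assumes c: "c > 0" and y: "y < top"
  shows "y \<le> ennreal c * indicator {0<..} y + (\<Sum>k. ennreal c * indicator {ennreal (real (Suc k) * c)<..} y)"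
proof -
  obtain r where r: "y = ennreal r" "r \<ge> 0" using y by (cases y) auto
  define n where "n = (LEAST n. r \<le> real n * c)"
  have ex: "\<exists>n. r \<le> real n * c" using c by (meson ex_less_of_nat_mult less_imp_le)
  have n: "r \<le> real n * c" unfolding n_def by (rule LeastI_ex[OF ex])
  have less: "real k * c < r" if "k < n" for k
    using not_less_Least[of k "\<lambda>n. r \<le> real n * c"] that by (auto simp: n_def)
  show ?thesis
  proof (cases n)
    case 0
    then show ?thesis using n r by simp
  next
    case (Suc m)
    have "y \<le> ennreal (real n * c)" using r n by (simp add: ennreal_leI)
    also have "\<dots> = ennreal c + ennreal (real m * c)"
      using c Suc by (simp add: algebra_simps flip: ennreal_plus)
    also have "ennreal (real m * c) = (\<Sum>k<m. ennreal c)"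
      using c by (simp add: ennreal_mult ennreal_of_nat_eq_real_of_nat)
    also have "\<dots> = (\<Sum>k<m. ennreal c * indicator {ennreal (real (Suc k) * c)<..} y)"
    proof (intro sum.cong refl)
      fix k assume "k \<in> {..<m}"
      then have "real (Suc k) * c < r" using less[of "Suc k"] Suc by simp
      moreover have "0 \<le> real (Suc k) * c" using c by simp
      ultimately have "ennreal (real (Suc k) * c) < y" unfolding r(1) by (intro ennreal_lessI) linarith+
      then show "ennreal c = ennreal c * indicator {ennreal (real (Suc k) * c)<..} y"
        by (simp add: indicator_def)
    qed
    also have "\<dots> \<le> (\<Sum>k. ennreal c * indicator {ennreal (real (Suc k) * c)<..} y)"
      by (rule sum_le_suminf) auto
    finally have "y \<le> ennreal c + (\<Sum>k. ennreal c * indicator {ennreal (real (Suc k) * c)<..} y)"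
      by (simp add: add_left_mono)
    moreover have "indicator {0<..} y = (1 :: ennreal)"
      using less[of 0] Suc r by (simp add: indicator_def)
    ultimately show ?thesis by simp
  qed
qed

lemma layer_sum_le:
  fixes y :: ennreal and c :: real
  assumes c: "c > 0"
  shows "(\<Sum>k. ennreal c * indicator {ennreal (real (Suc k) * c)<..} y) \<le> y"
proof (rule suminf_le_const)
  have *: "(\<Sum>k<n. ennreal c * indicator {ennreal (real (Suc k) * c)<..} y) \<le> y \<and>
    (\<Sum>k<n. ennreal c * indicator {ennreal (real (Suc k) * c)<..} y) \<le> ennreal (real n * c)" for n
  proof (induction n)
    case (Suc n)
    let ?s = "\<Sum>k<n. ennreal c * indicator {ennreal (real (Suc k) * c)<..} y"
    have step: "ennreal (real n * c) + ennreal c = ennreal (real (Suc n) * c)"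
      using c by (simp add: algebra_simps flip: ennreal_plus)
    show ?case
    proof (cases "ennreal (real (Suc n) * c) < y")
      case True
      have "?s + ennreal c \<le> ennreal (real (Suc n) * c)"
        using Suc.IH add_right_mono[of ?s "ennreal (real n * c)" "ennreal c"] step by simp
      then show ?thesis using True by (auto intro: order_trans less_imp_le)
    next
      case False
      have "ennreal (real n * c) \<le> ennreal (real (Suc n) * c)"
        using c by (intro ennreal_leI mult_right_mono) auto
      then show ?thesis using False Suc.IH by (auto intro: order_trans)
    qed
  qed simp
  show "(\<Sum>k<n. ennreal c * indicator {ennreal (real (Suc k) * c)<..} y) \<le> y" for n using * by blast
qed simp

lemma nn_integral_superlevel:
  fixes f :: "'a \<Rightarrow> ennreal"
  assumes [measurable]: "f \<in> borel_measurable M"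
  shows "(\<integral>\<^sup>+x. ennreal c * indicator {ennreal t<..} (f x) \<partial>M) = ennreal c * emeasure M {x \<in> space M. ennreal t < f x}"
proof -
  have "(\<integral>\<^sup>+x. ennreal c * indicator {ennreal t<..} (f x) \<partial>M)
      = (\<integral>\<^sup>+x. ennreal c * indicator {x \<in> space M. ennreal t < f x} x \<partial>M)"
    by (intro nn_integral_cong) (auto simp: indicator_def)
  then show ?thesis by (simp add: nn_integral_cmult_indicator)
qed

text \<open>Both integrals are compared with the staircase sums of step \<open>c\<close> over the superlevel sets: the first function lies below
  its staircase plus \<open>c\<close>, the second above its own.  Only superlevel sets enter, and these can be matched across two
  spaces by an outer measure estimate.\<close>

lemma nn_integral_le_of_superlevel_le:
  fixes f :: "'a \<Rightarrow> ennreal" and F :: "'b \<Rightarrow> ennreal"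
  assumes f [measurable]: "f \<in> borel_measurable M" and F [measurable]: "F \<in> borel_measurable N"
    and fin: "\<And>x. f x < top"
    and le: "\<And>t. 0 \<le> t \<Longrightarrow> emeasure M {x \<in> space M. ennreal t < f x} \<le> emeasure N {x \<in> space N. ennreal t < F x}"
    and finite: "emeasure M {x \<in> space M. 0 < f x} < top"
  shows "(\<integral>\<^sup>+x. f x \<partial>M) \<le> (\<integral>\<^sup>+x. F x \<partial>N)"
proof -
  let ?m = "\<lambda>t. emeasure M {x \<in> space M. ennreal t < f x}"
  let ?n = "\<lambda>t. emeasure N {x \<in> space N. ennreal t < F x}"
  have bound: "(\<integral>\<^sup>+x. f x \<partial>M) \<le> ennreal c * ?m 0 + (\<integral>\<^sup>+x. F x \<partial>N)" if c: "c > 0" for c :: real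
  proof -
    have "(\<integral>\<^sup>+x. f x \<partial>M) \<le> (\<integral>\<^sup>+x. ennreal c * indicator {ennreal 0<..} (f x)
        + (\<Sum>k. ennreal c * indicator {ennreal (real (Suc k) * c)<..} (f x)) \<partial>M)"
      using le_layer_sum[OF c fin] by (intro nn_integral_mono) (simp only: ennreal_0)
    also have "\<dots> = (\<integral>\<^sup>+x. ennreal c * indicator {ennreal 0<..} (f x) \<partial>M)
        + (\<integral>\<^sup>+x. (\<Sum>k. ennreal c * indicator {ennreal (real (Suc k) * c)<..} (f x)) \<partial>M)"
      by (rule nn_integral_add) measurable
    also have "(\<integral>\<^sup>+x. (\<Sum>k. ennreal c * indicator {ennreal (real (Suc k) * c)<..} (f x)) \<partial>M)
        = (\<Sum>k. ennreal c * ?m (real (Suc k) * c))"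
      by (subst nn_integral_suminf) (measurable, simp only: nn_integral_superlevel[OF f])
    also note nn_integral_superlevel[OF f]
    also have "(\<Sum>k. ennreal c * ?m (real (Suc k) * c)) \<le> (\<Sum>k. ennreal c * ?n (real (Suc k) * c))"
      using c by (intro suminf_le mult_left_mono le) auto
    also have "\<dots> = (\<Sum>k. \<integral>\<^sup>+x. ennreal c * indicator {ennreal (real (Suc k) * c)<..} (F x) \<partial>N)"
      by (simp only: nn_integral_superlevel[OF F])
    also have "\<dots> = (\<integral>\<^sup>+x. (\<Sum>k. ennreal c * indicator {ennreal (real (Suc k) * c)<..} (F x)) \<partial>N)"
      by (rule nn_integral_suminf[symmetric]) measurable
    also have "\<dots> \<le> (\<integral>\<^sup>+x. F x \<partial>N)" by (intro nn_integral_mono layer_sum_le c)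
    finally show ?thesis by (simp add: add_left_mono)
  qed
  obtain r where r: "?m 0 = ennreal r" "r \<ge> 0" using finite by (cases "?m 0") auto
  show ?thesis
  proof (rule ennreal_le_epsilon)
    fix e :: real assume e: "0 < e"
    define c where "c = e / (r + 1)"
    have c: "c > 0" using e r by (simp add: c_def)
    have "c * r \<le> e" using e r by (simp add: c_def divide_le_eq mult_left_mono)
    then have "ennreal c * ?m 0 \<le> ennreal e"
      using c r by (simp add: ennreal_leI flip: ennreal_mult)
    then show "(\<integral>\<^sup>+x. f x \<partial>M) \<le> (\<integral>\<^sup>+x. F x \<partial>N) + ennreal e"
      using bound[OF c] by (metis add.commute add_left_mono order_trans)
  qed
qed

section \<open>Generalized curvature and second differences of the gauge\<close>

lemma rot90_nth [simp]: "rot90 u $ 1 = - u $ 2" "rot90 u $ 2 = u $ 1"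
  by (simp_all add: rot90_def)

lemma inner_real2: "(x::real^2) \<bullet> y = x $ 1 * y $ 1 + x $ 2 * y $ 2"
  by (simp add: inner_vec_def sum_2)

lemma rot90_decomp:
  assumes "norm u = 1"
  shows "v = (v \<bullet> rot90 u) *\<^sub>R rot90 u + (v \<bullet> u) *\<^sub>R u"
proof -
  have "u \<bullet> u = 1" using assms by (simp add: dot_square_norm)
  then have u: "u $ 1 * u $ 1 + u $ 2 * u $ 2 = 1" by (simp add: inner_real2)
  have "v $ 1 = v $ 1 * (u $ 1 * u $ 1 + u $ 2 * u $ 2)" "v $ 2 = v $ 2 * (u $ 1 * u $ 1 + u $ 2 * u $ 2)"
    by (simp_all only: u mult_1_right)
  then show ?thesis by (simp add: vec_eq_iff forall_2 inner_real2 algebra_simps)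
qed

lemma boundary_height_le:
  assumes "x + t *\<^sub>R rot90 u - s *\<^sub>R u \<in> K" "is_outer_normal K x u"
  shows "boundary_height K x u t \<le> s" "0 \<le> boundary_height K x u t"
proof -
  have ge0: "0 \<le> r" if "x + t *\<^sub>R rot90 u - r *\<^sub>R u \<in> K" for r
  proof -
    have "u \<bullet> u = 1" using assms(2) by (simp add: is_outer_normal_def dot_square_norm)
    moreover have "u \<bullet> rot90 u = 0" by (simp add: inner_real2)
    moreover have "u \<bullet> (x + t *\<^sub>R rot90 u - r *\<^sub>R u) \<le> u \<bullet> x"
      using assms(2) that by (auto simp: is_outer_normal_def)
    ultimately show ?thesis by (simp add: inner_add_right inner_diff_right)
  qed
  show "boundary_height K x u t \<le> s"
    unfolding boundary_height_def using assms(1) ge0 by (intro cInf_lower bdd_belowI[of _ 0]) auto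
  show "0 \<le> boundary_height K x u t"
    unfolding boundary_height_def using assms(1) ge0 by (intro cInf_greatest) auto
qed

lemma gen_curvature_eq: "has_gen_curvature K x k \<Longrightarrow> gen_curvature K x = k"
  unfolding gen_curvature_def has_gen_curvature_def
  by (auto intro!: the_equality tendsto_unique[of "at (0::real)"])

context polar_gauge begin

text \<open>The length of the point \<open>\<gamma> \<theta> dir \<theta> + \<beta> \<theta> dir (\<theta> + pi/2)\<close> of the polar body dual to the boundary point in direction \<open>\<theta>\<close>;
  its reciprocal is the distance of the supporting line from the origin.\<close>

definition N :: "real \<Rightarrow> real" where "N \<theta> = sqrt ((\<gamma> \<theta>)\<^sup>2 + (\<beta> \<theta>)\<^sup>2)"

lemma N_pos: "N \<theta> > 0" unfolding N_def by (auto simp: add_pos_nonneg)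
lemma N_sq: "(N \<theta>)\<^sup>2 = (\<gamma> \<theta>)\<^sup>2 + (\<beta> \<theta>)\<^sup>2" by (simp add: N_def add_nonneg_nonneg)
lemma N_le: "N \<theta> \<le> 2 * M"
proof -
  have "N \<theta> \<le> \<bar>\<gamma> \<theta>\<bar> + \<bar>\<beta> \<theta>\<bar>" unfolding N_def by (rule sqrt_sum_squares_le_sum_abs)
  then show ?thesis using beta_bound[of \<theta>] upp[of \<theta>] pos[of \<theta>] by simp
qed

text \<open>The length of the derivative of \<open>dir \<theta> / \<gamma> \<theta>\<close> where \<open>\<beta>\<close> is the derivative of \<open>\<gamma>\<close>.\<close>

definition speed :: "real \<Rightarrow> real" where "speed \<theta> = N \<theta> / (\<gamma> \<theta>)\<^sup>2"

lemma speed_pos: "speed \<theta> > 0" unfolding speed_def using N_pos[of \<theta>] by simp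

lemma speed_le: "speed \<theta> \<le> 2 * M / m\<^sup>2"
proof -
  have "m\<^sup>2 \<le> (\<gamma> \<theta>)\<^sup>2" using m low[of \<theta>] by (intro power_mono) auto
  then show ?thesis unfolding speed_def using N_le[of \<theta>] N_pos[of \<theta>] m M by (intro frac_le) auto
qed

lemma speed_measurable [measurable]: "speed \<in> borel_measurable borel"
  unfolding speed_def[abs_def] N_def[abs_def] by measurable

lemma speed_integrable: "speed integrable_on {a..b}"
proof (rule measurable_bounded_by_integrable_imp_integrable_real)
  have "speed \<in> borel_measurable lebesgue" by (intro measurable_completion) simp
  then show "speed \<in> borel_measurable (lebesgue_on {a..b})" by (rule measurable_restrict_space1)
  show "(\<lambda>x. 2 * M / m\<^sup>2) integrable_on {a..b}" by (intro integrable_continuous_real) auto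
  show "\<bar>speed x\<bar> \<le> 2 * M / m\<^sup>2" for x using speed_le[of x] speed_pos[of x] by simp
qed auto

lemma emeasure_speed_Icc:
  "emeasure (density lborel (\<lambda>\<theta>. ennreal (speed \<theta>))) {a..b} = ennreal (integral {a..b} speed)"
proof -
  have "emeasure (density lborel (\<lambda>\<theta>. ennreal (speed \<theta>))) {a..b}
      = (\<integral>\<^sup>+x. ennreal (indicator {a..b} x * speed x) \<partial>lborel)"
    by (subst emeasure_density) (auto intro!: nn_integral_cong simp: indicator_def)
  also have "\<dots> = ennreal (integral {a..b} speed)"
    by (rule nn_integral_has_integral_lebesgue)
       (auto intro: less_imp_le[OF speed_pos] integrable_integral speed_integrable)
  finally show ?thesis .
qed

text \<open>A difference quotient for \<open>\<gamma>'' + \<gamma>\<close>.  The factor \<open>cos h\<close> makes it vanish on sinusoids, which is why it is nonnegative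
  for a gauge.\<close>

definition second_diff :: "real \<Rightarrow> real \<Rightarrow> real" where
  "second_diff h \<theta> = (\<gamma> (\<theta> + h) + \<gamma> (\<theta> - h) - 2 * cos h * \<gamma> \<theta>) / h\<^sup>2"

lemma second_diff_nonneg: "second_diff h \<theta> \<ge> 0"
proof -
  have "0 \<le> \<gamma> (\<theta> + h) + \<gamma> (\<theta> - h) - 2 * cos h * \<gamma> \<theta>"
    using support[of \<theta> "\<theta> + h"] support[of \<theta> "\<theta> - h"] by (simp add: algebra_simps)
  then show ?thesis unfolding second_diff_def by (rule divide_nonneg_nonneg) simp
qed

text \<open>The density \<open>\<gamma> (\<gamma> + \<gamma>'')\<close> of twice the polar area, as a lower limit that is defined everywhere.\<close>

definition curv_density :: "real \<Rightarrow> ennreal" where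
  "curv_density \<theta> = liminf (\<lambda>i. ennreal (\<gamma> \<theta> * second_diff (1 / real (Suc i)) \<theta>))"

lemma second_diff_cont: "h \<noteq> 0 \<Longrightarrow> continuous_on A (second_diff h)"
  unfolding second_diff_def
  by (intro continuous_intros continuous_on_compose2[OF gamma_cont[of UNIV]]) auto

lemma curv_density_measurable [measurable]: "curv_density \<in> borel_measurable borel"
proof -
  have [measurable]: "second_diff (1 / real (Suc i)) \<in> borel_measurable borel" for i
    by (rule borel_measurable_continuous_onI) (rule second_diff_cont, simp)
  show ?thesis unfolding curv_density_def[abs_def] by measurable
qed

text \<open>Summation by parts: by periodicity \<open>\<gamma> \<theta>\<close> may be shifted against \<open>\<gamma> (\<theta> - h)\<close>, which turns the second difference into the
  square of a first difference.\<close>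

lemma gamma_second_diff_integral:
  assumes h: "h \<noteq> 0"
  shows "integral {0..2*pi} (\<lambda>\<theta>. \<gamma> \<theta> * second_diff h \<theta>)
    = integral {0..2*pi} (\<lambda>\<theta>. 2 * (1 - cos h) / h\<^sup>2 * (\<gamma> \<theta>)\<^sup>2 - ((\<gamma> (\<theta> + h) - \<gamma> \<theta>) / h)\<^sup>2)"
proof -
  have per2: "\<gamma> (x + 2*pi) = \<gamma> x" for x using per[of x] per[of "x+pi"] by (simp add: algebra_simps)
  have per2h: "\<gamma> (x + 2*pi + h) = \<gamma> (x + h)" for x
    using per2[of "x + h"] by (simp add: add.assoc add.commute)
  have cs: "continuous_on A (\<lambda>\<theta>. \<gamma> (\<theta> + c))" for A c
    by (intro continuous_on_compose2[OF gamma_cont[of UNIV]] continuous_intros) auto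
  have ii: "f integrable_on {a..b}" if "continuous_on UNIV f" for f :: "real \<Rightarrow> real" and a b
    by (intro integrable_continuous_real continuous_on_subset[OF that]) auto
  let ?f = "\<lambda>x. \<gamma> (x + h) * \<gamma> x" and ?g = "\<lambda>x. (\<gamma> x)\<^sup>2" and ?I = "integral {0..2*pi}"
  let ?r = "\<lambda>x. 2 * (1 - cos h) / h\<^sup>2 * (\<gamma> x)\<^sup>2 - ((\<gamma> (x + h) - \<gamma> x) / h)\<^sup>2"
  have shift: "((\<lambda>x. f (x + c)) has_integral ?I f) {0..2*pi}"
    if cont: "continuous_on UNIV f" and f_per: "\<And>x. f (x + 2*pi) = f x" for f :: "real \<Rightarrow> real" and c
  proof -
    have "?I f = integral {c..c+2*pi} f"
      using integral_periodic_shift_any[of f "2*pi" 0 c] by (simp add: f_per ii cont)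
    also have "\<dots> = ?I (\<lambda>x. f (x + c))"
      using integral_shift_real_ivl[of c c "c+2*pi" f] by simp
    finally show ?thesis
      by (simp only:) (intro integrable_integral ii continuous_on_compose2[OF cont] continuous_intros; simp)
  qed
  have fc: "continuous_on UNIV ?f" and gc: "continuous_on UNIV ?g" and rc: "continuous_on UNIV ?r"
    using h by (auto intro!: continuous_intros cs gamma_cont)
  \<comment> \<open>The two integrands differ by increments of \<open>?f\<close> and \<open>?g\<close>, whose integrals over a period vanish.\<close>
  have "((\<lambda>x. ?r x + ((?f (x + (-h)) - ?f x) + (?g (x + h) - ?g x)) / h\<^sup>2) has_integral
      ?I ?r + ((?I ?f - ?I ?f) + (?I ?g - ?I ?g)) / h\<^sup>2) {0..2*pi}"
    by (intro has_integral_add has_integral_divide has_integral_diff shift[OF fc] shift[OF gc]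
        integrable_integral ii fc gc rc) (auto simp: per2 per2h)
  moreover have "?r x + ((?f (x + (-h)) - ?f x) + (?g (x + h) - ?g x)) / h\<^sup>2 = \<gamma> x * second_diff h x" for x
    using h by (simp add: second_diff_def field_simps power2_eq_square)
  ultimately show ?thesis by (simp add: integral_unique)
qed

lemma gamma_second_diff_limit:
  "(\<lambda>i. integral {0..2*pi} (\<lambda>\<theta>. \<gamma> \<theta> * second_diff (1 / real (Suc i)) \<theta>))
    \<longlonglongrightarrow> integral {0..2*pi} (\<lambda>\<theta>. (\<gamma> \<theta>)\<^sup>2 - (\<beta> \<theta>)\<^sup>2)"
proof -
  define h where "h i = 1 / real (Suc i)" for i
  have h0: "h i \<noteq> 0" "h i > 0" for i by (auto simp: h_def)
  have hl: "h \<longlonglongrightarrow> 0" unfolding h_def by (rule LIMSEQ_Suc) (rule lim_1_over_n)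
  have hl0: "filterlim h (at 0) sequentially"
    using hl h0 by (auto simp: filterlim_at)
  define f where "f i \<theta> = 2 * (1 - cos (h i)) / (h i)\<^sup>2 * (\<gamma> \<theta>)\<^sup>2 - ((\<gamma> (\<theta> + h i) - \<gamma> \<theta>) / h i)\<^sup>2" for i \<theta>
  define g where "g \<theta> = (\<gamma> \<theta>)\<^sup>2 - (\<beta> \<theta>)\<^sup>2" for \<theta>
  let ?A = "{0..2*pi}"
  let ?B = "5 * M\<^sup>2"
  have fb: "\<bar>f i \<theta>\<bar> \<le> ?B" for i \<theta>
  proof -
    have "2 * (1 - cos (h i)) / (h i)\<^sup>2 \<le> 1"
      using one_minus_cos_le(2)[of "h i"] h0[of i] by (simp add: divide_le_eq)
    moreover have "0 \<le> 2 * (1 - cos (h i)) / (h i)\<^sup>2" by simp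
    moreover have "(\<gamma> \<theta>)\<^sup>2 \<le> M\<^sup>2" using upp[of \<theta>] pos[of \<theta>] by (intro power_mono) auto
    ultimately have 1: "\<bar>2 * (1 - cos (h i)) / (h i)\<^sup>2 * (\<gamma> \<theta>)\<^sup>2\<bar> \<le> 1 * M\<^sup>2"
      unfolding abs_mult by (intro mult_mono) auto
    have b: "\<bar>(\<gamma> (\<theta> + h i) - \<gamma> \<theta>) / h i\<bar> \<le> 2 * M"
      using gamma_lipschitz[of "\<theta> + h i" \<theta>] h0[of i] by (simp add: divide_le_eq)
    have "((\<gamma> (\<theta> + h i) - \<gamma> \<theta>) / h i)\<^sup>2 \<le> (2 * M)\<^sup>2"
      using power_mono[OF b abs_ge_zero, of 2] by (simp only: power2_abs)
    then have 2: "((\<gamma> (\<theta> + h i) - \<gamma> \<theta>) / h i)\<^sup>2 \<le> 4 * M\<^sup>2" by (simp add: power_mult_distrib)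
    have "0 \<le> ((\<gamma> (\<theta> + h i) - \<gamma> \<theta>) / h i)\<^sup>2" by simp
    then show ?thesis unfolding f_def using 1 2 by linarith
  qed
  have gb: "\<bar>g \<theta>\<bar> \<le> ?B" for \<theta>
  proof -
    have "(\<gamma> \<theta>)\<^sup>2 \<le> M\<^sup>2" using upp[of \<theta>] pos[of \<theta>] by (intro power_mono) auto
    moreover have "(\<beta> \<theta>)\<^sup>2 \<le> M\<^sup>2" using power_mono[OF beta_bound[of \<theta>], of 2] by simp
    moreover have "0 \<le> (\<gamma> \<theta>)\<^sup>2" "0 \<le> (\<beta> \<theta>)\<^sup>2" "0 \<le> M\<^sup>2" by simp_all
    ultimately show ?thesis unfolding g_def by linarith
  qed
  have fm [measurable]: "f i \<in> borel_measurable borel" for i unfolding f_def[abs_def] by measurable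
  have gm [measurable]: "g \<in> borel_measurable borel" unfolding g_def[abs_def] by measurable
  have cint: "integrable lborel (\<lambda>x. indicator ?A x *\<^sub>R ?B)"
    by (intro Bochner_Integration.integrable_scaleR_left) (simp add: integrable_indicator_iff)
  have sint: "set_integrable lborel ?A u" if "u \<in> borel_measurable borel" "\<And>x. \<bar>u x\<bar> \<le> ?B" for u :: "real \<Rightarrow> real"
    unfolding set_integrable_def
    by (rule Bochner_Integration.integrable_bound[OF cint])
       (use that in \<open>auto simp: indicator_def\<close>)
  have "(\<lambda>i. LINT x|lborel. indicator ?A x *\<^sub>R f i x) \<longlonglongrightarrow> (LINT x|lborel. indicator ?A x *\<^sub>R g x)"
  proof (rule integral_dominated_convergence[OF _ _ cint])
    note AE_not_S
    then show "AE x in lborel. (\<lambda>i. indicator ?A x *\<^sub>R f i x) \<longlonglongrightarrow> indicator ?A x *\<^sub>R g x"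
    proof eventually_elim
      fix x assume x: "x \<notin> S"
      have "((\<lambda>h. (\<gamma> (x + h) - \<gamma> x) / h) \<longlongrightarrow> \<beta> x) (at 0)"
        using gamma_deriv[OF x] by (simp add: DERIV_def)
      then have 1: "(\<lambda>i. (\<gamma> (x + h i) - \<gamma> x) / h i) \<longlonglongrightarrow> \<beta> x"
        by (rule filterlim_compose[OF _ hl0])
      have "((\<lambda>h. 2 * (1 - cos h) / h\<^sup>2) \<longlongrightarrow> 1) (at (0::real))"
      proof -
        have "((\<lambda>h. (sin (h/2) / (h/2))\<^sup>2) \<longlongrightarrow> 1\<^sup>2) (at (0::real))"
        proof (intro tendsto_power)
          have s: "((\<lambda>h. sin h / h) \<longlongrightarrow> (1::real)) (at 0)"
            using DERIV_sin[of "0::real"] by (simp add: DERIV_def)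
          have "filterlim (\<lambda>h::real. h/2) (at 0) (at 0)"
            by (auto simp: filterlim_at eventually_at_filter intro!: tendsto_eq_intros)
          then show "((\<lambda>h. sin (h/2) / (h/2)) \<longlongrightarrow> (1::real)) (at 0)"
            by (rule filterlim_compose[OF s])
        qed
        moreover have "(sin (h/2) / (h/2))\<^sup>2 = 2 * (1 - cos h) / h\<^sup>2" for h :: real
          using cos_double_sin[of "h/2"] by (simp add: power_divide)
        ultimately show ?thesis by simp
      qed
      then have 2: "(\<lambda>i. 2 * (1 - cos (h i)) / (h i)\<^sup>2) \<longlonglongrightarrow> 1"
        by (rule filterlim_compose[OF _ hl0])
      have "(\<lambda>i. f i x) \<longlonglongrightarrow> 1 * (\<gamma> x)\<^sup>2 - (\<beta> x)\<^sup>2"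
        unfolding f_def by (intro tendsto_intros 1 2)
      then show "(\<lambda>i. indicator ?A x *\<^sub>R f i x) \<longlonglongrightarrow> indicator ?A x *\<^sub>R g x"
        by (intro tendsto_intros) (simp add: g_def)
    qed
    show "AE x in lborel. norm (indicator ?A x *\<^sub>R f i x) \<le> indicator ?A x *\<^sub>R ?B" for i
      using fb[of i] by (auto simp: indicator_def)
  qed auto
  then have "(\<lambda>i. integral ?A (f i)) \<longlonglongrightarrow> integral ?A g"
    using set_borel_integral_eq_integral(2)[OF sint[OF fm fb]]
      set_borel_integral_eq_integral(2)[OF sint[OF gm gb]]
    by (simp add: set_lebesgue_integral_def)
  moreover have "integral ?A (f i) = integral ?A (\<lambda>\<theta>. \<gamma> \<theta> * second_diff (1 / real (Suc i)) \<theta>)" for i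
    using gamma_second_diff_integral[OF h0(1)[of i]] unfolding f_def h_def by simp
  ultimately show ?thesis by (simp add: g_def[abs_def])
qed

text \<open>Fatou's lemma; the integrals of the difference quotients converge to the right-hand side.  A possible singular part of
  \<open>\<gamma>''\<close> is lost, hence the inequality.\<close>

lemma curv_density_integral_le:
  "(\<integral>\<^sup>+\<theta>. curv_density \<theta> * indicator {0..2*pi} \<theta> \<partial>lborel) \<le> ennreal (integral {0..2*pi} (\<lambda>\<theta>. (\<gamma> \<theta>)\<^sup>2 - (\<beta> \<theta>)\<^sup>2))"
proof -
  let ?A = "{0..2*pi}"
  define u where "u i \<theta> = \<gamma> \<theta> * second_diff (1 / real (Suc i)) \<theta>" for i \<theta>
  have uc: "continuous_on UNIV (u i)" for i
    unfolding u_def by (intro continuous_intros gamma_cont second_diff_cont) simp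
  have [measurable]: "u i \<in> borel_measurable borel" for i
    by (rule borel_measurable_continuous_onI[OF uc])
  have u0: "u i \<theta> \<ge> 0" for i \<theta> unfolding u_def using pos[of \<theta>] second_diff_nonneg by simp
  have "curv_density \<theta> * indicator ?A \<theta> = liminf (\<lambda>i. ennreal (indicator ?A \<theta> * u i \<theta>))" for \<theta>
    by (cases "\<theta> \<in> ?A") (simp_all add: curv_density_def u_def Liminf_const)
  then have "(\<integral>\<^sup>+\<theta>. curv_density \<theta> * indicator ?A \<theta> \<partial>lborel) = (\<integral>\<^sup>+\<theta>. liminf (\<lambda>i. ennreal (indicator ?A \<theta> * u i \<theta>)) \<partial>lborel)"
    by simp
  also have "\<dots> \<le> liminf (\<lambda>i. \<integral>\<^sup>+\<theta>. ennreal (indicator ?A \<theta> * u i \<theta>) \<partial>lborel)"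
    by (rule nn_integral_liminf) measurable
  also have "(\<lambda>i. \<integral>\<^sup>+\<theta>. ennreal (indicator ?A \<theta> * u i \<theta>) \<partial>lborel) = (\<lambda>i. ennreal (integral ?A (u i)))"
  proof
    fix i
    have "u i integrable_on ?A"
      by (intro integrable_continuous_real continuous_on_subset[OF uc]) auto
    then show "(\<integral>\<^sup>+\<theta>. ennreal (indicator ?A \<theta> * u i \<theta>) \<partial>lborel) = ennreal (integral ?A (u i))"
      by (intro nn_integral_has_integral_lebesgue integrable_integral u0)
  qed
  also have "liminf \<dots> = ennreal (integral ?A (\<lambda>\<theta>. (\<gamma> \<theta>)\<^sup>2 - (\<beta> \<theta>)\<^sup>2))"
    using gamma_second_diff_limit unfolding u_def
    by (intro lim_imp_Liminf tendsto_ennrealI) auto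
  finally show ?thesis .
qed

end

context polar_body begin

lemma inner_pt: "v \<bullet> pt \<theta> = (v \<bullet> dir \<theta>) / \<gamma> \<theta>"
  by (simp add: pt_def)

lemma pt_in_K: "pt \<theta> \<in> K"
  using K_iff[of "1 / \<gamma> \<theta>" \<theta>] pos[of \<theta>] by (simp add: pt_def)

lemma inner_dir_deriv: "((\<lambda>\<theta>. v \<bullet> dir \<theta>) has_real_derivative v \<bullet> dir (\<theta> + pi/2)) (at \<theta>)"
  by (auto simp: inner_real2 cos_add sin_add intro!: derivative_eq_intros)

lemma inner_pt_deriv:
  assumes "\<theta> \<notin> S"
  shows "((\<lambda>\<theta>. v \<bullet> pt \<theta>) has_real_derivative
    (v \<bullet> dir (\<theta> + pi/2)) / \<gamma> \<theta> + (- (v \<bullet> dir \<theta>) / (\<gamma> \<theta>)\<^sup>2) * \<beta> \<theta>) (at \<theta>)"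
  unfolding inner_pt
  using DERIV_divide[OF inner_dir_deriv gamma_deriv[OF assms] nz, of v]
  by (simp add: power2_eq_square diff_divide_distrib)

text \<open>Integrate the derivative of the component of the curve along the chord; it is at most the length of the chord times the
  speed.\<close>

lemma dist_pt_le:
  assumes ab: "a \<le> b"
  shows "dist (pt a) (pt b) \<le> integral {a..b} speed"
proof (cases "pt a = pt b")
  case True
  then show ?thesis
    using integral_nonneg[OF speed_integrable[of a b]] by (simp add: less_imp_le[OF speed_pos])
next
  case False
  define v where "v = pt b - pt a"
  have v: "norm v > 0" using False by (simp add: v_def)
  have ic: "isCont (\<lambda>x. v \<bullet> dir (x + c)) x" for x c
    by (simp add: inner_real2)
  have ic0: "isCont (\<lambda>x. v \<bullet> dir x) x" for x
    using ic[where c = 0] by simp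
  have "((\<lambda>x. (v \<bullet> dir (x + pi/2)) / \<gamma> x + (- (v \<bullet> dir x) / (\<gamma> x)\<^sup>2) * \<beta> x) has_integral
      (v \<bullet> pt b - v \<bullet> pt a)) {a..b}"
  proof (rule ftc[OF ab])
    show "continuous_on {a..b} (\<lambda>x. v \<bullet> pt x)"
      unfolding inner_pt by (intro continuous_at_imp_continuous_on ballI continuous_intros ic0 gamma_isCont) simp
    show "isCont (\<lambda>x. (v \<bullet> dir (x + pi/2)) / \<gamma> x) x" for x
      by (intro continuous_intros ic gamma_isCont) simp
    show "isCont (\<lambda>x. - (v \<bullet> dir x) / (\<gamma> x)\<^sup>2) x" for x
      by (intro continuous_intros ic0 gamma_isCont) simp
  qed (rule inner_pt_deriv, simp)
  moreover have "((\<lambda>x. norm v * speed x) has_integral (norm v * integral {a..b} speed)) {a..b}"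
    by (intro has_integral_mult_right integrable_integral speed_integrable)
  ultimately have "v \<bullet> pt b - v \<bullet> pt a \<le> norm v * integral {a..b} speed"
  proof (rule has_integral_le)
    fix x
    define y where "y = (1 / \<gamma> x) *\<^sub>R dir (x + pi/2) - (\<beta> x / (\<gamma> x)\<^sup>2) *\<^sub>R dir x"
    have "(norm y)\<^sup>2 = (1 / \<gamma> x)\<^sup>2 + (\<beta> x / (\<gamma> x)\<^sup>2)\<^sup>2"
      unfolding power2_norm_eq_inner y_def
      by (simp add: inner_diff_left inner_diff_right power2_eq_square)
    also have "\<dots> = (speed x)\<^sup>2"
      using N_sq[of x] by (simp add: speed_def field_simps power2_eq_square)
    finally have "norm y = speed x" using speed_pos[of x] by simp
    moreover have "v \<bullet> y \<le> norm v * norm y" by (rule norm_cauchy_schwarz)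
    ultimately show "(v \<bullet> dir (x + pi/2)) / \<gamma> x + (- (v \<bullet> dir x) / (\<gamma> x)\<^sup>2) * \<beta> x \<le> norm v * speed x"
      by (simp add: y_def inner_diff_right mult.commute)
  qed
  moreover have "v \<bullet> pt b - v \<bullet> pt a = norm v * norm v"
    by (simp add: v_def flip: inner_diff_right dot_square_norm power2_eq_square)
  ultimately have "norm v \<le> integral {a..b} speed" using v by simp
  then show ?thesis by (simp add: v_def dist_norm norm_minus_commute)
qed

lemma hausdorff1_outer_pt_le:
  assumes "A \<in> sets borel"
  shows "hausdorff1_outer (pt ` A) \<le> emeasure (density lborel (\<lambda>\<theta>. ennreal (speed \<theta>))) A"
proof (rule hausdorff1_outer_curve_le[OF speed_measurable speed_le _ _ assms])
  show "0 < 2 * M / m\<^sup>2" using m M by simp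
  show "ennreal (dist (pt a) (pt b)) \<le> emeasure (density lborel (\<lambda>x. ennreal (speed x))) {a..b}" if "a \<le> b" for a b
    unfolding emeasure_speed_Icc by (intro ennreal_leI dist_pt_le that)
qed

definition normal :: "real \<Rightarrow> real^2" where
  "normal \<theta> = (1 / N \<theta>) *\<^sub>R (\<gamma> \<theta> *\<^sub>R dir \<theta> + \<beta> \<theta> *\<^sub>R dir (\<theta> + pi/2))"

lemma dir_turn_inner: "dir (\<theta> + pi/2) \<bullet> dir \<phi> = sin (\<phi> - \<theta>)" "dir \<phi> \<bullet> dir (\<theta> + pi/2) = sin (\<phi> - \<theta>)"
  by (simp_all add: inner_real2 cos_add sin_add sin_diff)

lemma norm_normal: "norm (normal \<theta>) = 1"
proof -
  have "(norm (\<gamma> \<theta> *\<^sub>R dir \<theta> + \<beta> \<theta> *\<^sub>R dir (\<theta> + pi/2)))\<^sup>2 = (N \<theta>)\<^sup>2"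
    unfolding power2_norm_eq_inner N_sq
    by (simp add: inner_add_left inner_add_right power2_eq_square dir_turn_inner)
  then have "norm (\<gamma> \<theta> *\<^sub>R dir \<theta> + \<beta> \<theta> *\<^sub>R dir (\<theta> + pi/2)) = N \<theta>"
    using N_pos[of \<theta>] by simp
  then show ?thesis using N_pos[of \<theta>] by (simp add: normal_def)
qed

lemma normal_inner_pt:
  "normal \<theta> \<bullet> pt \<phi> = (\<gamma> \<theta> * cos (\<phi> - \<theta>) + \<beta> \<theta> * sin (\<phi> - \<theta>)) / (N \<theta> * \<gamma> \<phi>)"
proof -
  have "dir \<theta> \<bullet> dir \<phi> = cos (\<phi> - \<theta>)" using cos_minus[of "\<phi> - \<theta>"] by simp
  then show ?thesis
    by (simp add: normal_def pt_def inner_add_left dir_turn_inner(1) add_divide_distrib del: inner_dir)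
qed

lemma normal_inner_self: "normal \<theta> \<bullet> pt \<theta> = 1 / N \<theta>"
  by (simp add: normal_inner_pt)

lemma is_outer_normal_normal: "is_outer_normal K (pt \<theta>) (normal \<theta>)"
  unfolding is_outer_normal_def
proof (intro conjI ballI norm_normal)
  fix y assume y: "y \<in> K"
  obtain r \<phi> where r: "0 \<le> r" "y = r *\<^sub>R dir \<phi>" using polar_form by metis
  have r1: "r * \<gamma> \<phi> \<le> 1" using y r K_iff by simp
  have "y = (r * \<gamma> \<phi>) *\<^sub>R pt \<phi>" by (simp add: r pt_def)
  then have "normal \<theta> \<bullet> y = (r * \<gamma> \<phi>) * ((\<gamma> \<theta> * cos (\<phi> - \<theta>) + \<beta> \<theta> * sin (\<phi> - \<theta>)) / (N \<theta> * \<gamma> \<phi>))"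
    by (simp add: normal_inner_pt)
  also have "\<dots> \<le> (r * \<gamma> \<phi>) * (\<gamma> \<phi> / (N \<theta> * \<gamma> \<phi>))"
    using support[of \<theta> \<phi>] N_pos[of \<theta>] pos[of \<phi>] r(1)
    by (intro mult_left_mono divide_right_mono) auto
  also have "\<dots> \<le> 1 * (1 / N \<theta>)"
    using r1 N_pos[of \<theta>] by (simp add: divide_right_mono)
  finally show "normal \<theta> \<bullet> y \<le> normal \<theta> \<bullet> pt \<theta>" by (simp add: normal_inner_self)
qed

lemma outer_normal_eq:
  assumes "has_gen_curvature K (pt \<theta>) k"
  shows "outer_normal K (pt \<theta>) = normal \<theta>"
  unfolding outer_normal_def
  using assms is_outer_normal_normal[of \<theta>] by (auto simp: has_gen_curvature_def intro: the1_equality)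

text \<open>In the frame at the boundary point \<open>pt \<theta>\<close>, the nearby boundary point \<open>pt (\<theta> + h)\<close> has tangential coordinate \<open>t h\<close>, of order
  \<open>h N / \<gamma>\<^sup>2\<close>, and depth \<open>s h\<close>, which is \<open>(\<gamma> (\<theta> + h) - \<gamma> \<theta> cos h - \<beta> \<theta> sin h) / (N \<gamma> (\<theta> + h))\<close>.  The boundary height
  at \<open>t h\<close> is at most this depth, and adding the estimates for \<open>h\<close> and \<open>- h\<close> cancels the sine term and leaves the second
  difference.\<close>

lemma curvature_bound:
  assumes S: "\<theta> \<notin> S" and k: "has_gen_curvature K (pt \<theta>) k"
  shows "0 \<le> k" "ennreal (k * (N \<theta>)^3 / (\<gamma> \<theta>)\<^sup>2) \<le> curv_density \<theta>"
proof -
  define n where "n = normal \<theta>"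
  define t where "t h = rot90 n \<bullet> (pt (\<theta> + h) - pt \<theta>)" for h
  define s where "s h = n \<bullet> (pt \<theta> - pt (\<theta> + h))" for h
  define H where "H h = boundary_height K (pt \<theta>) n (t h)" for h
  have Npos: "N \<theta> > 0" by (rule N_pos)
  have gpos: "\<gamma> \<theta> > 0" by (rule pos)
  have mem: "pt \<theta> + t h *\<^sub>R rot90 n - s h *\<^sub>R n \<in> K" for h
  proof -
    have "pt (\<theta> + h) - pt \<theta> = t h *\<^sub>R rot90 n - s h *\<^sub>R n"
    proof -
      define v where "v = pt (\<theta> + h) - pt \<theta>"
      have "t h = v \<bullet> rot90 n" by (simp add: t_def v_def inner_commute)
      moreover have "s h = - (v \<bullet> n)"
        by (simp add: s_def v_def inner_diff_left inner_diff_right inner_commute)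
      moreover have "v = (v \<bullet> rot90 n) *\<^sub>R rot90 n + (v \<bullet> n) *\<^sub>R n"
        by (rule rot90_decomp) (simp add: n_def norm_normal)
      ultimately show ?thesis by (simp flip: v_def)
    qed
    then have "pt \<theta> + t h *\<^sub>R rot90 n - s h *\<^sub>R n = pt (\<theta> + h)" by (simp add: algebra_simps)
    then show ?thesis using pt_in_K[of "\<theta> + h"] by simp
  qed
  have H: "H h \<le> s h" "0 \<le> H h" for h
    unfolding H_def using boundary_height_le[OF mem] is_outer_normal_normal[of \<theta>] by (auto simp: n_def)
  have lim_k: "((\<lambda>t. 2 * boundary_height K (pt \<theta>) n t / t\<^sup>2) \<longlongrightarrow> k) (at 0)"
    using k outer_normal_eq[OF k] by (simp add: has_gen_curvature_def n_def)
  have t': "((\<lambda>h. t h / h) \<longlongrightarrow> N \<theta> / (\<gamma> \<theta>)\<^sup>2) (at 0)"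
  proof -
    have "((\<lambda>x. rot90 n \<bullet> pt x) has_real_derivative
      (rot90 n \<bullet> dir (\<theta> + pi/2)) / \<gamma> \<theta> + (- (rot90 n \<bullet> dir \<theta>) / (\<gamma> \<theta>)\<^sup>2) * \<beta> \<theta>) (at \<theta>)"
      by (rule inner_pt_deriv[OF S])
    moreover have r: "rot90 n = (1 / N \<theta>) *\<^sub>R (\<gamma> \<theta> *\<^sub>R dir (\<theta> + pi/2) - \<beta> \<theta> *\<^sub>R dir \<theta>)"
      by (simp add: n_def normal_def vec_eq_iff forall_2 cos_add sin_add minus_divide_left)
    have "rot90 n \<bullet> dir (\<theta> + pi/2) = \<gamma> \<theta> / N \<theta>" "rot90 n \<bullet> dir \<theta> = - \<beta> \<theta> / N \<theta>"
      unfolding r by (simp_all add: inner_diff_left dir_turn_inner)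
    moreover have "\<gamma> \<theta> / N \<theta> / \<gamma> \<theta> + (- (- \<beta> \<theta> / N \<theta>) / (\<gamma> \<theta>)\<^sup>2) * \<beta> \<theta> = N \<theta> / (\<gamma> \<theta>)\<^sup>2"
    proof -
      have "\<gamma> \<theta> / N \<theta> / \<gamma> \<theta> + (- (- \<beta> \<theta> / N \<theta>) / (\<gamma> \<theta>)\<^sup>2) * \<beta> \<theta> = ((\<gamma> \<theta>)\<^sup>2 + (\<beta> \<theta>)\<^sup>2) / (N \<theta> * (\<gamma> \<theta>)\<^sup>2)"
        using Npos gpos by (simp add: field_simps power2_eq_square)
      also have "\<dots> = N \<theta> / (\<gamma> \<theta>)\<^sup>2"
        unfolding N_sq[symmetric] using Npos by (simp add: power2_eq_square)
      finally show ?thesis .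
    qed
    ultimately have "((\<lambda>x. rot90 n \<bullet> pt x) has_real_derivative N \<theta> / (\<gamma> \<theta>)\<^sup>2) (at \<theta>)" by simp
    then show ?thesis by (simp add: DERIV_def t_def inner_diff_right)
  qed
  have tpos: "eventually (\<lambda>h. t h \<noteq> 0) (at 0)"
  proof -
    have "N \<theta> / (\<gamma> \<theta>)\<^sup>2 > 0" using Npos gpos by simp
    then have "eventually (\<lambda>h. t h / h > 0) (at 0)" by (rule order_tendstoD(1)[OF t'])
    then show ?thesis by eventually_elim auto
  qed
  have t0: "(t \<longlongrightarrow> 0) (at 0)"
  proof -
    have "((\<lambda>h. t h / h * h) \<longlongrightarrow> N \<theta> / (\<gamma> \<theta>)\<^sup>2 * 0) (at 0)"
      by (intro tendsto_intros t')
    moreover have "eventually (\<lambda>h. t h / h * h = t h) (at 0)"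
      by (auto simp: eventually_at_filter)
    ultimately show ?thesis by (simp add: tendsto_cong)
  qed
  have "filterlim t (at 0) (at 0)" using t0 tpos by (simp add: filterlim_at)
  from filterlim_compose[OF lim_k this]
  have lim_H: "((\<lambda>h. 2 * H h / (t h)\<^sup>2) \<longlongrightarrow> k) (at 0)" by (simp add: H_def)
  show "0 \<le> k"
    by (rule tendsto_lowerbound[OF lim_H]) (auto intro!: always_eventually divide_nonneg_nonneg simp: H(2))
  define E where "E h = \<gamma> (\<theta> + h) - \<gamma> \<theta> * cos h - \<beta> \<theta> * sin h" for h
  have sE: "E h = s h * (N \<theta> * \<gamma> (\<theta> + h))" for h
    using Npos pos[of "\<theta> + h"]
    by (simp add: s_def n_def inner_diff_right normal_inner_pt E_def field_simps)
  define L where "L h = \<gamma> \<theta> * ((H h / (t h)\<^sup>2) * (t h / h)\<^sup>2 * (N \<theta> * \<gamma> (\<theta> + h)))" for h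
  have LE: "eventually (\<lambda>h. L h \<le> \<gamma> \<theta> * E h / h\<^sup>2) (at 0)"
    using tpos
  proof eventually_elim
    fix h assume th: "t h \<noteq> 0"
    have "L h = \<gamma> \<theta> * (H h * (N \<theta> * \<gamma> (\<theta> + h))) / h\<^sup>2"
      using th by (simp add: L_def power_divide)
    also have "\<dots> \<le> \<gamma> \<theta> * (s h * (N \<theta> * \<gamma> (\<theta> + h))) / h\<^sup>2"
      using Npos gpos pos[of "\<theta> + h"] H(1)[of h]
      by (intro divide_right_mono mult_left_mono mult_right_mono) auto
    finally show "L h \<le> \<gamma> \<theta> * E h / h\<^sup>2" by (simp add: sE)
  qed
  have limL: "(L \<longlongrightarrow> k * (N \<theta>)^3 / (2 * (\<gamma> \<theta>)\<^sup>2)) (at 0)"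
  proof -
    have g: "((\<lambda>h. \<gamma> (\<theta> + h)) \<longlongrightarrow> \<gamma> \<theta>) (at 0)"
      using gamma_isCont[of \<theta>] by (simp add: isCont_def LIM_offset_zero_iff)
    have Hl: "((\<lambda>h. H h / (t h)\<^sup>2) \<longlongrightarrow> k / 2) (at 0)"
      using tendsto_divide[OF lim_H tendsto_const[of 2]] by simp
    have "(L \<longlongrightarrow> \<gamma> \<theta> * ((k / 2) * (N \<theta> / (\<gamma> \<theta>)\<^sup>2)\<^sup>2 * (N \<theta> * \<gamma> \<theta>))) (at 0)"
      unfolding L_def
      by (intro tendsto_mult[OF tendsto_const] tendsto_mult[OF tendsto_mult[OF Hl tendsto_power[OF t']]]
          tendsto_mult[OF tendsto_const] g)
    moreover have "\<gamma> \<theta> * ((k / 2) * (N \<theta> / (\<gamma> \<theta>)\<^sup>2)\<^sup>2 * (N \<theta> * \<gamma> \<theta>)) = k * (N \<theta>)^3 / (2 * (\<gamma> \<theta>)\<^sup>2)"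
      using gpos by (simp add: power_divide power2_eq_square power3_eq_cube field_simps)
    ultimately show ?thesis by (simp only:)
  qed
  define h where "h i = 1 / real (Suc i)" for i
  have h0: "h \<longlonglongrightarrow> 0" unfolding h_def by (rule LIMSEQ_Suc) (rule lim_1_over_n)
  have hne: "h i \<noteq> 0" for i by (simp add: h_def)
  have hl: "filterlim h (at 0) sequentially"
    using h0 hne by (auto simp: filterlim_at)
  have hl': "filterlim (\<lambda>i. - h i) (at 0) sequentially"
    using tendsto_minus[OF h0] hne by (auto simp: filterlim_at)
  have "(\<lambda>i. L (h i) + L (- h i)) \<longlonglongrightarrow> k * (N \<theta>)^3 / (2 * (\<gamma> \<theta>)\<^sup>2) + k * (N \<theta>)^3 / (2 * (\<gamma> \<theta>)\<^sup>2)"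
    by (intro tendsto_add filterlim_compose[OF limL] hl hl')
  then have "(\<lambda>i. ennreal (L (h i) + L (- h i))) \<longlonglongrightarrow> ennreal (k * (N \<theta>)^3 / (\<gamma> \<theta>)\<^sup>2)"
    using tendsto_ennrealI by fastforce
  then have "ennreal (k * (N \<theta>)^3 / (\<gamma> \<theta>)\<^sup>2) = liminf (\<lambda>i. ennreal (L (h i) + L (- h i)))"
    by (simp add: lim_imp_Liminf)
  also have "\<dots> \<le> curv_density \<theta>"
    unfolding curv_density_def
  proof (rule Liminf_mono)
    have "eventually (\<lambda>i. L (h i) \<le> \<gamma> \<theta> * E (h i) / (h i)\<^sup>2) sequentially"
      using LE hl by (rule eventually_compose_filterlim)
    moreover have "eventually (\<lambda>i. L (- h i) \<le> \<gamma> \<theta> * E (- h i) / (- h i)\<^sup>2) sequentially"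
      using LE hl' by (rule eventually_compose_filterlim)
    ultimately show "eventually (\<lambda>i. ennreal (L (h i) + L (- h i))
        \<le> ennreal (\<gamma> \<theta> * second_diff (1 / real (Suc i)) \<theta>)) sequentially"
    proof eventually_elim
      case (elim i)
      have "\<gamma> \<theta> * E (h i) / (h i)\<^sup>2 + \<gamma> \<theta> * E (- h i) / (- h i)\<^sup>2 = \<gamma> \<theta> * second_diff (h i) \<theta>"
        by (simp add: E_def second_diff_def algebra_simps add_divide_distrib diff_divide_distrib)
      then have "L (h i) + L (- h i) \<le> \<gamma> \<theta> * second_diff (h i) \<theta>"
        using add_mono[OF elim] by (simp only:)
      then show ?case unfolding h_def by (rule ennreal_leI)
    qed
  qed
  finally show "ennreal (k * (N \<theta>)^3 / (\<gamma> \<theta>)\<^sup>2) \<le> curv_density \<theta>" .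
qed

section \<open>The p-affine isoperimetric inequality\<close>

lemma frontier_param:
  assumes "y \<in> frontier K"
  obtains \<theta> where "0 \<le> \<theta>" "\<theta> \<le> 2 * pi" "y = pt \<theta>"
proof -
  obtain \<phi> where \<phi>: "y = (1 / \<gamma> \<phi>) *\<^sub>R dir \<phi>" using assms K_frontier by auto
  obtain r \<theta> where r: "0 \<le> r" "y = r *\<^sub>R dir \<theta>" "0 \<le> \<theta>" "\<theta> < 2 * pi" using polar_form by metis
  have "norm y = r" unfolding r(2) using r(1) by simp
  moreover have "norm y = 1 / \<gamma> \<phi>" unfolding \<phi> using pos[of \<phi>] by simp
  ultimately have r\<phi>: "r = 1 / \<gamma> \<phi>" by simp
  then have d: "dir \<theta> = dir \<phi>" using r(2) \<phi> by simp
  have "s * \<gamma> \<theta> \<le> 1 \<longleftrightarrow> s * \<gamma> \<phi> \<le> 1" if "0 \<le> s" for s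
    using K_iff[OF that, of \<theta>] K_iff[OF that, of \<phi>] d by simp
  from this[of "1 / \<gamma> \<theta>"] this[of "1 / \<gamma> \<phi>"] have "\<gamma> \<theta> = \<gamma> \<phi>"
    using pos[of \<theta>] pos[of \<phi>] by (simp add: divide_le_eq)
  then show ?thesis using that[of \<theta>] r r\<phi> by (simp add: pt_def)
qed

text \<open>At a point with curvature \<open>k\<close> put \<open>u = k N\<^sup>3 / \<gamma>\<^sup>2\<close> and \<open>v = \<gamma>\<^sup>-\<^sup>2\<close>.  The integrand times the speed equals
  \<open>u powr a * v powr b\<close> with \<open>a = p/(2+p)\<close> and \<open>b = 2/(2+p)\<close>, since the powers of \<open>N\<close> match by \<open>e + 1 = 3 a\<close>.
  Young's inequality, normalized by the bounds \<open>B0\<close> for \<open>\<integral> u\<close> and \<open>2 pi\<close> for \<open>\<integral> v\<close>, then integrates to \<open>V\<close>.  If the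
  integrand is not integrable, its Bochner integral is \<open>0\<close>.\<close>

lemma p_affine_area_le:
  assumes p: "p \<ge> 1" and norm: "\<tau> pi = pi"
    and B: "integral {0..2*pi} (\<lambda>\<theta>. (\<gamma> \<theta>)\<^sup>2 - (\<beta> \<theta>)\<^sup>2) \<le> B0" "B0 > 0"
  shows "p_affine_area p K \<le> (2 * pi) powr (2 / (2 + p)) * B0 powr (p / (2 + p))"
proof -
  define a b where "a = p / (2 + p)" and "b = 2 / (2 + p)"
  have ab: "0 < a" "0 < b" "a + b = 1" using p by (auto simp: a_def b_def simp flip: add_divide_distrib)
  define e where "e = 2 * (p - 1) / (2 + p)"
  have e: "e + 1 = 3 * a" using p by (simp add: e_def a_def field_simps)
  define V where "V = (2 * pi) powr b * B0 powr a"
  have V: "V > 0" using B by (simp add: V_def)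
  define f where "f y = gen_curvature K y powr a / (y \<bullet> outer_normal K y) powr e" for y
  define g where "g y = indicator (frontier K) y * f y" for y
  have f0: "f y \<ge> 0" for y by (simp add: f_def)
  have g0: "g y \<ge> 0" for y using f0 by (simp add: g_def)
  define A where "A = {0..2*pi}"
  define \<nu> where "\<nu> = density lborel (\<lambda>\<theta>. ennreal (speed \<theta>))"
  define c1 c2 where "c1 = V * a / B0" and "c2 = V * b / (2 * pi)"
  have c: "c1 > 0" "c2 > 0" using V ab B by (auto simp: c1_def c2_def)
  \<comment> \<open>On the countable set of kinks the majorant is infinite, which costs nothing in the integral.\<close>
  define F where "F \<theta> = (if \<theta> \<in> S then top else
    (ennreal c1 * curv_density \<theta> + ennreal (c2 * (1 / (\<gamma> \<theta>)\<^sup>2))) * ennreal (1 / speed \<theta>))" for \<theta>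
  have [measurable]: "S \<in> sets borel" by (rule sets.countable[OF _ S_countable]) auto
  have Fm [measurable]: "F \<in> borel_measurable borel" unfolding F_def[abs_def] by measurable
  have Am [measurable]: "A \<in> sets borel" by (simp add: A_def)
  have key: "ennreal (f (pt \<theta>)) \<le> F \<theta>" for \<theta>
  proof (cases "\<theta> \<in> S \<or> gen_curvature K (pt \<theta>) = 0")
    case True
    then show ?thesis by (auto simp: F_def f_def)
  next
    case False
    then have S: "\<theta> \<notin> S" and nz: "gen_curvature K (pt \<theta>) \<noteq> 0" by auto
    then obtain k where k: "has_gen_curvature K (pt \<theta>) k"
      by (auto simp: gen_curvature_def split: if_splits)
    have kc: "gen_curvature K (pt \<theta>) = k" by (rule gen_curvature_eq[OF k])
    have k0: "k > 0" using curvature_bound(1)[OF S k] nz kc by simp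
    have Np: "N \<theta> > 0" and gp: "\<gamma> \<theta> > 0" by (rule N_pos, rule pos)
    define u v where "u = k * (N \<theta>)^3 / (\<gamma> \<theta>)\<^sup>2" and "v = 1 / (\<gamma> \<theta>)\<^sup>2"
    have uv: "u > 0" "v > 0" using k0 Np gp by (auto simp: u_def v_def)
    have "f (pt \<theta>) = k powr a * N \<theta> powr e"
      using Np by (simp add: f_def kc outer_normal_eq[OF k] inner_commute[of "pt \<theta>"] normal_inner_self powr_divide)
    then have "f (pt \<theta>) * speed \<theta> = k powr a * (N \<theta> powr e * N \<theta> powr 1) / (\<gamma> \<theta>)\<^sup>2"
      using Np by (simp add: speed_def)
    also have "N \<theta> powr e * N \<theta> powr 1 = N \<theta> powr (3 * a)"
      by (simp only: powr_add[symmetric] e)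
    also have "k powr a * N \<theta> powr (3 * a) / (\<gamma> \<theta>)\<^sup>2 = u powr a * v powr b"
    proof -
      have "v powr a * v powr b = v" using ab uv by (simp add: powr_add[symmetric])
      moreover have "u powr a = k powr a * N \<theta> powr (3 * a) * v powr a"
      proof -
        have "((N \<theta>)^3) powr a = (N \<theta> powr 3) powr a" using Np by (simp add: powr_numeral)
        also have "\<dots> = N \<theta> powr (3 * a)" by (rule powr_powr)
        finally have pw: "((N \<theta>)^3) powr a = N \<theta> powr (3 * a)" .
        have "u = k * (N \<theta>)^3 * v" by (simp add: u_def v_def)
        then show ?thesis using k0 Np uv by (simp add: powr_mult pw)
      qed
      ultimately have "u powr a * v powr b = k powr a * N \<theta> powr (3 * a) * v"
        by (simp add: mult.assoc)
      then show ?thesis by (simp add: v_def)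
    qed
    also have "\<dots> = V * ((u / B0) powr a * (v / (2*pi)) powr b)"
      using uv B by (simp add: V_def powr_divide)
    also have "\<dots> \<le> V * (a * (u / B0) + b * (v / (2*pi)))"
      using V ab uv B by (intro mult_left_mono Youngs_inequality_0) auto
    also have "\<dots> = c1 * u + c2 * v" by (simp add: c1_def c2_def distrib_left)
    finally have "f (pt \<theta>) * speed \<theta> * (1 / speed \<theta>) \<le> (c1 * u + c2 * v) * (1 / speed \<theta>)"
      using speed_pos[of \<theta>] by (intro mult_right_mono) auto
    then have "f (pt \<theta>) \<le> (c1 * u + c2 * v) * (1 / speed \<theta>)"
      using speed_pos[of \<theta>] by simp
    then have "ennreal (f (pt \<theta>)) \<le> ennreal ((c1 * u + c2 * v) * (1 / speed \<theta>))" by (rule ennreal_leI)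
    also have "\<dots> = (ennreal c1 * ennreal u + ennreal (c2 * v)) * ennreal (1 / speed \<theta>)"
    proof -
      have "ennreal ((c1 * u + c2 * v) * (1 / speed \<theta>)) = ennreal (c1 * u + c2 * v) * ennreal (1 / speed \<theta>)"
        using c uv speed_pos[of \<theta>] by (intro ennreal_mult add_nonneg_nonneg) auto
      moreover have "ennreal (c1 * u + c2 * v) = ennreal (c1 * u) + ennreal (c2 * v)"
        using c uv by (intro ennreal_plus) auto
      moreover have "ennreal (c1 * u) = ennreal c1 * ennreal u" using c uv by (intro ennreal_mult) auto
      ultimately show ?thesis by simp
    qed
    also have "\<dots> \<le> (ennreal c1 * curv_density \<theta> + ennreal (c2 * v)) * ennreal (1 / speed \<theta>)"
      using curvature_bound(2)[OF S k] by (intro mult_right_mono add_right_mono mult_left_mono) (auto simp: u_def)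
    also have "\<dots> = F \<theta>" using S by (simp add: F_def v_def)
    finally show ?thesis .
  qed
  have area_def: "p_affine_area p K = (\<integral>y. g y \<partial>hausdorff1_measure)"
    by (simp add: p_affine_area_def set_lebesgue_integral_def g_def f_def a_def e_def)
  show ?thesis
  proof (cases "integrable hausdorff1_measure g")
    case False
    then have "p_affine_area p K = 0" unfolding area_def by (rule not_integrable_integral_eq)
    then show ?thesis using V by (simp add: V_def a_def b_def)
  next
    case True
    then have gm [measurable]: "g \<in> borel_measurable hausdorff1_measure" by simp
    have level: "emeasure hausdorff1_measure {y \<in> space hausdorff1_measure. ennreal t < ennreal (g y)}
        \<le> emeasure \<nu> {\<theta> \<in> space \<nu>. ennreal t < F \<theta> * indicator A \<theta>}" if t: "0 \<le> t" for t
    proof -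
      let ?L = "{y \<in> space hausdorff1_measure. ennreal t < ennreal (g y)}"
      let ?R = "{\<theta> \<in> space \<nu>. ennreal t < F \<theta> * indicator A \<theta>}"
      have "?L \<in> sets hausdorff1_measure" by measurable
      then have "emeasure hausdorff1_measure ?L = hausdorff1_outer ?L" by (rule emeasure_hausdorff1_measure)
      also have "\<dots> \<le> hausdorff1_outer (pt ` ?R)"
      proof (rule hausdorff1_outer_mono, rule subsetI)
        fix y assume "y \<in> ?L"
        then have y: "ennreal t < ennreal (g y)" by simp
        then have "g y \<noteq> 0" using t by auto
        then have yf: "y \<in> frontier K" by (auto simp: g_def indicator_def split: if_splits)
        then obtain \<theta> where \<theta>: "0 \<le> \<theta>" "\<theta> \<le> 2 * pi" "y = pt \<theta>" by (rule frontier_param)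
        have "ennreal t < F \<theta>" using y key[of \<theta>] yf \<theta>(3) by (simp add: g_def)
        then show "y \<in> pt ` ?R" using \<theta> by (auto simp: A_def \<nu>_def)
      qed
      also have "\<dots> \<le> emeasure \<nu> ?R"
        unfolding \<nu>_def by (rule hausdorff1_outer_pt_le) (simp, measurable)
      finally show ?thesis .
    qed
    have \<nu>A: "emeasure \<nu> A < top"
      unfolding \<nu>_def A_def emeasure_speed_Icc by simp
    have "(\<integral>\<^sup>+y. ennreal (g y) \<partial>hausdorff1_measure) \<le> (\<integral>\<^sup>+\<theta>. F \<theta> * indicator A \<theta> \<partial>\<nu>)"
    proof (rule nn_integral_le_of_superlevel_le)
      show "(\<lambda>\<theta>. F \<theta> * indicator A \<theta>) \<in> borel_measurable \<nu>" unfolding \<nu>_def by measurable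
      have "emeasure hausdorff1_measure {y \<in> space hausdorff1_measure. 0 < ennreal (g y)}
          \<le> emeasure \<nu> {\<theta> \<in> space \<nu>. 0 < F \<theta> * indicator A \<theta>}"
        using level[of 0] by simp
      also have "\<dots> \<le> emeasure \<nu> A"
        by (rule emeasure_mono) (auto simp: \<nu>_def indicator_def split: if_splits)
      finally show "emeasure hausdorff1_measure {y \<in> space hausdorff1_measure. 0 < ennreal (g y)} < top"
        using \<nu>A by (rule le_less_trans)
    qed (use level in \<open>auto intro: gm\<close>)
    also have "\<dots> = (\<integral>\<^sup>+\<theta>. ennreal (speed \<theta>) * (F \<theta> * indicator A \<theta>) \<partial>lborel)"
      unfolding \<nu>_def by (rule nn_integral_density) measurable
    also have "\<dots> = (\<integral>\<^sup>+\<theta>. ennreal c1 * (curv_density \<theta> * indicator A \<theta>)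
        + ennreal c2 * ennreal (indicator A \<theta> * (1 / (\<gamma> \<theta>)\<^sup>2)) \<partial>lborel)"
    proof (rule nn_integral_cong_AE)
      note AE_not_S
      then show "AE \<theta> in lborel. ennreal (speed \<theta>) * (F \<theta> * indicator A \<theta>)
          = ennreal c1 * (curv_density \<theta> * indicator A \<theta>) + ennreal c2 * ennreal (indicator A \<theta> * (1 / (\<gamma> \<theta>)\<^sup>2))"
      proof eventually_elim
        fix \<theta> assume S: "\<theta> \<notin> S"
        have "ennreal (speed \<theta>) * ennreal (1 / speed \<theta>) = 1"
          using speed_pos[of \<theta>] by (simp flip: ennreal_mult)
        then have "ennreal (speed \<theta>) * F \<theta> = ennreal c1 * curv_density \<theta> + ennreal (c2 * (1 / (\<gamma> \<theta>)\<^sup>2))"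
          using S by (simp add: F_def mult.left_commute[of "ennreal (speed \<theta>)"])
        moreover have "ennreal (c2 * (1 / (\<gamma> \<theta>)\<^sup>2)) = ennreal c2 * ennreal (1 / (\<gamma> \<theta>)\<^sup>2)"
          using c by (intro ennreal_mult) auto
        ultimately show "ennreal (speed \<theta>) * (F \<theta> * indicator A \<theta>)
          = ennreal c1 * (curv_density \<theta> * indicator A \<theta>) + ennreal c2 * ennreal (indicator A \<theta> * (1 / (\<gamma> \<theta>)\<^sup>2))"
          by (cases "\<theta> \<in> A") simp_all
      qed
    qed
    also have "\<dots> = ennreal c1 * (\<integral>\<^sup>+\<theta>. curv_density \<theta> * indicator A \<theta> \<partial>lborel)
        + ennreal c2 * (\<integral>\<^sup>+\<theta>. ennreal (indicator A \<theta> * (1 / (\<gamma> \<theta>)\<^sup>2)) \<partial>lborel)"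
      by (simp add: nn_integral_add nn_integral_cmult)
    also have "(\<integral>\<^sup>+\<theta>. ennreal (indicator A \<theta> * (1 / (\<gamma> \<theta>)\<^sup>2)) \<partial>lborel) = ennreal (2 * pi)"
    proof (rule nn_integral_has_integral_lebesgue)
      have "((\<lambda>x. 1 / (\<gamma> x)\<^sup>2) has_integral (\<tau> (2*pi) - \<tau> 0)) {0..2*pi}"
        by (rule inv_sq_has_integral) simp
      moreover have "\<tau> (2*pi) - \<tau> 0 = 2 * pi"
        using tau_shift[OF norm, of pi] norm tau_0 by simp
      ultimately show "((\<lambda>x. 1 / (\<gamma> x)\<^sup>2) has_integral 2 * pi) A" by (simp add: A_def)
    qed simp
    also have "(\<integral>\<^sup>+\<theta>. curv_density \<theta> * indicator A \<theta> \<partial>lborel) \<le> ennreal B0"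
      using curv_density_integral_le ennreal_leI[OF B(1)] unfolding A_def by (rule order_trans)
    also have "ennreal c1 * ennreal B0 + ennreal c2 * ennreal (2 * pi) = ennreal V"
    proof -
      have "ennreal c1 * ennreal B0 + ennreal c2 * ennreal (2 * pi) = ennreal (c1 * B0 + c2 * (2 * pi))"
        using c B by (simp add: ennreal_mult ennreal_plus)
      also have "c1 * B0 + c2 * (2 * pi) = V * (a + b)" using B by (simp add: c1_def c2_def distrib_left)
      finally show ?thesis using ab by simp
    qed
    finally have le: "(\<integral>\<^sup>+y. ennreal (g y) \<partial>hausdorff1_measure) \<le> ennreal V"
      by (simp add: mult_left_mono add_right_mono)
    have "p_affine_area p K = enn2real (\<integral>\<^sup>+y. ennreal (g y) \<partial>hausdorff1_measure)"
      unfolding area_def by (rule integral_eq_nn_integral) (use g0 in auto)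
    also have "\<dots> \<le> V" using le V by (intro enn2real_leI) auto
    finally show ?thesis by (simp add: V_def a_def b_def)
  qed
qed

end

section \<open>Stability\<close>

text \<open>The ray in direction \<open>z\<close> leaves \<open>L\<close> at a frontier point at distance at least \<open>r1\<close>, since it starts inside the
  inner ball.\<close>

lemma support_fun_between_balls:
  fixes L :: "(real^2) set"
  assumes L: "compact L" and r: "0 < r1" "cball 0 r1 \<subseteq> L" "L \<subseteq> cball 0 r2" and z: "norm z = 1"
  shows "r1 \<le> support_fun L z" "support_fun L z \<le> r2"
proof -
  have fr: "frontier L \<subseteq> L" using L by (intro frontier_subset_closed compact_imp_closed)
  have ball: "ball 0 r1 \<subseteq> interior L" using r(2) by (intro interior_maximal) auto
  then have "0 \<in> interior L" using r(1) by (meson centre_in_ball subsetD)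
  moreover have "z \<noteq> 0" using z by auto
  ultimately obtain d where d: "0 < d" "d *\<^sub>R z \<in> frontier L"
    using ray_to_frontier[OF compact_imp_bounded[OF L], of 0 z] by (metis add_0)
  have "r1 \<le> d"
  proof (rule ccontr)
    assume "\<not> r1 \<le> d"
    then have "d *\<^sub>R z \<in> ball 0 r1" using d(1) z by simp
    then show False using subsetD[OF ball] d(2) unfolding frontier_def by blast
  qed
  have le: "z \<bullet> y \<le> r2" if "y \<in> frontier L" for y
  proof -
    have "norm y \<le> r2" using that fr r(3) by auto
    then show ?thesis using norm_cauchy_schwarz[of z y] z by simp
  qed
  have "z \<bullet> z = 1" using z by (simp add: dot_square_norm)
  then have "z \<bullet> (d *\<^sub>R z) = d" by simp
  moreover have "z \<bullet> (d *\<^sub>R z) \<le> support_fun L z"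
    unfolding support_fun_def using d(2) le by (intro cSUP_upper bdd_aboveI2[of _ _ r2])
  ultimately show "r1 \<le> support_fun L z" using \<open>r1 \<le> d\<close> by linarith
  show "support_fun L z \<le> r2"
    unfolding support_fun_def using d(2) le by (intro cSUP_least) auto
qed

lemma support_fun_cball_0:
  assumes "0 < R" "norm z = 1"
  shows "support_fun (cball (0 :: real^2) R) z = R"
  using support_fun_between_balls[of "cball 0 R" R R z] assms by (intro antisym) auto

lemma hausdorff_distance_le:
  assumes "\<And>z. norm z = 1 \<Longrightarrow> \<bar>support_fun K z - support_fun L z\<bar> \<le> B"
  shows "hausdorff_distance K L \<le> B"
  unfolding hausdorff_distance_def
proof (rule cSUP_least)
  show "sphere (0 :: real^2) 1 \<noteq> {}" using norm_dir[of 0] by (metis empty_iff mem_sphere_0)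
qed (use assms in auto)

lemma (in polar_gauge) deficit_eq:
  assumes norm: "\<tau> pi = pi"
  shows "deficit = pi - integral {0..2*pi} (\<lambda>\<theta>. (\<gamma> \<theta>)\<^sup>2 - (\<beta> \<theta>)\<^sup>2) / 2"
proof -
  let ?h = "\<lambda>\<theta>. (\<gamma> \<theta>)\<^sup>2 - (\<beta> \<theta>)\<^sup>2"
  have hint: "?h integrable_on {a..b}" for a b
  proof -
    have "(\<lambda>x. (\<gamma> x)\<^sup>2 * \<beta> x ^ 0) integrable_on {a..b}" "(\<lambda>x. 1 * \<beta> x ^ 2) integrable_on {a..b}"
      by (intro cont_beta_power_integrable continuous_intros gamma_cont)+
    then show ?thesis by (auto intro: integrable_diff)
  qed
  have gint: "((\<lambda>x. 1 / (\<gamma> x)\<^sup>2) has_integral (\<tau> pi - \<tau> 0)) {0..pi}"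
    by (rule inv_sq_has_integral) simp
  have "((\<lambda>x. 1 / (\<gamma> x)\<^sup>2 - ?h x) has_integral (\<tau> pi - \<tau> 0) - integral {0..pi} ?h) {0..pi}"
    by (intro has_integral_diff gint integrable_integral hint)
  then have "deficit = pi - integral {0..pi} ?h"
    unfolding deficit_def by (simp add: integral_unique norm tau_0 algebra_simps)
  moreover have "integral {0..2*pi} ?h = integral {0..pi} ?h + integral {pi..2*pi} ?h"
    by (rule Henstock_Kurzweil_Integration.integral_combine[symmetric]) (auto intro: hint)
  moreover have "integral {pi..pi + pi} ?h = integral {0..0 + pi} ?h"
    by (rule integral_periodic_shift_any) (auto simp: per beta_per intro: hint)
  ultimately show ?thesis by simp
qed

text \<open>If the deficit were larger, \<open>\<integral> (\<gamma>\<^sup>2 - \<beta>\<^sup>2)\<close> would be at most \<open>2 pi (1 - \<epsilon>)\<close>, and the isoperimetric bound with this value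
  would make the left-hand side of the hypothesis at most \<open>pi\<^sup>2 (1 - \<epsilon>)\<close>.\<close>

lemma (in polar_body) deficit_le_of_p_affine_area:
  assumes p: "p \<ge> 1" and norm: "\<tau> pi = pi" and \<epsilon>: "0 < \<epsilon>" "\<epsilon> < 1"
    and big: "(p_affine_area p K powr (2 + p) / (2 powr (2 + p) * pi powr (2 - p))) powr (1 / p) > pi\<^sup>2 * (1 - \<epsilon>)"
  shows "deficit \<le> pi * \<epsilon>"
proof (rule ccontr)
  assume "\<not> deficit \<le> pi * \<epsilon>"
  define B0 where "B0 = 2 * pi * (1 - \<epsilon>)"
  have B0: "B0 > 0" using \<epsilon> by (simp add: B0_def)
  have "integral {0..2*pi} (\<lambda>\<theta>. (\<gamma> \<theta>)\<^sup>2 - (\<beta> \<theta>)\<^sup>2) \<le> B0"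
    using \<open>\<not> deficit \<le> pi * \<epsilon>\<close> deficit_eq[OF norm] by (simp add: B0_def algebra_simps)
  from p_affine_area_le[OF p norm this B0]
  have le: "p_affine_area p K \<le> (2 * pi) powr (2 / (2 + p)) * B0 powr (p / (2 + p))" .
  have nn: "0 \<le> p_affine_area p K"
    unfolding p_affine_area_def set_lebesgue_integral_def by (intro integral_nonneg_AE) auto
  have "p_affine_area p K powr (2 + p) \<le> ((2 * pi) powr (2 / (2 + p)) * B0 powr (p / (2 + p))) powr (2 + p)"
    using nn le p by (intro powr_mono2) auto
  also have "\<dots> = (2 * pi) powr 2 * B0 powr p"
  proof -
    have e: "2 / (2 + p) * (2 + p) = 2" "p / (2 + p) * (2 + p) = p"
      using p by (intro nonzero_eq_divide_eq[THEN iffD1, OF _ refl]; linarith)+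
    show ?thesis by (subst powr_mult) (simp only: powr_powr e)
  qed
  finally have "p_affine_area p K powr (2 + p) / (2 powr (2 + p) * pi powr (2 - p))
      \<le> (2 * pi) powr 2 * B0 powr p / (2 powr (2 + p) * pi powr (2 - p))"
    by (intro divide_right_mono) auto
  also have "\<dots> = (pi\<^sup>2 * (1 - \<epsilon>)) powr p"
  proof -
    have "(2 * pi) powr 2 * B0 powr p = (2 powr 2 * 2 powr p) * (pi powr 2 * pi powr p) * (1 - \<epsilon>) powr p"
      using \<epsilon> by (simp add: B0_def powr_mult del: powr_numeral)
    also have "2 powr 2 * 2 powr p = (2 :: real) powr (2 + p)" by (simp only: powr_add)
    also have "pi powr 2 * pi powr p = pi powr (2 - p) * pi powr (2 * p)"
      by (simp only: powr_add[symmetric]) (rule arg_cong[where f = "\<lambda>x. pi powr x"], simp)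
    finally have "(2 * pi) powr 2 * B0 powr p / (2 powr (2 + p) * pi powr (2 - p)) = pi powr (2 * p) * (1 - \<epsilon>) powr p"
      by simp
    also have "pi powr (2 * p) = (pi\<^sup>2) powr p"
    proof -
      have "(pi\<^sup>2) powr p = (pi powr 2) powr p" by (simp add: powr_numeral)
      then show ?thesis by (simp only: powr_powr)
    qed
    finally show ?thesis using \<epsilon> by (simp add: powr_mult)
  qed
  finally have "(p_affine_area p K powr (2 + p) / (2 powr (2 + p) * pi powr (2 - p))) powr (1 / p)
      \<le> ((pi\<^sup>2 * (1 - \<epsilon>)) powr p) powr (1 / p)"
    using p by (intro powr_mono2) auto
  also have "\<dots> = pi\<^sup>2 * (1 - \<epsilon>)" using p \<epsilon> by (simp add: powr_powr)
  finally show False using big by simp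
qed

theorem theorem1p1:
  fixes p c1 c2 :: real
  assumes p: "p \<ge> 1"
    and c: "john_constants c1 c2"
  shows "\<exists>\<epsilon>p>0. \<exists>Cp>0. \<forall>K. convex_body K \<and> origin_symmetric K \<and> area K = pi \<longrightarrow>
    (\<forall>\<epsilon>. 0 < \<epsilon> \<and> \<epsilon> < \<epsilon>p \<and>
      (p_affine_area p K powr (2 + p) / (2 powr (2 + p) * area K powr (2 - p))) powr (1 / p)
        > pi\<^sup>2 * (1 - \<epsilon>) \<longrightarrow>
      (\<exists>D E T. is_disk D \<and> is_ellipse E \<and> special_linear T \<and>
        E \<subseteq> mat_image T K \<and>
        mat_image T K
          \<subseteq> scaled_set (1 + (4/3) powr (3/4) * (2 * c2 / c1\<^sup>2) * \<epsilon> powr (3/10)) D \<and>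
        hausdorff_distance E
          (scaled_set (1 + (4/3) powr (3/4) * (2 * c2 / c1\<^sup>2) * \<epsilon> powr (3/10)) D)
          < Cp * \<epsilon> powr (3/10) \<and>
        hausdorff_distance (mat_image T K) E < Cp * \<epsilon> powr (3/10)))"
proof -
  \<comment> \<open>Small enough that \<open>\<delta> \<le> 2 \<kappa> sqrt \<epsilon> \<le> 1/100\<close> in the estimates below.\<close>
  define \<epsilon>p where "\<epsilon>p = min 1 ((1 / (200 * \<kappa>))\<^sup>2)"
  have \<epsilon>p: "\<epsilon>p > 0" using kappa_pos by (simp add: \<epsilon>p_def)
  have Cp: "225 * \<kappa> > 0" using kappa_pos by simp
  show ?thesis
  proof (rule exI[of _ \<epsilon>p], rule conjI[OF \<epsilon>p], rule exI[of _ "225 * \<kappa>"], rule conjI[OF Cp], intro allI impI, goal_cases)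
    case (1 K \<epsilon>)
    note K = 1(1) and h = 1(2)
    then have \<epsilon>: "0 < \<epsilon>" "\<epsilon> < 1" "\<epsilon> < (1 / (200 * \<kappa>))\<^sup>2" by (auto simp: \<epsilon>p_def)
    obtain \<gamma> m M where "polar_body \<gamma> m M K" using polar_body_of_convex_body K by blast
    then interpret polar_body \<gamma> m M K .
    have norm: "\<tau> pi = pi" using area_eq_tau K by simp
    have def: "deficit \<le> pi * \<epsilon>"
      using deficit_le_of_p_affine_area[OF p norm \<epsilon>(1,2)] h K by simp
    define \<delta> where "\<delta> = exp (\<kappa> * sqrt \<epsilon>) - 1"
    have "sqrt \<epsilon> < 1 / (200 * \<kappa>)"
      using \<epsilon> kappa_pos by (intro real_less_lsqrt) auto
    then have ks: "\<kappa> * sqrt \<epsilon> < 1 / 200" "0 \<le> \<kappa> * sqrt \<epsilon>"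
      using kappa_pos \<epsilon> by (auto simp: field_simps)
    have \<delta>: "\<delta> \<le> 2 * (\<kappa> * sqrt \<epsilon>)" "0 \<le> \<delta>"
    proof -
      have "exp (\<kappa> * sqrt \<epsilon>) \<le> 1 + \<kappa> * sqrt \<epsilon> + (\<kappa> * sqrt \<epsilon>)\<^sup>2"
        using ks by (intro exp_bound) auto
      moreover have "(\<kappa> * sqrt \<epsilon>)\<^sup>2 \<le> \<kappa> * sqrt \<epsilon> * 1"
        unfolding power2_eq_square using ks by (intro mult_left_mono) auto
      ultimately show "\<delta> \<le> 2 * (\<kappa> * sqrt \<epsilon>)" by (simp add: \<delta>_def)
      show "0 \<le> \<delta>" using ks by (simp add: \<delta>_def)
    qed
    have \<delta>small: "\<delta> \<le> 1/100" using \<delta> ks by simp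
    obtain T r where T: "special_linear T" "0 < r" "r \<le> 2"
      "cball 0 (r * (1 - 28 * \<delta>)) \<subseteq> mat_image T K" "mat_image T K \<subseteq> cball 0 (r * (1 + 28 * \<delta>))"
      using near_round[OF _ norm def \<epsilon>(1)] \<delta>small K unfolding \<delta>_def by metis
    define r1 r2 where "r1 = r * (1 - 28 * \<delta>)" and "r2 = r * (1 + 28 * \<delta>)"
    have r1: "r1 > 0" unfolding r1_def using T(2) \<delta>small by (intro mult_pos_pos) auto
    have r12: "r1 \<le> r2" unfolding r1_def r2_def using T(2) \<delta> by (intro mult_left_mono) auto
    have gap: "r2 - r1 < 225 * \<kappa> * \<epsilon> powr (3/10)"
    proof -
      have "r2 - r1 = r * (56 * \<delta>)" by (simp add: r1_def r2_def algebra_simps)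
      also have "\<dots> \<le> 2 * (56 * (2 * (\<kappa> * sqrt \<epsilon>)))"
        using T(2,3) \<delta> by (intro mult_mono) auto
      also have "\<dots> = 224 * \<kappa> * \<epsilon> powr (1/2)" using \<epsilon> by (simp add: powr_half_sqrt)
      also have "\<dots> \<le> 224 * \<kappa> * \<epsilon> powr (3/10)"
        using kappa_pos \<epsilon> by (intro mult_left_mono powr_mono') auto
      also have "\<dots> < 225 * \<kappa> * \<epsilon> powr (3/10)" using kappa_pos \<epsilon> by simp
      finally show ?thesis .
    qed
    define s where "s = 1 + (4/3) powr (3/4) * (2 * c2 / c1\<^sup>2) * \<epsilon> powr (3/10)"
    have "c1 > 0" "c2 > 0" using c by (auto simp: john_constants_def)
    then have s: "s > 0" unfolding s_def by (intro add_pos_nonneg mult_nonneg_nonneg divide_nonneg_nonneg) auto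
    \<comment> \<open>Both sets are centred at the origin; dividing the radius by \<open>s\<close> makes the enlarged disc have radius \<open>r2\<close>.\<close>
    define D E where "D = cball (0 :: real^2) (r2 / s)" and "E = cball (0 :: real^2) r1"
    have sD: "scaled_set s D = cball 0 r2" using s by (simp add: D_def cball_scale)
    have comp: "compact (mat_image T K)"
      by (intro compact_continuous_image K_compact linear_continuous_on matrix_vector_mul_bounded_linear)
    have "is_disk D" unfolding is_disk_def D_def using s r1 r12 by (intro exI[of _ 0] exI[of _ "r2 / s"]) auto
    moreover have "is_ellipse E"
    proof -
      have "invertible (r1 *\<^sub>R (mat 1 :: real^2^2))"
        using r1 by (simp add: invertible_det_nz det_2 mat_def)
      moreover have "E = (\<lambda>x. 0 + (r1 *\<^sub>R mat 1) *v x) ` cball 0 1"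
        using r1 cball_scale[of r1 "0::real^2" 1] by (simp add: E_def scaleR_matrix_vector_assoc[symmetric])
      ultimately show ?thesis unfolding is_ellipse_def by blast
    qed
    moreover have "E \<subseteq> mat_image T K" using T(4) by (simp add: E_def r1_def)
    moreover have "mat_image T K \<subseteq> scaled_set s D" unfolding sD using T(5) by (simp add: r2_def)
    moreover have "hausdorff_distance E (scaled_set s D) < 225 * \<kappa> * \<epsilon> powr (3/10)"
    proof -
      have "hausdorff_distance E (scaled_set s D) \<le> r2 - r1"
        unfolding sD E_def using r1 r12
        by (intro hausdorff_distance_le) (simp add: support_fun_cball_0)
      then show ?thesis using gap by simp
    qed
    moreover have "hausdorff_distance (mat_image T K) E < 225 * \<kappa> * \<epsilon> powr (3/10)"
    proof -
      have "hausdorff_distance (mat_image T K) E \<le> r2 - r1"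
      proof (rule hausdorff_distance_le)
        fix z :: "real^2" assume z: "norm z = 1"
        have "r1 \<le> support_fun (mat_image T K) z" "support_fun (mat_image T K) z \<le> r2"
          using support_fun_between_balls[OF comp r1 _ _ z] T(4,5) unfolding r1_def r2_def by blast+
        then show "\<bar>support_fun (mat_image T K) z - support_fun E z\<bar> \<le> r2 - r1"
          unfolding E_def support_fun_cball_0[OF r1 z] by simp
      qed
      then show ?thesis using gap by simp
    qed
    ultimately show ?case using T(1) unfolding s_def by blast
  qed
qed

end
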